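(* Let $M=(S^2;(p_i,q_i),\,1\le i\le n)$ be an orientable Seifert manifold fibered over $S^2$ with exceptional fibers of types $(p_i,q_i)$ such that (1) all $p_i$ are odd and (2) the number of odd $q_i$ is even. Denote by $Q_\ast=\sum_{i=1}^n q_i$ the sum of all $q_i$, and by $P_\ast$ any alternating sum of all those $p_i$ for which the corresponding $q_i$ is odd. Suppose that the integer $\xi(M)=(Q_\ast+P_\ast)/2$ is odd. Then there exists an essential element $x\in H^1(M;\mathbb{Z}_2)$, i.e. an element with $x^3\neq 0$ in $H^3(M;\mathbb{Z}_2)$.
   Context: Seifert manifolds. Let $n\ge 0$ and, for $1\le i\le n$, let $p_i\ge 2$ and $q_i$ be coprime integers. Choose disjoint closed discs $\delta_1,\dots,\delta_n\subset S^2$, put $\Sigma=S^2\setminus\bigcup_i \mathrm{Int}\,\delta_i$, fix orientations of $\Sigma$ and of $S^1$, and orient each circle $\partial\delta_i$ coherently, as a component of $\partial\Sigma$. Then $M=(S^2;(p_i,q_i),\,1\le i\le n)$ is the closed orientable 3-manifold obtained from $\Sigma\times S^1$ by gluing, for each $i$, a solid torus along the boundary torus $t_i=\partial\delta_i\times S^1$ so that its meridian is identified with a simple closed curve in $t_i$ of type $(p_i,q_i)$, i.e. representing $p_i[\partial\delta_i]+q_i[\ast\times S^1]\in H_1(t_i;\mathbb{Z})$. The cores of the glued solid tori are the exceptional fibers, of types $(p_i,q_i)$. The parameters $(p_i,q_i)$ are not assumed normalized. Alternating sum. If $i_1,\dots,i_{2k}$ are the indices (listed in any order) for which $q_i$ is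 odd, then $P_\ast=p_{i_1}-p_{i_2}+p_{i_3}-\dots-p_{i_{2k}}$ (and $P_\ast=0$ if there are no such indices). Essential elements. For a closed 3-manifold $M$, an element $x\in H^1(M;\mathbb{Z}_2)$ is called essential if its cup-product cube $x^3\in H^3(M;\mathbb{Z}_2)$ is nonzero. *)

theory Defs
  imports "HOL-Homology.Homology" "HOL-Library.Z2"
begin

section \<open>Singular cohomology with coefficients in the field of two elements\<close>

text \<open>
  A cochain is a function on all maps from coordinate space; it is required to vanish off
  the singular simplices of \<open>X\<close>, so that each cochain has exactly one representation.
\<close>

definition cochain_group ::
    "nat \<Rightarrow> 'a topology \<Rightarrow> (((nat \<Rightarrow> real) \<Rightarrow> 'a) \<Rightarrow> bit) monoid" where
  "cochain_group p X =
     \<lparr>carrier = {c. \<forall>\<sigma>. \<not> singular_simplex p X \<sigma> \<longrightarrow> c \<sigma> = 0},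
      mult = (\<lambda>c d \<sigma>. c \<sigma> + d \<sigma>),
      one = (\<lambda>\<sigma>. 0)\<rparr>"

definition coboundary ::
    "nat \<Rightarrow> 'a topology \<Rightarrow> (((nat \<Rightarrow> real) \<Rightarrow> 'a) \<Rightarrow> bit) \<Rightarrow> ((nat \<Rightarrow> real) \<Rightarrow> 'a) \<Rightarrow> bit" where
  "coboundary p X c =
     (\<lambda>\<sigma>. if singular_simplex (Suc p) X \<sigma> then \<Sum>k\<le>Suc p. c (singular_face (Suc p) k \<sigma>) else 0)"

definition cocycles ::
    "nat \<Rightarrow> 'a topology \<Rightarrow> (((nat \<Rightarrow> real) \<Rightarrow> 'a) \<Rightarrow> bit) set" where
  "cocycles p X = {c \<in> carrier (cochain_group p X). coboundary p X c = (\<lambda>\<sigma>. 0)}"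

definition coboundaries ::
    "nat \<Rightarrow> 'a topology \<Rightarrow> (((nat \<Rightarrow> real) \<Rightarrow> 'a) \<Rightarrow> bit) set" where
  "coboundaries p X =
     (if p = 0 then {\<lambda>\<sigma>. 0} else coboundary (p - 1) X ` carrier (cochain_group (p - 1) X))"

definition cohomology_group ::
    "nat \<Rightarrow> 'a topology \<Rightarrow> (((nat \<Rightarrow> real) \<Rightarrow> 'a) \<Rightarrow> bit) set monoid" where
  "cohomology_group p X =
     subgroup_generated (cochain_group p X) (cocycles p X) Mod coboundaries p X"

text \<open>
  The Alexander--Whitney cup product: \<open>front_face p \<sigma>\<close> restricts \<open>\<sigma>\<close> to the face spanned by
  the first \<open>p + 1\<close> vertices, and \<open>back_face p q \<sigma>\<close> restricts a \<open>(p + q)\<close>-simplex \<open>\<sigma>\<close> to the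
  face spanned by the vertices \<open>p, \<dots>, p + q\<close>.
\<close>

definition front_face :: "nat \<Rightarrow> ((nat \<Rightarrow> real) \<Rightarrow> 'a) \<Rightarrow> (nat \<Rightarrow> real) \<Rightarrow> 'a" where
  "front_face p \<sigma> = restrict \<sigma> (standard_simplex p)"

definition back_face :: "nat \<Rightarrow> nat \<Rightarrow> ((nat \<Rightarrow> real) \<Rightarrow> 'a) \<Rightarrow> (nat \<Rightarrow> real) \<Rightarrow> 'a" where
  "back_face p q \<sigma> =
     restrict (\<lambda>t. \<sigma> (\<lambda>i. if i < p then 0 else t (i - p))) (standard_simplex q)"

definition cochain_cup ::
    "nat \<Rightarrow> nat \<Rightarrow> 'a topology \<Rightarrow> (((nat \<Rightarrow> real) \<Rightarrow> 'a) \<Rightarrow> bit) \<Rightarrow> (((nat \<Rightarrow> real) \<Rightarrow> 'a) \<Rightarrow> bit)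
       \<Rightarrow> ((nat \<Rightarrow> real) \<Rightarrow> 'a) \<Rightarrow> bit" where
  "cochain_cup p q X c d =
     (\<lambda>\<sigma>. if singular_simplex (p + q) X \<sigma> then c (front_face p \<sigma>) * d (back_face p q \<sigma>) else 0)"

text \<open>
  Cohomology classes are cosets of coboundaries.  The product of two classes is the union of the classes of all products of representatives, which all coincide.
\<close>

definition cup ::
    "nat \<Rightarrow> nat \<Rightarrow> 'a topology \<Rightarrow> (((nat \<Rightarrow> real) \<Rightarrow> 'a) \<Rightarrow> bit) set
       \<Rightarrow> (((nat \<Rightarrow> real) \<Rightarrow> 'a) \<Rightarrow> bit) set \<Rightarrow> (((nat \<Rightarrow> real) \<Rightarrow> 'a) \<Rightarrow> bit) set" where
  "cup p q X x y =
     (\<Union>c\<in>x. \<Union>d\<in>y. coboundaries (p + q) X #>\<^bsub>cochain_group (p + q) X\<^esub> cochain_cup p q X c d)"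

definition essential :: "'a topology \<Rightarrow> (((nat \<Rightarrow> real) \<Rightarrow> 'a) \<Rightarrow> bit) set \<Rightarrow> bool" where
  "essential M x \<longleftrightarrow>
     x \<in> carrier (cohomology_group 1 M) \<and>
     cup 2 1 M (cup 1 1 M x x) x \<noteq> \<one>\<^bsub>cohomology_group 3 M\<^esub>"


section \<open>Adjunction spaces\<close>

text \<open>
  \<open>adjunction_space A B C f\<close> is the space obtained by attaching \<open>B\<close> to \<open>A\<close> along the map \<open>f\<close>
  from \<open>C \<subseteq> topspace B\<close> to \<open>A\<close>.  Its points are the points of \<open>A\<close> and the points of \<open>B\<close> outside
  \<open>C\<close>, and it carries the quotient topology for the canonical map from the disjoint union of \<open>A\<close>
  and \<open>B\<close>, which is \<^const>\<open>Inl\<close> on \<open>A\<close> and \<open>attach_map C f\<close> on \<open>B\<close>.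
\<close>

definition attach_map :: "'b set \<Rightarrow> ('b \<Rightarrow> 'a) \<Rightarrow> 'b \<Rightarrow> 'a + 'b" where
  "attach_map C f b = (if b \<in> C then Inl (f b) else Inr b)"

definition adjunction_space ::
    "'a topology \<Rightarrow> 'b topology \<Rightarrow> 'b set \<Rightarrow> ('b \<Rightarrow> 'a) \<Rightarrow> ('a + 'b) topology" where
  "adjunction_space A B C f = topology (\<lambda>U.
     U \<subseteq> Inl ` topspace A \<union> Inr ` (topspace B - C) \<and>
     openin A {a \<in> topspace A. Inl a \<in> U} \<and>
     openin B {b \<in> topspace B. attach_map C f b \<in> U})"

lemma openin_adjunction_space:
  "openin (adjunction_space A B C f) U \<longleftrightarrow>
     U \<subseteq> Inl ` topspace A \<union> Inr ` (topspace B - C) \<and>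
     openin A {a \<in> topspace A. Inl a \<in> U} \<and>
     openin B {b \<in> topspace B. attach_map C f b \<in> U}"
proof -
  have Int: "{x \<in> T. g x \<in> U \<inter> V} = {x \<in> T. g x \<in> U} \<inter> {x \<in> T. g x \<in> V}"
    and Un: "{x \<in> T. g x \<in> \<Union>\<K>} = (\<Union>K\<in>\<K>. {x \<in> T. g x \<in> K})"
    for T :: "'c set" and g :: "'c \<Rightarrow> 'd" and U V \<K>
    by auto
  have "istopology (\<lambda>U.
     U \<subseteq> Inl ` topspace A \<union> Inr ` (topspace B - C) \<and>
     openin A {a \<in> topspace A. Inl a \<in> U} \<and>
     openin B {b \<in> topspace B. attach_map C f b \<in> U})"
    unfolding istopology_def Int Un by blast
  then show ?thesis
    by (simp add: adjunction_space_def)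
qed

lemma topspace_adjunction_space:
  assumes "f ` (C \<inter> topspace B) \<subseteq> topspace A"
  shows "topspace (adjunction_space A B C f) = Inl ` topspace A \<union> Inr ` (topspace B - C)"
proof
  have "{a \<in> topspace A. Inl a \<in> Inl ` topspace A \<union> Inr ` (topspace B - C)} = topspace A"
    by auto
  moreover have "{b \<in> topspace B. attach_map C f b \<in> Inl ` topspace A \<union> Inr ` (topspace B - C)}
      = topspace B"
    using assms by (auto simp: attach_map_def)
  ultimately have "openin (adjunction_space A B C f) (Inl ` topspace A \<union> Inr ` (topspace B - C))"
    by (simp add: openin_adjunction_space)
  then show "Inl ` topspace A \<union> Inr ` (topspace B - C) \<subseteq> topspace (adjunction_space A B C f)"
    by (rule openin_subset)
  show "topspace (adjunction_space A B C f) \<subseteq> Inl ` topspace A \<union> Inr ` (topspace B - C)"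
    using openin_topspace openin_adjunction_space by blast
qed


section \<open>Seifert manifolds fibred over the sphere\<close>

abbreviation circle :: "complex topology" where
  "circle \<equiv> top_of_set (sphere 0 1)"

abbreviation disc :: "complex topology" where
  "disc \<equiv> top_of_set (cball 0 1)"

definition group_generator :: "('a, 'b) monoid_scheme \<Rightarrow> 'a \<Rightarrow> bool" where
  "group_generator G g \<longleftrightarrow> g \<in> carrier G \<and> subgroup_generated G {g} = G"

text \<open>
  The discs in the sphere are the images of the closed unit disc under the embeddings \<open>e i\<close>;
  \<open>boundary_circle e i\<close> and \<open>e i ` ball 0 1\<close> are the boundary and the interior of the \<open>i\<close>-th disc.
\<close>

definition disjoint_discs :: "nat \<Rightarrow> (nat \<Rightarrow> complex \<Rightarrow> real^3) \<Rightarrow> bool" where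
  "disjoint_discs n e \<longleftrightarrow>
     (\<forall>i\<in>{1..n}. continuous_on (cball 0 1) (e i) \<and> inj_on (e i) (cball 0 1) \<and>
        e i ` cball 0 1 \<subseteq> sphere 0 1) \<and>
     disjoint_family_on (\<lambda>i. e i ` cball 0 1) {1..n}"

definition boundary_circle :: "(nat \<Rightarrow> complex \<Rightarrow> real^3) \<Rightarrow> nat \<Rightarrow> (real^3) set" where
  "boundary_circle e i = e i ` sphere 0 1"

definition holed_sphere :: "nat \<Rightarrow> (nat \<Rightarrow> complex \<Rightarrow> real^3) \<Rightarrow> (real^3) topology" where
  "holed_sphere n e = top_of_set (sphere 0 1 - (\<Union>i\<in>{1..n}. e i ` ball 0 1))"

definition holed_sphere_boundary :: "nat \<Rightarrow> (nat \<Rightarrow> complex \<Rightarrow> real^3) \<Rightarrow> (real^3) set" where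
  "holed_sphere_boundary n e = (\<Union>i\<in>{1..n}. boundary_circle e i)"

text \<open>
  An orientation of the circle is a generator \<open>\<zeta>\<close> of its first homology group, and an
  orientation of the holed sphere is a generator \<open>\<mu>\<close> of its second homology group relative to
  the boundary.  The boundary circles, parametrised by the restrictions of the \<open>e i\<close>, carry
  the boundary orientation if the boundary of \<open>\<mu>\<close> is the sum of the images of \<open>\<zeta>\<close>.
  (The homology groups are written multiplicatively.)
\<close>

definition coherently_oriented ::
    "nat \<Rightarrow> (nat \<Rightarrow> complex \<Rightarrow> real^3) \<Rightarrow> complex chain set \<Rightarrow> (real^3) chain set \<Rightarrow> bool" where
  "coherently_oriented n e \<zeta> \<mu> \<longleftrightarrow>
     (let \<Sigma> = holed_sphere n e; B = holed_sphere_boundary n e in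
        group_generator (homology_group 1 circle) \<zeta> \<and>
        group_generator (relative_homology_group 2 \<Sigma> B) \<mu> \<and>
        hom_boundary 2 \<Sigma> B \<mu> =
          (\<Otimes>\<^bsub>homology_group 1 (subtopology \<Sigma> B)\<^esub> i\<in>{1..n}.
             hom_induced 1 circle {} (subtopology \<Sigma> B) {} (e i) \<zeta>))"

definition boundary_torus :: "(nat \<Rightarrow> complex \<Rightarrow> real^3) \<Rightarrow> nat \<Rightarrow> ((real^3) \<times> complex) topology" where
  "boundary_torus e i = prod_topology (top_of_set (boundary_circle e i)) circle"

text \<open>
  The boundary torus of the \<open>i\<close>-th solid torus is glued by \<open>\<phi> i\<close>.  The class of the image of its
  meridian \<open>z \<mapsto> (z, 1)\<close> is \<open>p i\<close> times the class of the boundary circle \<open>z \<mapsto> (e i z, 1)\<close> plus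
  \<open>q i\<close> times the class of the fibre \<open>z \<mapsto> (e i 1, z)\<close>.
\<close>

definition seifert_gluing ::
    "nat \<Rightarrow> (nat \<Rightarrow> int) \<Rightarrow> (nat \<Rightarrow> int) \<Rightarrow> (nat \<Rightarrow> complex \<Rightarrow> real^3) \<Rightarrow> complex chain set
       \<Rightarrow> (nat \<Rightarrow> complex \<times> complex \<Rightarrow> (real^3) \<times> complex) \<Rightarrow> bool" where
  "seifert_gluing n p q e \<zeta> \<phi> \<longleftrightarrow>
     (\<forall>i\<in>{1..n}.
        let T = boundary_torus e i; H = homology_group 1 T;
            cls = (\<lambda>\<gamma>. hom_induced 1 circle {} T {} \<gamma> \<zeta>) in
        homeomorphic_map (prod_topology circle circle) T (\<phi> i) \<and>
        cls (\<lambda>z. \<phi> i (z, 1)) =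
          cls (\<lambda>z. (e i z, 1)) [^]\<^bsub>H\<^esub> p i \<otimes>\<^bsub>H\<^esub> cls (\<lambda>z. (e i 1, z)) [^]\<^bsub>H\<^esub> q i)"

definition seifert_space ::
    "nat \<Rightarrow> (nat \<Rightarrow> complex \<Rightarrow> real^3) \<Rightarrow> (nat \<Rightarrow> complex \<times> complex \<Rightarrow> (real^3) \<times> complex)
       \<Rightarrow> (((real^3) \<times> complex) + (nat \<times> complex \<times> complex)) topology" where
  "seifert_space n e \<phi> =
     adjunction_space
       (prod_topology (holed_sphere n e) circle)
       (sum_topology (\<lambda>i. prod_topology disc circle) {1..n})
       ({1..n} \<times> sphere 0 1 \<times> sphere 0 1)
       (\<lambda>(i, y). \<phi> i y)"

text \<open>\<open>seifert_manifold M n p q\<close>: the space \<open>M\<close> is \<open>(S\<^sup>2; (p i, q i), 1 \<le> i \<le> n)\<close>.\<close>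

definition seifert_manifold ::
    "'a topology \<Rightarrow> nat \<Rightarrow> (nat \<Rightarrow> int) \<Rightarrow> (nat \<Rightarrow> int) \<Rightarrow> bool" where
  "seifert_manifold M n p q \<longleftrightarrow>
     (\<forall>i\<in>{1..n}. p i \<ge> 2 \<and> coprime (p i) (q i)) \<and>
     (\<exists>e \<zeta> \<mu> \<phi>. disjoint_discs n e \<and> coherently_oriented n e \<zeta> \<mu> \<and>
        seifert_gluing n p q e \<zeta> \<phi> \<and> M homeomorphic_space seifert_space n e \<phi>)"

end

theory Submission
  imports Defs "HOL-Complex_Analysis.Complex_Analysis"
begin

text \<open>
  Write $M$ as $A = \Sigma\times S^1$ with solid tori $V_i$ glued in. Choose integers $d_i$ with $\sum_i d_i = 0$
  that are the alternating signs where $q_i$ is odd and $0$ elsewhere, and $f\colon\Sigma\to\mathbb C^*$ of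
  degree $d_i$ on $\partial\delta_i$. The function $G(x,z)=f(x)z$ on $A$ has even degree $p_id_i+q_i$ on the
  $i$-th meridian, so up to a power of the core coordinate it is a square $s^2$ there; the punctured cone
  $C=\{(a^2,ab,b^2)\}$ gives enough room to extend $(G,0,0)$ over $V_i$. The resulting $F\colon M\to C$ and the double
  cover $\mathbb C^2\setminus 0\to C$ yield a class $c\in H^1(M;\mathbb Z_2)$.

  On $A$ and on each $V_i$ the cocycle $c$ lifts to integral cocycles $g$ and $r_i$. With $\nu=\lfloor g/2\rfloor$
  mod $2$ one has $\delta\nu=c\cup c$, so $c^3=\delta(\nu\cup c)$ on each piece. If $c^3=\delta w$ on $M$,
  then $D=w+\nu\cup c$ is a cocycle on $A$, and likewise on $V_i$ with $r_i$ for $g$. The prisms over the circles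
  $\partial\delta_i$ are the tori $t_i$; together they bound in $A$, whereas each one bounds in $V_i$.
  Comparing both lifts on $t_i$ gives $\langle D,t_i\rangle=(q_i+d_ip_i)/2$ mod $2$, hence
  $\xi(M)=\sum_i(q_i+d_ip_i)/2$ is even, a contradiction.
\<close>

subsection \<open>Edges and triangles of singular simplices\<close>

text \<open>The punctured cone is the quotient of \<open>C^2 - 0\<close> by the sign, hence homotopy
  equivalent to RP^3, and \<open>c\<close> is the pullback of the generator of its first cohomology;
  the cube of \<open>c\<close> is the degree of \<open>F\<close> modulo 2. Instead of a fundamental
  class of \<open>M\<close>, the cochain argument uses a 2-chain on the holed sphere that bounds the
  circles, and the vanishing second homology of a solid torus. Nonzero complex numbers would be too
  small a target: extending over a solid torus would force the meridian degree to be 0. In RP^3 a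
  loop of even degree contracts, and evenness is what odd \<open>p i\<close> and the choice of
  \<open>d i\<close> provide. The condition that the \<open>d i\<close> sum to 0 is the degree
  relation for \<open>f\<close> on a surface; alternating signs meet it because the number of odd
  \<open>q i\<close> is even. If the cube is nonzero, \<open>c\<close> has no integral lift over
  \<open>M\<close>, so lifts exist only piecewise. On the pair (boundary circle, fibre) the lift
  \<open>g\<close> has the values (\<open>d i\<close>, 1), while \<open>r i\<close> vanishes on the
  meridian and so has an odd multiple of (\<open>q i\<close>, \<open>- p i\<close>). Both reduce to
  \<open>c\<close>, but their halves differ, and that difference is what the tori detect.\<close>

definition edge_point :: "real \<Rightarrow> nat \<Rightarrow> real" where
  "edge_point t = (\<lambda>i. if i = 0 then 1 - t else if i = 1 then t else 0)"

text \<open>Vertices 0, 1, 2 sit at \<open>(0, 0)\<close>, \<open>(1, 0)\<close>,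
  \<open>(0, 1)\<close>, so the edges 01, 02, 12 become the paths \<open>(t, 0)\<close>,
  \<open>(0, t)\<close>, \<open>(1 - t, t)\<close> that recur below.\<close>

definition triangle_point :: "real \<times> real \<Rightarrow> nat \<Rightarrow> real" where
  "triangle_point = (\<lambda>(s, t) i. if i = 0 then 1 - s - t else if i = 1 then s else if i = 2 then t else 0)"

definition std_triangle :: "(real \<times> real) set" where
  "std_triangle = {(s, t). 0 \<le> s \<and> 0 \<le> t \<and> s + t \<le> 1}"

lemma edge_point_in_simplex [simp]: "0 \<le> t \<Longrightarrow> t \<le> 1 \<Longrightarrow> edge_point t \<in> standard_simplex (Suc 0)"
  by (auto simp: edge_point_def standard_simplex_def)

lemma sum_atMost_2: "(\<Sum>i\<le>(2::nat). f i) = f 0 + f 1 + f 2"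
  by (simp add: numeral_2_eq_2)

lemma triangle_point_in_simplex: "z \<in> std_triangle \<Longrightarrow> triangle_point z \<in> standard_simplex 2"
  by (cases z) (auto simp: triangle_point_def std_triangle_def standard_simplex_def sum_atMost_2)

lemma continuous_map_edge_point:
  "continuous_map (top_of_set {0..1}) (subtopology (powertop_real UNIV) (standard_simplex 1)) edge_point"
  unfolding continuous_map_in_subtopology
proof
  show "continuous_map (top_of_set {0..1}) (powertop_real UNIV) edge_point"
  proof -
    have "continuous_on {0..1} (\<lambda>t. edge_point t i)" for i
      unfolding edge_point_def by (cases "i = 0"; cases "i = 1") (auto intro!: continuous_intros)
    then show ?thesis
      unfolding continuous_map_componentwise by (simp add: extensional_def)
  qed
qed auto

lemma continuous_map_triangle_point:
  "continuous_map (top_of_set std_triangle) (subtopology (powertop_real UNIV) (standard_simplex 2)) triangle_point"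
  unfolding continuous_map_in_subtopology
proof
  have "continuous_on std_triangle (\<lambda>z. triangle_point z i)" for i
    unfolding triangle_point_def case_prod_beta
    by (cases "i = 0"; cases "i = 1"; cases "i = 2") (auto intro!: continuous_intros)
  then show "continuous_map (top_of_set std_triangle) (powertop_real UNIV) triangle_point"
    unfolding continuous_map_componentwise by (simp add: extensional_def)
qed (auto intro: triangle_point_in_simplex)

lemma continuous_map_simplex_edge:
  assumes "singular_simplex 1 X \<sigma>"
  shows "continuous_map (top_of_set {0..1}) X (\<lambda>t. \<sigma> (edge_point t))"
  using continuous_map_compose[OF continuous_map_edge_point, of X \<sigma>] assms
  by (simp add: singular_simplex_def o_def)

lemma continuous_map_simplex_triangle:
  assumes "singular_simplex 2 X \<sigma>"
  shows "continuous_map (top_of_set std_triangle) X (\<lambda>z. \<sigma> (triangle_point z))"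
  using continuous_map_compose[OF continuous_map_triangle_point, of X \<sigma>] assms
  by (simp add: singular_simplex_def o_def)

lemma singular_face_edge_point:
  assumes "t \<in> {0..1}"
  shows "singular_face 2 0 \<sigma> (edge_point t) = \<sigma> (triangle_point (1 - t, t))"
    and "singular_face 2 (Suc 0) \<sigma> (edge_point t) = \<sigma> (triangle_point (0, t))"
    and "singular_face 2 2 \<sigma> (edge_point t) = \<sigma> (triangle_point (t, 0))"
proof -
  have *: "edge_point t \<in> standard_simplex (Suc 0)" using assms by simp
  have "simplical_face 0 (edge_point t) = triangle_point (1 - t, t)"
    "simplical_face (Suc 0) (edge_point t) = triangle_point (0, t)"
    "simplical_face 2 (edge_point t) = triangle_point (t, 0)"
    by (auto simp: simplical_face_def edge_point_def triangle_point_def fun_eq_iff)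
  then show "singular_face 2 0 \<sigma> (edge_point t) = \<sigma> (triangle_point (1 - t, t))"
    and "singular_face 2 (Suc 0) \<sigma> (edge_point t) = \<sigma> (triangle_point (0, t))"
    and "singular_face 2 2 \<sigma> (edge_point t) = \<sigma> (triangle_point (t, 0))"
    using * by (simp_all add: singular_face_def)
qed

definition path_simplex :: "(real \<Rightarrow> 'a) \<Rightarrow> (nat \<Rightarrow> real) \<Rightarrow> 'a" where
  "path_simplex g = restrict (\<lambda>x. g (x 1)) (standard_simplex 1)"

lemma path_simplex_edge_point [simp]:
  "t \<in> {0..1} \<Longrightarrow> path_simplex g (edge_point t) = g t"
  using edge_point_in_simplex[of t] unfolding path_simplex_def by (simp add: edge_point_def)

lemma singular_simplex_path_simplex:
  assumes "continuous_map (top_of_set {0..1}) X g"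
  shows "singular_simplex 1 X (path_simplex g)"
proof -
  have "continuous_map (subtopology (powertop_real UNIV) (standard_simplex 1)) (top_of_set {0..1}) (\<lambda>x. x 1)"
    unfolding continuous_map_in_subtopology
    by (auto simp: standard_simplex_def intro!: continuous_map_from_subtopology
        continuous_map_product_projection)
  from continuous_map_compose[OF this assms]
  show ?thesis
    unfolding singular_simplex_def path_simplex_def by (simp add: o_def)
qed

subsection \<open>Logarithms along paths\<close>

text \<open>Meaningful only for nonvanishing continuous paths; the difference does not depend on the chosen logarithm.\<close>

definition log_diff :: "(real \<Rightarrow> complex) \<Rightarrow> complex" where
  "log_diff \<gamma> = (let L = SOME L. continuous_on {0..1} L \<and> (\<forall>t\<in>{0..1}. \<gamma> t = exp (L t)) in L 1 - L 0)"

text \<open>Translated to agree at 0, both functions lift one path through the covering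
  \<open>exp\<close>, hence agree everywhere.\<close>

lemma log_diff_unique:
  fixes L L' :: "real \<Rightarrow> complex"
  assumes "continuous_on {0..1} L" "continuous_on {0..1} L'"
    and "\<And>t. t \<in> {0..1} \<Longrightarrow> exp (L t) = exp (L' t)"
  shows "L 1 - L 0 = L' 1 - L' 0"
proof -
  define M where "M t = L' t + (L 0 - L' 0)" for t
  have "L 1 = M 1"
  proof (rule covering_space_lift_unique[OF covering_space_exp_punctured_plane,
        where a = 0 and T = "{0..1}" and f = "\<lambda>t. exp (L t)"])
    fix x :: real assume x: "x \<in> {0..1}"
    have "exp (L 0 - L' 0) = 1"
      using assms(3)[of 0] by (simp add: exp_diff)
    then show "exp (L x) = exp (M x)"
      using assms(3)[OF x] by (simp add: M_def exp_add)
  qed (use assms in \<open>auto simp: M_def intro!: continuous_intros\<close>)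
  then show ?thesis by (simp add: M_def)
qed

lemma log_diff_eq:
  assumes "continuous_on {0..1} L" "\<And>t. t \<in> {0..1} \<Longrightarrow> \<gamma> t = exp (L t)"
  shows "log_diff \<gamma> = L 1 - L 0"
proof -
  define L' where "L' = (SOME L. continuous_on {0..1} L \<and> (\<forall>t\<in>{0..1}. \<gamma> t = exp (L t)))"
  have "continuous_on {0..1} L' \<and> (\<forall>t\<in>{0..1}. \<gamma> t = exp (L' t))"
    unfolding L'_def by (rule someI[of _ L]) (use assms in auto)
  then have "L' 1 - L' 0 = L 1 - L 0"
    using assms by (intro log_diff_unique) auto
  then show ?thesis by (simp add: log_diff_def L'_def Let_def)
qed

lemma path_logarithm_exists:
  assumes "continuous_on {0..1::real} \<gamma>" "\<And>t. t \<in> {0..1} \<Longrightarrow> \<gamma> t \<noteq> (0::complex)"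
  obtains L where "continuous_on {0..1} L" "\<And>t. t \<in> {0..1} \<Longrightarrow> \<gamma> t = exp (L t)"
  using continuous_logarithm_on_contractible[of "{0..1}" \<gamma>] assms
  by (metis convex_imp_contractible convex_real_interval(5))

lemma log_diff_mult:
  assumes "continuous_on {0..1} \<gamma>" "\<And>t. t \<in> {0..1} \<Longrightarrow> \<gamma> t \<noteq> 0"
    and "continuous_on {0..1} \<delta>" "\<And>t. t \<in> {0..1} \<Longrightarrow> \<delta> t \<noteq> 0"
  shows "log_diff (\<lambda>t. \<gamma> t * \<delta> t) = log_diff \<gamma> + log_diff \<delta>"
proof -
  obtain L where L: "continuous_on {0..1} L" "\<And>t. t \<in> {0..1} \<Longrightarrow> \<gamma> t = exp (L t)"
    using path_logarithm_exists assms(1,2) by blast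
  obtain L' where L': "continuous_on {0..1} L'" "\<And>t. t \<in> {0..1} \<Longrightarrow> \<delta> t = exp (L' t)"
    using path_logarithm_exists assms(3,4) by blast
  have "log_diff (\<lambda>t. \<gamma> t * \<delta> t) = (L 1 + L' 1) - (L 0 + L' 0)"
    by (rule log_diff_eq) (use L L' in \<open>auto simp: exp_add intro!: continuous_intros\<close>)
  then show ?thesis
    using log_diff_eq[OF L] log_diff_eq[OF L'] by simp
qed

lemma exp_log_diff:
  assumes "continuous_on {0..1} \<gamma>" "\<And>t. t \<in> {0..1} \<Longrightarrow> \<gamma> t \<noteq> 0"
  shows "exp (log_diff \<gamma>) = \<gamma> 1 / \<gamma> 0"
proof -
  obtain L where L: "continuous_on {0..1} L" "\<And>t. t \<in> {0..1} \<Longrightarrow> \<gamma> t = exp (L t)"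
    using path_logarithm_exists assms by blast
  show ?thesis
    using log_diff_eq[OF L] L(2)[of 0] L(2)[of 1] by (simp add: exp_diff)
qed

lemma log_diff_cong:
  "(\<And>t. t \<in> {0..1} \<Longrightarrow> \<gamma> t = \<delta> t) \<Longrightarrow> log_diff \<gamma> = log_diff \<delta>"
  unfolding log_diff_def by (metis (lifting))

lemma convex_triangle: "convex std_triangle"
proof -
  have eq: "std_triangle = {z. 0 \<le> (1, 0) \<bullet> z} \<inter> {z. 0 \<le> (0, 1) \<bullet> z} \<inter> {z. (1, 1) \<bullet> z \<le> 1}"
    by (auto simp: std_triangle_def inner_prod_def)
  show ?thesis
    unfolding eq by (intro convex_Int convex_halfspace_le convex_halfspace_ge)
qed

lemma continuous_on_triangle_edges:
  assumes "continuous_on std_triangle g"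
  shows "continuous_on {0..1} (\<lambda>t. g (t, 0))" "continuous_on {0..1} (\<lambda>t. g (0, t))"
    "continuous_on {0..1} (\<lambda>t. g (1 - t, t))"
  by (rule continuous_on_compose2[OF assms]; auto simp: std_triangle_def intro!: continuous_intros)+

text \<open>The triangle is convex, so one logarithm serves all three edges and its vertex values
  telescope.\<close>

lemma log_diff_triangle:
  assumes "continuous_on std_triangle g" "\<And>z. z \<in> std_triangle \<Longrightarrow> g z \<noteq> 0"
  shows "log_diff (\<lambda>t. g (t, 0)) + log_diff (\<lambda>t. g (1 - t, t)) = log_diff (\<lambda>t. g (0, t))"
proof -
  obtain L where L: "continuous_on std_triangle L" "\<And>z. z \<in> std_triangle \<Longrightarrow> g z = exp (L z)"
    using continuous_logarithm_on_contractible[OF assms(1) convex_imp_contractible[OF convex_triangle]] assms(2)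
    by metis
  note c = continuous_on_triangle_edges[OF L(1)]
  have "log_diff (\<lambda>t. g (t, 0)) = L (1, 0) - L (0, 0)"
    "log_diff (\<lambda>t. g (1 - t, t)) = L (1 - 1, 1) - L (1 - 0, 0)"
    "log_diff (\<lambda>t. g (0, t)) = L (0, 1) - L (0, 0)"
    by (subst log_diff_eq[OF c(1)] log_diff_eq[OF c(2)] log_diff_eq[OF c(3)];
        use L(2) in \<open>auto simp: std_triangle_def\<close>)+
  then show ?thesis by simp
qed

subsection \<open>Holonomy of the double cover of the punctured cone\<close>

text \<open>The invariants of the sign change on \<open>C^2\<close>: the quotient map onto the
  quadric cone.\<close>

definition veronese :: "complex \<times> complex \<Rightarrow> complex \<times> complex \<times> complex" where
  "veronese = (\<lambda>(a, b). (a\<^sup>2, a * b, b\<^sup>2))"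

definition cone_scale :: "complex \<Rightarrow> complex \<times> complex \<times> complex \<Rightarrow> complex \<times> complex \<times> complex" where
  "cone_scale u = (\<lambda>(a, b, c). (u * a, u * b, u * c))"

lemma veronese_minus [simp]: "veronese (- v) = veronese v"
  by (cases v) (simp add: veronese_def)

lemma veronese_eq_iff: "veronese v = veronese w \<longleftrightarrow> v = w \<or> v = - w"
proof
  obtain a b c d where [simp]: "v = (a, b)" "w = (c, d)" by (meson surj_pair)
  assume "veronese v = veronese w"
  then have eq: "a\<^sup>2 = c\<^sup>2" "a * b = c * d" "b\<^sup>2 = d\<^sup>2"
    by (auto simp: veronese_def)
  from eq(1,3) have "a = c \<or> a = - c" "b = d \<or> b = - d"
    by (simp_all add: power2_eq_iff)
  with eq(2) show "v = w \<or> v = - w"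
    by auto
qed auto

text \<open>Scaling in the cone lifts to scaling by a square root upstairs; this is how turns of a
  scalar factor, counted modulo 2, become holonomy.\<close>

lemma veronese_scale: "veronese (a * fst v, a * snd v) = cone_scale (a\<^sup>2) (veronese v)"
  by (cases v) (simp add: veronese_def cone_scale_def power2_eq_square algebra_simps)

lemma square_nonpos_Reals_iff: "z\<^sup>2 \<in> \<real>\<^sub>\<le>\<^sub>0 \<longleftrightarrow> Re z = 0"
proof -
  have "Re z * Re z \<le> Im z * Im z \<and> (Im z = 0 \<or> Re z = 0) \<longleftrightarrow> Re z = 0"
    by (cases "Re z = 0") (auto simp: not_le mult_neg_neg zero_less_mult_iff)
  then show ?thesis
    by (simp add: complex_nonpos_Reals_iff power2_eq_square)
qed

text \<open>Near a nonzero vector, \<open>v\<close> and \<open>- v\<close> are told apart by the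
  sign of the real part of a linear form, which gives exactly two sheets.\<close>

lemma covering_space_veronese: "covering_space (- {0}) veronese (veronese ` (- {0}))"
proof -
  have cont: "continuous_on S veronese" for S
    unfolding veronese_def case_prod_beta by (intro continuous_intros)
  have "\<exists>T. veronese v0 \<in> T \<and> openin (top_of_set (veronese ` (- {0}))) T \<and>
          (\<exists>v. \<Union> v = - {0} \<inter> veronese -` T \<and>
              (\<forall>u\<in>v. openin (top_of_set (- {0})) u) \<and> pairwise disjnt v \<and>
              (\<forall>u\<in>v. \<exists>q. homeomorphism u T veronese q))"
    if "v0 \<noteq> 0" for v0
  proof -
    \<comment> \<open>With the linear form \<open>l = \<langle>\<cdot>, v0\<rangle> / |v0|\<^sup>2\<close>, the products \<open>l\<^sup>2\<close>, \<open>l a\<close>, \<open>l b\<close> are linear in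
      \<open>(a\<^sup>2, a b, b\<^sup>2)\<close>; where \<open>Re l > 0\<close>, dividing by \<open>csqrt (l\<^sup>2) = l\<close> recovers \<open>(a, b)\<close>.\<close>
    define N where "N = complex_of_real ((norm v0)\<^sup>2)"
    define \<alpha> \<beta> where "\<alpha> = cnj (fst v0) / N" and "\<beta> = cnj (snd v0) / N"
    define l where "l v = \<alpha> * fst v + \<beta> * snd v" for v
    define Q where "Q = (\<lambda>(A, B, C). \<alpha>\<^sup>2 * A + 2 * \<alpha> * \<beta> * B + \<beta>\<^sup>2 * C)"
    define g where "g x = (case x of (A, B, C) \<Rightarrow>
      ((\<alpha> * A + \<beta> * B) / csqrt (Q x), (\<alpha> * B + \<beta> * C) / csqrt (Q x)))" for x
    define S where "S = veronese ` (- {0})"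
    \<comment> \<open>The removed values are the branch cut of \<open>csqrt\<close>. As
      \<open>Q (veronese v)\<close> is the square of \<open>l v\<close>, they correspond to
      \<open>Re (l v) = 0\<close>, the wall between the two sheets.\<close>
    define T where "T = {x \<in> S. Q x \<notin> \<real>\<^sub>\<le>\<^sub>0}"
    define U1 U2 where "U1 = {v. Re (l v) > 0}" and "U2 = {v. Re (l v) < 0}"
    have N: "N \<noteq> 0" using that by (simp add: N_def)
    have Nq: "N = fst v0 * cnj (fst v0) + snd v0 * cnj (snd v0)"
      unfolding N_def complex_mult_cnj by (simp add: norm_prod_def cmod_def)
    have l0: "l v0 = 1"
    proof -
      have "l v0 = (fst v0 * cnj (fst v0) + snd v0 * cnj (snd v0)) / N"
        by (simp add: l_def \<alpha>_def \<beta>_def add_divide_distrib mult.commute)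
      then show ?thesis using N Nq by simp
    qed
    have lm: "l (- v) = - l v" for v by (simp add: l_def)
    have Ql: "Q (veronese v) = (l v)\<^sup>2" for v
      by (cases v) (simp add: Q_def veronese_def l_def power2_eq_square algebra_simps)
    have gv: "g (veronese v) = v" if "v \<in> U1" for v
    proof -
      have "csqrt ((l v)\<^sup>2) = l v" "l v \<noteq> 0"
        using that by (auto simp: U1_def csqrt_square)
      moreover obtain a b where [simp]: "v = (a, b)" by (meson surj_pair)
      have "\<alpha> * a\<^sup>2 + \<beta> * (a * b) = a * l v" "\<alpha> * (a * b) + \<beta> * b\<^sup>2 = b * l v"
        by (simp_all add: l_def power2_eq_square algebra_simps)
      ultimately show ?thesis
        unfolding g_def Ql by (simp add: veronese_def)
    qed
    have Tiff: "veronese v \<in> T \<longleftrightarrow> v \<in> U1 \<union> U2" if "v \<noteq> 0" for v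
      using that by (auto simp: T_def S_def Ql square_nonpos_Reals_iff U1_def U2_def)
    have U0: "0 \<notin> U1" "0 \<notin> U2" by (auto simp: U1_def U2_def l_def)
    have contl: "continuous_on UNIV l" unfolding l_def by (intro continuous_intros)
    have contQ: "continuous_on X Q" for X
      unfolding Q_def case_prod_beta by (intro continuous_intros)
    have op: "open U1" "open U2"
      unfolding U1_def U2_def using contl
      by (auto intro!: open_Collect_less continuous_intros)
    have contg: "continuous_on T g"
      unfolding g_def case_prod_beta
      by (intro continuous_intros continuous_on_compose2[OF continuous_on_csqrt contQ])
        (auto simp: T_def)
    have lift: "\<exists>v\<in>U1. x = veronese v" if xT: "x \<in> T" for x
    proof -
      have "x \<in> veronese ` (- {0})" using xT unfolding T_def S_def by blast
      then obtain v where v: "v \<noteq> 0" "x = veronese v" by blast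
      then have "v \<in> U1 \<or> v \<in> U2" using Tiff xT by auto
      then show ?thesis
      proof
        assume "v \<in> U2"
        then have "- v \<in> U1" by (simp add: U1_def U2_def lm)
        then show ?thesis using v by (metis veronese_minus)
      qed (use v in blast)
    qed
    have V1: "veronese ` U1 = T" and V2: "veronese ` U2 = T"
    proof -
      show "veronese ` U1 = T" using lift Tiff U0 by force
      moreover have "U2 = uminus ` U1"
      proof (intro equalityI subsetI)
        fix x assume "x \<in> U2"
        then have "- x \<in> U1" by (simp add: U1_def U2_def lm)
        then show "x \<in> uminus ` U1" by (metis image_eqI minus_minus)
      next
        fix x assume "x \<in> uminus ` U1"
        then obtain y where "y \<in> U1" "x = - y" by blast
        then show "x \<in> U2" by (simp add: U1_def U2_def lm)
      qed
      ultimately show "veronese ` U2 = T"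
        by (simp add: image_image)
    qed
    have h1: "homeomorphism U1 T veronese g"
    proof (rule homeomorphismI)
      show "g ` T \<subseteq> U1" using lift gv by fastforce
    qed (use cont contg gv lift V1 in auto)
    have h2: "homeomorphism U2 T veronese (\<lambda>x. - g x)"
    proof (rule homeomorphismI)
      show "(\<lambda>x. - g x) ` T \<subseteq> U2"
      proof (intro image_subsetI)
        fix x assume "x \<in> T"
        then obtain y where "y \<in> U1" "x = veronese y" using lift by blast
        then have "g x \<in> U1" using gv by simp
        then show "- g x \<in> U2" by (simp add: U1_def U2_def lm)
      qed
      show "- g (veronese v) = v" if "v \<in> U2" for v
        using gv[of "- v"] that by (simp add: U1_def U2_def lm)
      show "veronese (- g x) = x" if "x \<in> T" for x
        using lift[OF that] gv by auto
    qed (use cont contg V2 in \<open>auto intro!: continuous_intros\<close>)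
    have "openin (top_of_set S) T"
    proof -
      have "openin (top_of_set S) (S \<inter> Q -` (- \<real>\<^sub>\<le>\<^sub>0))"
        using contQ by (intro continuous_openin_preimage_gen) (auto simp: closed_nonpos_Reals_complex)
      moreover have "T = S \<inter> Q -` (- \<real>\<^sub>\<le>\<^sub>0)" by (auto simp: T_def)
      ultimately show ?thesis by simp
    qed
    moreover have "veronese v0 \<in> T"
      using Tiff[OF that] l0 by (simp add: U1_def)
    moreover have "\<Union>{U1, U2} = - {0} \<inter> veronese -` T"
    proof -
      have "v \<in> U1 \<union> U2 \<longleftrightarrow> v \<noteq> 0 \<and> veronese v \<in> T" for v
        using Tiff[of v] U0 by blast
      then show ?thesis unfolding vimage_def by blast
    qed
    moreover have "\<forall>u\<in>{U1, U2}. openin (top_of_set (- {0})) u"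
      using op U0 by (auto intro: open_subset)
    moreover have "pairwise disjnt {U1, U2}"
      by (auto simp: pairwise_def disjnt_def U1_def U2_def)
    moreover have "\<forall>u\<in>{U1, U2}. \<exists>q. homeomorphism u T veronese q"
      using h1 h2 by blast
    ultimately show ?thesis
      unfolding S_def by (intro exI[of _ T] conjI exI[of _ "{U1, U2}"])
  qed
  then have sheets: "v0 \<in> - {0} \<Longrightarrow> \<exists>T. veronese v0 \<in> T \<and> openin (top_of_set (veronese ` (- {0}))) T \<and>
          (\<exists>v. \<Union> v = - {0} \<inter> veronese -` T \<and>
              (\<forall>u\<in>v. openin (top_of_set (- {0})) u) \<and> pairwise disjnt v \<and>
              (\<forall>u\<in>v. \<exists>q. homeomorphism u T veronese q))" for v0
    by simp
  show ?thesis
    unfolding covering_space_def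
    by (intro conjI cont refl ballI, elim imageE, hypsubst, rule sheets)
qed

definition veronese_cone :: "(complex \<times> complex \<times> complex) set" where
  "veronese_cone = veronese ` (- {0})"

lemma veronese_lift_exists:
  fixes S :: "'a::real_normed_vector set"
  assumes "convex S" "continuous_on S \<gamma>" "\<And>x. x \<in> S \<Longrightarrow> \<gamma> x \<in> veronese_cone"
  obtains v where "continuous_on S v" "\<And>x. x \<in> S \<Longrightarrow> v x \<noteq> 0"
    "\<And>x. x \<in> S \<Longrightarrow> \<gamma> x = veronese (v x)"
proof -
  obtain v where "continuous_on S v" "v \<in> S \<rightarrow> - {0}" "\<And>x. x \<in> S \<Longrightarrow> veronese (v x) = \<gamma> x"
  proof (rule covering_space_lift[OF covering_space_veronese])
    show "simply_connected S" "locally path_connected S"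
      using assms(1) by (simp_all add: convex_imp_simply_connected convex_imp_locally_path_connected)
    show "continuous_on S \<gamma>" "\<gamma> \<in> S \<rightarrow> veronese ` (- {0})"
      using assms by (auto simp: veronese_cone_def)
  qed blast
  then show thesis by (intro that[of v]) auto
qed

text \<open>At time 0 the two lifts agree up to sign, and a lift through a covering is determined by
  its starting point.\<close>

lemma veronese_lift_unique:
  assumes "continuous_on {0..1::real} v" "\<And>t. t \<in> {0..1} \<Longrightarrow> v t \<noteq> 0"
    and "continuous_on {0..1} w"  "\<And>t. t \<in> {0..1} \<Longrightarrow> w t \<noteq> 0"
    and "\<And>t. t \<in> {0..1} \<Longrightarrow> veronese (v t) = veronese (w t)"
  shows "(\<forall>t\<in>{0..1}. v t = w t) \<or> (\<forall>t\<in>{0..1}. v t = - w t)"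
proof -
  have *: "v t = w' t" if w': "continuous_on {0..1::real} w'" "\<And>t. t \<in> {0..1} \<Longrightarrow> w' t \<noteq> 0"
    "v 0 = w' 0" "\<And>t. t \<in> {0..1} \<Longrightarrow> veronese (v t) = veronese (w' t)" "t \<in> {0..1}" for w' t
  proof (rule covering_space_lift_unique[OF covering_space_veronese,
        where a = 0 and T = "{0..1}" and f = "\<lambda>t. veronese (v t)"])
    show "continuous_on {0..1} (\<lambda>t. veronese (v t))"
      unfolding veronese_def case_prod_beta using assms(1) by (intro continuous_intros)
  qed (use assms w' in auto)
  have "v 0 = w 0 \<or> v 0 = - w 0"
    using assms(5)[of 0] by (simp add: veronese_eq_iff)
  then show ?thesis
  proof
    assume "v 0 = - w 0"
    then have "v t = - w t" if "t \<in> {0..1}" for t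
      using *[of "\<lambda>t. - w t" t] that assms by (auto intro: continuous_intros)
    then show ?thesis by blast
  next
    assume "v 0 = w 0"
    then have "v t = w t" if "t \<in> {0..1}" for t
      using *[of w t] that assms by auto
    then show ?thesis by blast
  qed
qed

text \<open>Holonomy has to be defined on all paths, not only loops, so one of the two preimages of every point of
  the cone is declared positive.\<close>

definition root_sign :: "complex \<times> complex \<Rightarrow> bit" where
  "root_sign v = of_bool (v \<noteq> (SOME w. veronese w = veronese v))"

lemma root_sign_minus:
  assumes "v \<noteq> 0" shows "root_sign (- v) = root_sign v + 1"
proof -
  define w where "w = (SOME w. veronese w = veronese v)"
  have "veronese w = veronese v" unfolding w_def by (rule someI) simp
  then have "w = v \<or> w = - v" by (simp add: veronese_eq_iff)
  moreover have "v \<noteq> - v"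
    using assms by (cases v) (auto simp: prod_eq_iff)
  ultimately show ?thesis
    by (auto simp: root_sign_def w_def[symmetric])
qed

definition holonomy :: "(real \<Rightarrow> complex \<times> complex \<times> complex) \<Rightarrow> bit" where
  "holonomy \<gamma> =
     (let v = SOME v. continuous_on {0..1} v \<and> (\<forall>t\<in>{0..1}. v t \<noteq> 0 \<and> \<gamma> t = veronese (v t))
      in root_sign (v 0) + root_sign (v 1))"

text \<open>Another lift differs by a global sign, which flips both endpoint signs and leaves their
  sum modulo 2 unchanged.\<close>

lemma holonomy_eq:
  assumes "continuous_on {0..1} v" "\<And>t. t \<in> {0..1} \<Longrightarrow> v t \<noteq> 0"
    "\<And>t. t \<in> {0..1} \<Longrightarrow> \<gamma> t = veronese (v t)"
  shows "holonomy \<gamma> = root_sign (v 0) + root_sign (v 1)"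
proof -
  define w where "w = (SOME v. continuous_on {0..1} v \<and> (\<forall>t\<in>{0..1}. v t \<noteq> 0 \<and> \<gamma> t = veronese (v t)))"
  have w: "continuous_on {0..1} w \<and> (\<forall>t\<in>{0..1}. w t \<noteq> 0 \<and> \<gamma> t = veronese (w t))"
    unfolding w_def by (rule someI[of _ v]) (use assms in auto)
  have "(\<forall>t\<in>{0..1}. w t = v t) \<or> (\<forall>t\<in>{0..1}. w t = - v t)"
    by (rule veronese_lift_unique) (use assms w in auto)
  then have "root_sign (w 0) + root_sign (w 1) = root_sign (v 0) + root_sign (v 1)"
  proof
    assume "\<forall>t\<in>{0..1}. w t = - v t"
    then have "w 0 = - v 0" "w 1 = - v 1" by auto
    then show ?thesis using assms(2)[of 0] assms(2)[of 1]
      by (cases "root_sign (v 0)"; cases "root_sign (v 1)") (simp_all add: root_sign_minus)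
  qed auto
  then show ?thesis by (simp add: holonomy_def w_def Let_def)
qed

text \<open>A lift exists over the whole convex triangle, and the sign at each vertex is then
  counted by exactly two edges.\<close>

lemma holonomy_triangle:
  assumes "continuous_on std_triangle g" "\<And>z. z \<in> std_triangle \<Longrightarrow> g z \<in> veronese_cone"
  shows "holonomy (\<lambda>t. g (t, 0)) + holonomy (\<lambda>t. g (1 - t, t)) = holonomy (\<lambda>t. g (0, t))"
proof -
  obtain v where v: "continuous_on std_triangle v" "\<And>z. z \<in> std_triangle \<Longrightarrow> v z \<noteq> 0"
      "\<And>z. z \<in> std_triangle \<Longrightarrow> g z = veronese (v z)"
    using veronese_lift_exists[OF convex_triangle assms] by metis
  note c = continuous_on_triangle_edges[OF v(1)]
  have "holonomy (\<lambda>t. g (t, 0)) = root_sign (v (0, 0)) + root_sign (v (1, 0))"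
    "holonomy (\<lambda>t. g (1 - t, t)) = root_sign (v (1 - 0, 0)) + root_sign (v (1 - 1, 1))"
    "holonomy (\<lambda>t. g (0, t)) = root_sign (v (0, 0)) + root_sign (v (0, 1))"
    by (subst holonomy_eq[OF c(1)] holonomy_eq[OF c(2)] holonomy_eq[OF c(3)];
        use v in \<open>auto simp: std_triangle_def\<close>)+
  moreover have "a + b + (b + c) = a + c" for a b c :: bit
    by (cases a; cases b; cases c) simp_all
  ultimately show ?thesis by (simp only: diff_zero diff_self)
qed

text \<open>Turns are counted relative to the principal values at the endpoints, which makes them integers.\<close>

definition log_turns :: "(real \<Rightarrow> complex) \<Rightarrow> int" where
  "log_turns \<gamma> = (SOME n. of_int n * (2 * of_real pi * \<i>) = log_diff \<gamma> - Ln (\<gamma> 1) + Ln (\<gamma> 0))"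

text \<open>The right-hand side exponentiates to 1, so an integer as in the choice exists.\<close>

lemma log_turns:
  assumes "continuous_on {0..1} \<gamma>" "\<And>t. t \<in> {0..1} \<Longrightarrow> \<gamma> t \<noteq> 0"
  shows "of_int (log_turns \<gamma>) * (2 * of_real pi * \<i>) = log_diff \<gamma> - Ln (\<gamma> 1) + Ln (\<gamma> 0)"
  unfolding log_turns_def
proof (rule someI_ex)
  have nz: "\<gamma> 0 \<noteq> 0" "\<gamma> 1 \<noteq> 0" using assms(2)[of 0] assms(2)[of 1] by auto
  then have "exp (log_diff \<gamma> - Ln (\<gamma> 1) + Ln (\<gamma> 0)) = exp 0"
    using exp_log_diff[OF assms] by (simp add: exp_add exp_diff)
  then obtain n :: int where "log_diff \<gamma> - Ln (\<gamma> 1) + Ln (\<gamma> 0) = 0 + (of_int (2 * n) * pi) * \<i>"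
    by (auto simp only: exp_eq)
  then show "\<exists>n. of_int n * (2 * of_real pi * \<i>) = log_diff \<gamma> - Ln (\<gamma> 1) + Ln (\<gamma> 0)"
    by (intro exI[of _ n]) (simp add: algebra_simps)
qed

lemma log_turns_triangle:
  assumes "continuous_on std_triangle g" "\<And>z. z \<in> std_triangle \<Longrightarrow> g z \<noteq> 0"
  shows "log_turns (\<lambda>t. g (t, 0)) + log_turns (\<lambda>t. g (1 - t, t)) = log_turns (\<lambda>t. g (0, t))"
proof -
  have nz: "\<forall>t\<in>{0..1}. g (t, 0) \<noteq> 0 \<and> g (0, t) \<noteq> 0 \<and> g (1 - t, t) \<noteq> 0"
    using assms(2) by (auto simp: std_triangle_def)
  define X where "X = 2 * complex_of_real pi * \<i>"
  have X: "X \<noteq> 0" by (simp add: X_def)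
  have "of_int (log_turns (\<lambda>t. g (t, 0))) * X = log_diff (\<lambda>t. g (t, 0)) - Ln (g (1, 0)) + Ln (g (0, 0))"
    "of_int (log_turns (\<lambda>t. g (1 - t, t))) * X = log_diff (\<lambda>t. g (1 - t, t)) - Ln (g (0, 1)) + Ln (g (1, 0))"
    "of_int (log_turns (\<lambda>t. g (0, t))) * X = log_diff (\<lambda>t. g (0, t)) - Ln (g (0, 1)) + Ln (g (0, 0))"
    unfolding X_def
    by (subst log_turns; use nz continuous_on_triangle_edges[OF assms(1)] in simp)+
  then have "(of_int (log_turns (\<lambda>t. g (t, 0))) + of_int (log_turns (\<lambda>t. g (1 - t, t)))) * X
     = of_int (log_turns (\<lambda>t. g (0, t))) * X"
    using log_diff_triangle[OF assms] by (simp add: ring_distribs)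
  then show ?thesis
    using X by (simp flip: of_int_add)
qed

lemma exp_half_integer_turns:
  "exp (of_int n * (of_real pi * \<i>)) = (if even n then 1 else (- 1::complex))"
proof (cases "even n")
  case True
  then obtain k where "n = 2 * k" by blast
  then show ?thesis using exp_integer_2pi[of "of_int k"] by (simp add: algebra_simps)
next
  case False
  then obtain k where "n = 2 * k + 1" by (metis oddE)
  then show ?thesis using False exp_integer_2pi_plus1[of "of_int k"] by (simp add: algebra_simps)
qed

text \<open>A full turn of the logarithm is half a turn of the square root, so \<open>n\<close>
  turns multiply the lifted point by the \<open>n\<close>-th power of -1.\<close>

lemma root_sign_half_turns:
  assumes "L = Ln z + of_int n * (2 * of_real pi * \<i>)" "w \<noteq> 0"
  shows "root_sign (exp (L / 2) * fst w, exp (L / 2) * snd w)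
       = of_int n + root_sign (exp (Ln z / 2) * fst w, exp (Ln z / 2) * snd w)"
proof -
  define v where "v = (exp (Ln z / 2) * fst w, exp (Ln z / 2) * snd w)"
  have e: "exp (L / 2) = exp (Ln z / 2) * (if even n then 1 else - 1)"
    unfolding exp_half_integer_turns[symmetric] exp_add[symmetric] assms(1)
    by (simp add: algebra_simps add_divide_distrib)
  have v: "v \<noteq> 0" using assms(2) by (cases w) (auto simp: v_def zero_prod_def)
  have n: "of_int n = (of_bool (odd n) :: bit)"
    by (cases "even n") (auto elim!: evenE oddE)
  show ?thesis
  proof (cases "even n")
    case True
    then show ?thesis using e n by (simp add: v_def)
  next
    case False
    then have "(exp (L / 2) * fst w, exp (L / 2) * snd w) = - v"
      using e by (simp add: v_def)
    then show ?thesis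
      using root_sign_minus[OF v] False n unfolding v_def by (simp only: ) (simp add: add.commute)
  qed
qed

text \<open>A lift of \<open>F\<close> to \<open>C^2\<close> is a square root of \<open>u\<close>
  times \<open>w\<close>. As \<open>w\<close> itself is globally defined, only the turns of
  \<open>u\<close> create holonomy, and counting them gives an integral lift. On a closed simplex
  the endpoint terms cancel, which yields the last clause.\<close>

lemma integer_lift_of_holonomy:
  fixes X :: "'a topology" and u :: "'a \<Rightarrow> complex" and w :: "'a \<Rightarrow> complex \<times> complex"
  assumes u: "continuous_map X euclidean u" "\<And>x. x \<in> topspace X \<Longrightarrow> u x \<noteq> 0"
    and w: "continuous_map X euclidean w" "\<And>x. x \<in> topspace X \<Longrightarrow> w x \<noteq> 0"
    and F: "\<And>x. x \<in> topspace X \<Longrightarrow> F x = cone_scale (u x) (veronese (w x))"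
  shows "\<exists>g :: ((nat \<Rightarrow> real) \<Rightarrow> 'a) \<Rightarrow> int.
    (\<forall>\<sigma>. singular_simplex 1 X \<sigma> \<longrightarrow> of_int (g \<sigma>) = holonomy (\<lambda>t. F (\<sigma> (edge_point t)))) \<and>
    (\<forall>\<sigma>. singular_simplex 2 X \<sigma> \<longrightarrow>
       g (singular_face 2 0 \<sigma>) + g (singular_face 2 2 \<sigma>) = g (singular_face 2 1 \<sigma>)) \<and>
    (\<forall>\<sigma>. singular_simplex 1 X \<sigma> \<longrightarrow> \<sigma> (edge_point 0) = \<sigma> (edge_point 1) \<longrightarrow>
       of_int (g \<sigma>) * (2 * of_real pi * \<i>) = log_diff (\<lambda>t. u (\<sigma> (edge_point t))))"
proof -
  \<comment> \<open>The principal logarithm selects a lift over every point; its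
    \<open>root_sign\<close>, read as 0 or 1, changes the turn count by a coboundary. This makes
    \<open>g\<close> reduce to the holonomy on every simplex instead of only on loops.\<close>
  define \<beta> :: "'a \<Rightarrow> int" where
    "\<beta> x = of_bool (root_sign (exp (Ln (u x) / 2) * fst (w x), exp (Ln (u x) / 2) * snd (w x)) = 1)" for x
  define g where "g \<sigma> = log_turns (\<lambda>t. u (\<sigma> (edge_point t))) + \<beta> (\<sigma> (edge_point 1)) - \<beta> (\<sigma> (edge_point 0))"
    for \<sigma> :: "(nat \<Rightarrow> real) \<Rightarrow> 'a"
  have edge: "continuous_on {0..1} (\<lambda>t. u (\<sigma> (edge_point t)))"
      "\<And>t. t \<in> {0..1} \<Longrightarrow> u (\<sigma> (edge_point t)) \<noteq> 0"
      "continuous_on {0..1} (\<lambda>t. w (\<sigma> (edge_point t)))"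
      "\<And>t. t \<in> {0..1} \<Longrightarrow> \<sigma> (edge_point t) \<in> topspace X"
    if "singular_simplex 1 X \<sigma>" for \<sigma>
  proof -
    note c = continuous_map_simplex_edge[OF that]
    show "continuous_on {0..1} (\<lambda>t. u (\<sigma> (edge_point t)))" "continuous_on {0..1} (\<lambda>t. w (\<sigma> (edge_point t)))"
      using continuous_map_compose[OF c u(1)] continuous_map_compose[OF c w(1)] by (simp_all add: o_def)
    show t: "\<And>t. t \<in> {0..1} \<Longrightarrow> \<sigma> (edge_point t) \<in> topspace X"
      using continuous_map_image_subset_topspace[OF c] by auto
    show "\<And>t. t \<in> {0..1} \<Longrightarrow> u (\<sigma> (edge_point t)) \<noteq> 0"
      using t u(2) by blast
  qed
  have 1: "of_int (g \<sigma>) = holonomy (\<lambda>t. F (\<sigma> (edge_point t)))" if "singular_simplex 1 X \<sigma>" for \<sigma>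
  proof -
    define \<gamma> where "\<gamma> t = u (\<sigma> (edge_point t))" for t
    define \<omega> where "\<omega> t = w (\<sigma> (edge_point t))" for t
    have \<gamma>: "continuous_on {0..1} \<gamma>" "\<And>t. t \<in> {0..1} \<Longrightarrow> \<gamma> t \<noteq> 0"
      using edge[OF that] by (auto simp: \<gamma>_def)
    obtain L where L: "continuous_on {0..1} L" "\<And>t. t \<in> {0..1} \<Longrightarrow> \<gamma> t = exp (L t)"
      using path_logarithm_exists[OF \<gamma>] by blast
    \<comment> \<open>The lift of the path: \<open>exp (L t / 2)\<close> is a continuous square root
      of \<open>u\<close> along it.\<close>
    define v where "v t = (exp (L t / 2) * fst (\<omega> t), exp (L t / 2) * snd (\<omega> t))" for t
    have w0: "\<omega> t \<noteq> 0" if "t \<in> {0..1}" for t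
      using edge(4)[OF \<open>singular_simplex 1 X \<sigma>\<close> that] w(2) by (auto simp: \<omega>_def)
    have hol: "holonomy (\<lambda>t. F (\<sigma> (edge_point t))) = root_sign (v 0) + root_sign (v 1)"
    proof (rule holonomy_eq)
      show "continuous_on {0..1} v"
        unfolding v_def using L(1) edge(3)[OF that] by (auto simp: \<omega>_def intro!: continuous_intros)
      fix t :: real assume t: "t \<in> {0..1}"
      show "v t \<noteq> 0" using w0[OF t] by (cases "\<omega> t") (auto simp: v_def zero_prod_def)
      have "(exp (L t / 2))\<^sup>2 = \<gamma> t"
        using L(2)[OF t] by (simp flip: exp_double)
      then show "F (\<sigma> (edge_point t)) = veronese (v t)"
        unfolding v_def veronese_scale using F[OF edge(4)[OF that t]] by (simp add: \<gamma>_def \<omega>_def)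
    qed
    have turns: "\<exists>n. L t = Ln (\<gamma> t) + of_int n * (2 * of_real pi * \<i>)" if "t \<in> {0..1}" for t
    proof -
      have "exp (L t) = exp (Ln (\<gamma> t))" using L(2)[OF that] \<gamma>(2)[OF that] by simp
      then obtain n :: int where "L t = Ln (\<gamma> t) + (of_int (2 * n) * pi) * \<i>"
        by (auto simp only: exp_eq)
      then show ?thesis by (intro exI[of _ n]) (simp add: algebra_simps)
    qed
    obtain n0 n1 where n: "L 0 = Ln (\<gamma> 0) + of_int n0 * (2 * of_real pi * \<i>)"
        "L 1 = Ln (\<gamma> 1) + of_int n1 * (2 * of_real pi * \<i>)"
      using turns[of 0] turns[of 1] by auto
    have "of_int (log_turns \<gamma>) * (2 * of_real pi * \<i>) = of_int (n1 - n0) * (2 * of_real pi * \<i>)"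
    proof -
      have "of_int (log_turns \<gamma>) * (2 * of_real pi * \<i>) = log_diff \<gamma> - Ln (\<gamma> 1) + Ln (\<gamma> 0)"
        by (rule log_turns[OF \<gamma>])
      also have "log_diff \<gamma> = L 1 - L 0"
        by (rule log_diff_eq[OF L])
      also have "L 1 - L 0 - Ln (\<gamma> 1) + Ln (\<gamma> 0) = of_int (n1 - n0) * (2 * of_real pi * \<i>)"
        unfolding n by (simp add: algebra_simps)
      finally show ?thesis .
    qed
    then have lt: "log_turns \<gamma> = n1 - n0"
      by (simp del: of_int_diff)
    have b: "of_int (\<beta> x) = root_sign (exp (Ln (u x) / 2) * fst (w x), exp (Ln (u x) / 2) * snd (w x))" for x
      unfolding \<beta>_def by (cases "root_sign (exp (Ln (u x) / 2) * fst (w x), exp (Ln (u x) / 2) * snd (w x))") auto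
    have "root_sign (v 0) = of_int n0 + of_int (\<beta> (\<sigma> (edge_point 0)))"
      unfolding v_def by (subst root_sign_half_turns[OF n(1) w0]) (simp_all add: b \<gamma>_def \<omega>_def)
    moreover have "root_sign (v 1) = of_int n1 + of_int (\<beta> (\<sigma> (edge_point 1)))"
      unfolding v_def by (subst root_sign_half_turns[OF n(2) w0]) (simp_all add: b \<gamma>_def \<omega>_def)
    moreover have "g \<sigma> = n1 - n0 + \<beta> (\<sigma> (edge_point 1)) - \<beta> (\<sigma> (edge_point 0))"
      using lt unfolding g_def \<gamma>_def by simp
    moreover have "a - b + c - d = (b + d) + (a + c)" for a b c d :: bit
      by (cases a; cases b; cases c; cases d) simp_all
    ultimately show ?thesis
      using hol by (simp only: of_int_add of_int_diff)
  qed
  have 2: "g (singular_face 2 0 \<sigma>) + g (singular_face 2 2 \<sigma>) = g (singular_face 2 1 \<sigma>)"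
    if "singular_simplex 2 X \<sigma>" for \<sigma>
  proof -
    define h where "h z = u (\<sigma> (triangle_point z))" for z
    note c = continuous_map_simplex_triangle[OF that]
    have h: "continuous_on std_triangle h" "\<And>z. z \<in> std_triangle \<Longrightarrow> h z \<noteq> 0"
      using continuous_map_compose[OF c u(1)] continuous_map_image_subset_topspace[OF c] u(2)
      by (auto simp: h_def o_def)
    have lt: "log_turns (\<lambda>t. u (singular_face 2 0 \<sigma> (edge_point t))) = log_turns (\<lambda>t. h (1 - t, t))"
       "log_turns (\<lambda>t. u (singular_face 2 1 \<sigma> (edge_point t))) = log_turns (\<lambda>t. h (0, t))"
       "log_turns (\<lambda>t. u (singular_face 2 2 \<sigma> (edge_point t))) = log_turns (\<lambda>t. h (t, 0))"
      unfolding log_turns_def h_def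
      using singular_face_edge_point[of _ \<sigma>]
        log_diff_cong[of "\<lambda>t. u (singular_face 2 0 \<sigma> (edge_point t))" "\<lambda>t. h (1 - t, t)"]
        log_diff_cong[of "\<lambda>t. u (singular_face 2 1 \<sigma> (edge_point t))" "\<lambda>t. h (0, t)"]
        log_diff_cong[of "\<lambda>t. u (singular_face 2 2 \<sigma> (edge_point t))" "\<lambda>t. h (t, 0)"]
      by (simp_all add: h_def)
    show ?thesis
      using log_turns_triangle[OF h] singular_face_edge_point[of 0 \<sigma>] singular_face_edge_point[of 1 \<sigma>]
      unfolding g_def lt by simp
  qed
  have 3: "of_int (g \<sigma>) * (2 * of_real pi * \<i>) = log_diff (\<lambda>t. u (\<sigma> (edge_point t)))"
    if "singular_simplex 1 X \<sigma>" "\<sigma> (edge_point 0) = \<sigma> (edge_point 1)" for \<sigma>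
    using log_turns[OF edge(1,2)[OF that(1)]] that(2) by (simp add: g_def)
  show ?thesis
    by (intro exI[of _ g] conjI allI impI)
      (rule 1, assumption, rule 2, assumption, rule 3, assumption, assumption)
qed

text \<open>These rules would turn ring expressions over \<^typ>\<open>bit\<close> into bit operations, out of reach of ring normalisation.\<close>

declare add_bit_eq_xor [simp del] mult_bit_eq_and [simp del]

subsection \<open>Evaluation of cochains and the cube of a class\<close>

text \<open>Chains are integral while the coefficient ring is free: the same pairing serves mod 2
  cochains, integral turn counts and complex logarithm increments.\<close>

definition evaluate :: "('s \<Rightarrow> 'r::comm_ring_1) \<Rightarrow> ('s \<Rightarrow>\<^sub>0 int) \<Rightarrow> 'r" where
  "evaluate c x = (\<Sum>s\<in>Poly_Mapping.keys x. of_int (Poly_Mapping.lookup x s) * c s)"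

lemma evaluate_superset:
  assumes "finite S" "Poly_Mapping.keys x \<subseteq> S"
  shows "evaluate c x = (\<Sum>s\<in>S. of_int (Poly_Mapping.lookup x s) * c s)"
  unfolding evaluate_def
  by (rule sum.mono_neutral_left) (use assms in \<open>auto simp: in_keys_iff\<close>)

lemma evaluate_0 [simp]: "evaluate c 0 = 0"
  by (simp add: evaluate_def)

lemma evaluate_frag_of [simp]: "evaluate c (frag_of s) = c s"
  by (simp add: evaluate_def)

lemma evaluate_add: "evaluate c (x + y) = evaluate c x + evaluate c y"
proof -
  define S where "S = Poly_Mapping.keys x \<union> Poly_Mapping.keys y"
  have "finite S" "Poly_Mapping.keys x \<subseteq> S" "Poly_Mapping.keys y \<subseteq> S" "Poly_Mapping.keys (x + y) \<subseteq> S"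
    using keys_add[of x y] by (auto simp: S_def)
  then show ?thesis
    by (simp add: evaluate_superset[of S] lookup_add ring_distribs sum.distrib)
qed

lemma evaluate_minus: "evaluate c (- x) = - evaluate c x"
  using evaluate_add[of c x "- x"] by (simp add: add_eq_0_iff)

lemma evaluate_diff: "evaluate c (x - y) = evaluate c x - evaluate c y"
  using evaluate_add[of c x "- y"] by (simp add: evaluate_minus)

lemma evaluate_sum: "evaluate c (sum f I) = (\<Sum>i\<in>I. evaluate c (f i))"
  by (induction I rule: infinite_finite_induct) (simp_all add: evaluate_add)

lemma evaluate_cmul: "evaluate c (frag_cmul k x) = of_int k * evaluate c x"
proof (cases "k = 0")
  case False
  then have "Poly_Mapping.keys (frag_cmul k x) = Poly_Mapping.keys x"
    by (simp add: keys_cmul_iff set_eq_iff)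
  then show ?thesis
    by (simp add: evaluate_def sum_distrib_left mult.assoc)
qed simp

lemma evaluate_chain_map: "evaluate c (chain_map p f x) = evaluate (\<lambda>\<sigma>. c (simplex_map p f \<sigma>)) x"
proof -
  have "Poly_Mapping.keys x \<subseteq> UNIV" by simp
  then show ?thesis
    by (induction x rule: frag_induction) (simp_all add: chain_map_diff evaluate_diff)
qed

lemma evaluate_cong:
  assumes "singular_chain p X x" "\<And>\<sigma>. singular_simplex p X \<sigma> \<Longrightarrow> c \<sigma> = d \<sigma>"
  shows "evaluate c x = evaluate d x"
  unfolding evaluate_def by (rule sum.cong) (use assms in \<open>auto simp: singular_chain_def\<close>)

lemma evaluate_chain_boundary_0:
  assumes "singular_chain p X x"
    and "\<And>\<sigma>. singular_simplex p X \<sigma> \<Longrightarrow> evaluate c (chain_boundary p (frag_of \<sigma>)) = 0"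
  shows "evaluate c (chain_boundary p x) = 0"
proof -
  have "Poly_Mapping.keys x \<subseteq> Collect (singular_simplex p X)"
    using assms(1) by (simp add: singular_chain_def)
  then show ?thesis
    by (induction x rule: frag_induction) (use assms(2) in \<open>auto simp: chain_boundary_diff evaluate_diff\<close>)
qed

lemma evaluate_chain_boundary_2:
  "evaluate c (chain_boundary 2 (frag_of \<sigma>))
     = c (singular_face 2 0 \<sigma>) - c (singular_face 2 1 \<sigma>) + c (singular_face 2 2 \<sigma>)"
  by (simp add: chain_boundary_of numeral_2_eq_2 evaluate_add evaluate_diff evaluate_cmul evaluate_minus)

lemma evaluate_chain_boundary_3_bit:
  "evaluate c (chain_boundary 3 (frag_of \<sigma>))
     = c (singular_face 3 0 \<sigma>) + c (singular_face 3 1 \<sigma>) + c (singular_face 3 2 \<sigma>) + (c (singular_face 3 3 \<sigma>) :: bit)"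
  by (simp add: chain_boundary_of numeral_3_eq_3 numeral_2_eq_2 evaluate_add evaluate_diff evaluate_cmul evaluate_minus)

lemma singular_face_singular_face:
  assumes "a \<le> 2" "b \<le> 3"
  shows "singular_face 2 a (singular_face 3 b \<tau>)
    = restrict (\<lambda>x. \<tau> (simplical_face b (simplical_face a x))) (standard_simplex 1)"
proof -
  have "simplical_face a x \<in> standard_simplex 2" if "x \<in> standard_simplex (Suc 0)" for x
    using simplical_face_in_standard_simplex[of 2 a x] that assms by simp
  then show ?thesis
    by (auto simp: singular_face_def fun_eq_iff)
qed

text \<open>For the edges 23, 12, 02, 01 and 13, in this order, the description through one face is
  rewritten into that through another, so that every edge gets one normal form. The edge 03 is
  neither a front nor a back edge of any face, so it does not occur in the products below.\<close>

lemma tetrahedron_edges: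
  "singular_face 2 0 (singular_face 3 1 \<tau>) = singular_face 2 0 (singular_face 3 0 \<tau>)"
  "singular_face 2 2 (singular_face 3 0 \<tau>) = singular_face 2 0 (singular_face 3 3 \<tau>)"
  "singular_face 2 2 (singular_face 3 1 \<tau>) = singular_face 2 1 (singular_face 3 3 \<tau>)"
  "singular_face 2 2 (singular_face 3 2 \<tau>) = singular_face 2 2 (singular_face 3 3 \<tau>)"
  "singular_face 2 0 (singular_face 3 2 \<tau>) = singular_face 2 1 (singular_face 3 0 \<tau>)"
proof -
  have x: "x 2 = 0" "x 3 = 0" "\<And>i. i > 1 \<Longrightarrow> x i = 0" if "x \<in> standard_simplex (Suc 0)" for x
    using that by (auto simp: standard_simplex_def)
  have *: "simplical_face 1 (simplical_face 0 x) = simplical_face 0 (simplical_face 0 x)"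
    "simplical_face 0 (simplical_face 2 x) = simplical_face 3 (simplical_face 0 x)"
    "simplical_face 1 (simplical_face 2 x) = simplical_face 3 (simplical_face 1 x)"
    "simplical_face 2 (simplical_face 2 x) = simplical_face 3 (simplical_face 2 x)"
    "simplical_face 2 (simplical_face 0 x) = simplical_face 0 (simplical_face 1 x)"
    if "x \<in> standard_simplex (Suc 0)" for x
    using x[OF that] by (auto simp: simplical_face_def fun_eq_iff)
  show "singular_face 2 0 (singular_face 3 1 \<tau>) = singular_face 2 0 (singular_face 3 0 \<tau>)"
  "singular_face 2 2 (singular_face 3 0 \<tau>) = singular_face 2 0 (singular_face 3 3 \<tau>)"
  "singular_face 2 2 (singular_face 3 1 \<tau>) = singular_face 2 1 (singular_face 3 3 \<tau>)"
  "singular_face 2 2 (singular_face 3 2 \<tau>) = singular_face 2 2 (singular_face 3 3 \<tau>)"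
  "singular_face 2 0 (singular_face 3 2 \<tau>) = singular_face 2 1 (singular_face 3 0 \<tau>)"
    using * by (simp_all add: singular_face_singular_face cong: restrict_cong)
qed

text \<open>Standard simplices are nested by zero padding, so the inclusion of the last face is the
  identity on coordinates.\<close>

lemma front_face_eq_singular_face:
  assumes "singular_simplex (Suc p) X \<sigma>"
  shows "front_face p \<sigma> = singular_face (Suc p) (Suc p) \<sigma>"
proof -
  have *: "simplical_face (Suc p) x = x" if "x \<in> standard_simplex p" for x
    using that by (auto simp: simplical_face_def standard_simplex_def fun_eq_iff)
  show ?thesis
    by (rule ext) (simp add: front_face_def singular_face_def restrict_def *)
qed

lemma back_face_1_1_eq: "back_face 1 1 \<sigma> = singular_face 2 0 \<sigma>"
proof -
  have "(\<lambda>i. if i = 0 then 0 else x (i - Suc 0)) = simplical_face 0 x" for x :: "nat \<Rightarrow> real"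
    by (auto simp: simplical_face_def)
  then show ?thesis
    by (simp add: back_face_def singular_face_def o_def)
qed

lemma back_face_2_1_eq: "back_face 2 1 \<tau> = singular_face 2 0 (singular_face 3 0 \<tau>)"
proof -
  have "(\<lambda>i. if i < 2 then 0 else x (i - 2)) = simplical_face 0 (simplical_face 0 x)" for x :: "nat \<Rightarrow> real"
    by (auto simp: simplical_face_def fun_eq_iff numeral_2_eq_2)
  then show ?thesis
    by (simp add: back_face_def singular_face_singular_face)
qed

text \<open>The equation "coboundary of \<open>w\<close> equals the cube of \<open>c\<close>",
  written out by Alexander-Whitney on the edges 01, 12, 23. It constrains \<open>w\<close> only on
  faces of simplices of \<open>X\<close>, so it pulls back along continuous maps without any
  adjustment of \<open>w\<close> off the simplices.\<close>

definition cube_primitive ::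
    "'a topology \<Rightarrow> (((nat \<Rightarrow> real) \<Rightarrow> 'a) \<Rightarrow> bit) \<Rightarrow> (((nat \<Rightarrow> real) \<Rightarrow> 'a) \<Rightarrow> bit) \<Rightarrow> bool" where
  "cube_primitive X c w \<longleftrightarrow>
     (\<forall>\<tau>. singular_simplex 3 X \<tau> \<longrightarrow>
        w (singular_face 3 0 \<tau>) + w (singular_face 3 1 \<tau>) + w (singular_face 3 2 \<tau>) + w (singular_face 3 3 \<tau>)
        = c (singular_face 2 2 (singular_face 3 3 \<tau>)) * c (singular_face 2 0 (singular_face 3 3 \<tau>))
          * c (singular_face 2 0 (singular_face 3 0 \<tau>)))"

lemma cube_primitive_coboundary:
  assumes "coboundary 2 X w = cochain_cup 2 1 X (cochain_cup 1 1 X c c) c"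
  shows "cube_primitive X c w"
  unfolding cube_primitive_def
proof (intro allI impI)
  fix \<tau> assume \<tau>: "singular_simplex 3 X \<tau>"
  then have \<tau>': "singular_simplex (Suc 2) X \<tau>" by simp
  have f: "front_face 2 \<tau> = singular_face 3 3 \<tau>"
    using front_face_eq_singular_face[OF \<tau>'] by simp
  have s: "singular_simplex 2 X (singular_face 3 3 \<tau>)"
    using singular_simplex_singular_face[OF \<tau>, of 3] by simp
  then have f': "front_face 1 (singular_face 3 3 \<tau>) = singular_face 2 2 (singular_face 3 3 \<tau>)"
    using front_face_eq_singular_face[of 1 X "singular_face 3 3 \<tau>"] by (simp add: numeral_2_eq_2)
  have "w (singular_face 3 0 \<tau>) + w (singular_face 3 1 \<tau>) + w (singular_face 3 2 \<tau>) + w (singular_face 3 3 \<tau>)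
     = coboundary 2 X w \<tau>"
    using \<tau>' by (simp add: coboundary_def numeral_3_eq_3 numeral_2_eq_2)
  also have "\<dots> = c (singular_face 2 2 (singular_face 3 3 \<tau>)) * c (singular_face 2 0 (singular_face 3 3 \<tau>))
          * c (singular_face 2 0 (singular_face 3 0 \<tau>))"
    using \<tau> s f f' back_face_1_1_eq[of "singular_face 3 3 \<tau>"] back_face_2_1_eq[of \<tau>]
    by (simp add: assms cochain_cup_def flip: numeral_2_eq_2)
  finally show "w (singular_face 3 0 \<tau>) + w (singular_face 3 1 \<tau>) + w (singular_face 3 2 \<tau>) + w (singular_face 3 3 \<tau>) = \<dots>" .
qed

lemma cube_primitive_pullback:
  assumes "cube_primitive Y c w" "continuous_map X Y j"
  shows "cube_primitive X (\<lambda>\<sigma>. c (simplex_map 1 j \<sigma>)) (\<lambda>\<sigma>. w (simplex_map 2 j \<sigma>))"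
  unfolding cube_primitive_def
proof (intro allI impI)
  fix \<tau> assume \<tau>: "singular_simplex 3 X \<tau>"
  have 3: "singular_face 3 k (simplex_map 3 j \<tau>) = simplex_map 2 j (singular_face 3 k \<tau>)" if "k \<le> 3" for k
    using singular_face_simplex_map[of 3 k j \<tau>] that
    by (simp add: simplex_map_def singular_face_def restrict_def fun_eq_iff)
  have 2: "singular_face 2 k (simplex_map 2 j \<sigma>) = simplex_map 1 j (singular_face 2 k \<sigma>)" if "k \<le> 2" for k \<sigma>
    using singular_face_simplex_map[of 2 k j \<sigma>] that
    by (simp add: simplex_map_def singular_face_def restrict_def fun_eq_iff)
  have "singular_simplex 3 Y (simplex_map 3 j \<tau>)"
    using \<tau> assms(2) by (rule singular_simplex_simplex_map)
  with assms(1) show "w (simplex_map 2 j (singular_face 3 0 \<tau>)) + w (simplex_map 2 j (singular_face 3 1 \<tau>))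
      + w (simplex_map 2 j (singular_face 3 2 \<tau>)) + w (simplex_map 2 j (singular_face 3 3 \<tau>))
    = c (simplex_map 1 j (singular_face 2 2 (singular_face 3 3 \<tau>)))
      * c (simplex_map 1 j (singular_face 2 0 (singular_face 3 3 \<tau>)))
      * c (simplex_map 1 j (singular_face 2 0 (singular_face 3 0 \<tau>)))"
    unfolding cube_primitive_def by (auto dest!: spec[of _ "simplex_map 3 j \<tau>"] simp: 2 3)
qed

text \<open>With parities \<open>r\<close> and \<open>t\<close> of the summands, adding carries
  \<open>r * t\<close> into the half; everything else occurs twice and vanishes modulo 2. This is
  the cochain form of the identity between the Bockstein and the square in degree one.\<close>

lemma half_int_bit:
  "of_int (a div 2) + of_int (b div 2) + of_int ((a + b) div 2) = (of_int a * of_int b :: bit)"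
proof -
  have dbl: "x + x = 0" "x + y + (x + y) = 0" "x + (y + 1) + (x + y) = 1" "x + y + (x + y + 1) = 1" for x y :: bit
    by (cases x; cases y; simp)+
  have two: "of_int (2 * n) = (0 :: bit)" for n by simp
  obtain x r where a: "a = 2 * x + r" "r = 0 \<or> r = 1"
    by (metis mult_div_mod_eq not_mod_2_eq_0_eq_1)
  obtain y t where b: "b = 2 * y + t" "t = 0 \<or> t = 1"
    by (metis mult_div_mod_eq not_mod_2_eq_0_eq_1)
  have ab: "a div 2 = x" "b div 2 = y" "(a + b) div 2 = x + y + r * t"
    using a b by auto
  have "(of_int a :: bit) = of_int r" "(of_int b :: bit) = of_int t"
    unfolding a(1) b(1) of_int_add two by simp_all
  then show ?thesis
    unfolding ab using a(2) b(2) dbl(2,4)[of "of_int x" "of_int y"]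
    by (auto simp only: of_int_add of_int_mult of_int_0 of_int_1 mult_zero_left mult_zero_right mult_1 add_0_right)
qed

text \<open>The cochain $D=w+\nu\cup c$. Here $\lfloor g/2\rfloor$ is half the difference between $g$ and
  the $0/1$-valued lift of $c$; its coboundary is $c\cup c$ by \<open>half_int_bit\<close>.\<close>

definition half_defect ::
    "(((nat \<Rightarrow> real) \<Rightarrow> 'a) \<Rightarrow> int) \<Rightarrow> (((nat \<Rightarrow> real) \<Rightarrow> 'a) \<Rightarrow> bit) \<Rightarrow> ((nat \<Rightarrow> real) \<Rightarrow> 'a) \<Rightarrow> bit" where
  "half_defect g w \<sigma> = w \<sigma> + of_int (g (singular_face 2 2 \<sigma>) div 2) * of_int (g (singular_face 2 0 \<sigma>))"

text \<open>The coboundary of \<open>w\<close> is the cube of \<open>c\<close>, and that of the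
  second summand is the square of \<open>c\<close> times \<open>c\<close>, because \<open>c\<close>
  is itself a cocycle; modulo 2 they cancel.\<close>

lemma half_defect_cocycle:
  assumes w: "cube_primitive X c w"
    and c: "\<And>\<sigma>. singular_simplex 1 X \<sigma> \<Longrightarrow> of_int (g \<sigma>) = c \<sigma>"
    and g: "\<And>\<sigma>. singular_simplex 2 X \<sigma> \<Longrightarrow>
       g (singular_face 2 0 \<sigma>) + g (singular_face 2 2 \<sigma>) = g (singular_face 2 1 \<sigma>)"
    and \<tau>: "singular_simplex 3 X \<tau>"
  shows "evaluate (half_defect g w) (chain_boundary 3 (frag_of \<tau>)) = 0"
proof -
  have s: "singular_simplex 2 X (singular_face 3 k \<tau>)" if "k \<le> 3" for k
    using singular_simplex_singular_face[OF \<tau>, of k] that by simp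
  have s': "singular_simplex 1 X (singular_face 2 l (singular_face 3 k \<tau>))" if "k \<le> 3" "l \<le> 2" for k l
    using singular_simplex_singular_face[OF s[OF that(1)], of l] that by simp
  \<comment> \<open>Values on the consecutive edges 01, 12, 23. The cocycle law of \<open>g\<close>
    then gives \<open>a + b\<close> on 02 and \<open>b + d\<close> on 13.\<close>
  define a where "a = g (singular_face 2 2 (singular_face 3 3 \<tau>))"
  define b where "b = g (singular_face 2 0 (singular_face 3 3 \<tau>))"
  define d where "d = g (singular_face 2 0 (singular_face 3 0 \<tau>))"
  have ab: "g (singular_face 2 1 (singular_face 3 3 \<tau>)) = a + b"
    using g[OF s, of 3] by (simp add: a_def b_def)
  have bd: "g (singular_face 2 1 (singular_face 3 0 \<tau>)) = b + d"
    using g[OF s, of 0] by (simp add: b_def d_def tetrahedron_edges)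
  have w': "w (singular_face 3 0 \<tau>) + w (singular_face 3 1 \<tau>) + w (singular_face 3 2 \<tau>) + w (singular_face 3 3 \<tau>)
      = of_int a * of_int b * of_int d"
    using w \<tau> c[OF s', of 3 2] c[OF s', of 3 0] c[OF s', of 0 0]
    unfolding cube_primitive_def a_def b_def d_def by simp
  have "(x0 + p) + (x1 + q) + (x2 + r) + (x3 + t) = (x0 + x1 + x2 + x3) + (p + q + r + t)"
    for x0 x1 x2 x3 p q r t :: bit by (simp only: ac_simps)
  then have "evaluate (half_defect g w) (chain_boundary 3 (frag_of \<tau>))
     = of_int a * of_int b * of_int d + (of_int (b div 2) * of_int d + of_int ((a + b) div 2) * of_int d
       + of_int (a div 2) * of_int (b + d) + of_int (a div 2) * of_int b)"
    unfolding evaluate_chain_boundary_3_bit half_defect_def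
    by (simp only: w' tetrahedron_edges ab bd flip: a_def b_def d_def)
  moreover have "of_int a * of_int b * of_int d
     = (of_int (a div 2) + of_int (b div 2) + of_int ((a + b) div 2)) * (of_int d :: bit)"
    by (simp only: half_int_bit)
  moreover have "(x + y + z) * t + (y * t + z * t + x * (u + t) + x * u) = 0" for x y z t u :: bit
    by (cases x; cases y; cases z; cases t; cases u) simp_all
  ultimately show ?thesis by (simp only: of_int_add)
qed

subsection \<open>Prisms over a singular simplex\<close>

text \<open>The \<open>k\<close>-th degeneracy map of simplices in barycentric coordinates.\<close>

definition merge_coordinates :: "nat \<Rightarrow> (nat \<Rightarrow> real) \<Rightarrow> nat \<Rightarrow> real" where
  "merge_coordinates k t = (\<lambda>i. if i < k then t i else if i = k then t k + t (Suc k) else t (Suc i))"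

lemma sum_merge_coordinates:
  assumes "k \<le> p"
  shows "(\<Sum>i\<le>p. merge_coordinates k t i) = (\<Sum>i\<le>Suc p. t i)"
  using assms
proof (induction p rule: dec_induct)
  case base
  have "(\<Sum>i\<le>k. merge_coordinates k t i) = (\<Sum>i<k. t i) + (t k + t (Suc k))"
    by (simp add: merge_coordinates_def lessThan_Suc_atMost[symmetric])
  then show ?case by (simp add: lessThan_Suc_atMost[symmetric])
next
  case (step p)
  then show ?case by (simp add: merge_coordinates_def)
qed

lemma merge_coordinates_in_simplex:
  assumes t: "t \<in> standard_simplex (Suc p)" and "k \<le> p"
  shows "merge_coordinates k t \<in> standard_simplex p"
proof -
  have t': "\<forall>i. 0 \<le> t i" "\<forall>i>Suc p. t i = 0" "(\<Sum>i\<le>Suc p. t i) = 1"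
    using t by (auto simp: standard_simplex_def)
  have nn: "0 \<le> merge_coordinates k t i" for i
    using t'(1) by (auto simp: merge_coordinates_def)
  have z: "merge_coordinates k t i = 0" if "i > p" for i
    using that t'(2) \<open>k \<le> p\<close> by (auto simp: merge_coordinates_def)
  have s: "(\<Sum>i\<le>p. merge_coordinates k t i) = 1"
    using sum_merge_coordinates[OF \<open>k \<le> p\<close>] t'(3) by simp
  have "merge_coordinates k t i \<le> 1" for i
  proof (cases "i \<le> p")
    case True
    then show ?thesis
      using member_le_sum[of i "{..p}" "merge_coordinates k t"] nn s by auto
  qed (use z in simp)
  with nn z s show ?thesis by (simp add: standard_simplex_def)
qed

text \<open>The \<open>k\<close>-th simplex of the standard subdivision of \<open>\<sigma> \<times> [0, 1]\<close>, with \<open>[0, 1]\<close> wrapped once around the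
  circle; the two ends of the prism therefore cancel.\<close>

definition circle_prism :: "nat \<Rightarrow> nat \<Rightarrow> ((nat \<Rightarrow> real) \<Rightarrow> 'a) \<Rightarrow> (nat \<Rightarrow> real) \<Rightarrow> 'a \<times> complex" where
  "circle_prism p k \<sigma> =
     restrict (\<lambda>t. (\<sigma> (merge_coordinates k t), cis (2 * pi * (\<Sum>j\<in>{k<..Suc p}. t j)))) (standard_simplex (Suc p))"

lemma continuous_map_coordinate:
  "continuous_map (subtopology (powertop_real UNIV) S) euclideanreal (\<lambda>t. t i)"
  by (intro continuous_map_from_subtopology continuous_map_product_projection) simp

lemma singular_simplex_circle_prism:
  assumes \<sigma>: "singular_simplex p X \<sigma>" and "k \<le> p"
  shows "singular_simplex (Suc p) (prod_topology X circle) (circle_prism p k \<sigma>)"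
proof -
  let ?S = "subtopology (powertop_real UNIV) (standard_simplex (Suc p))"
  have "continuous_map ?S euclideanreal (\<lambda>t. merge_coordinates k t i)" for i
    unfolding merge_coordinates_def
    by (cases "i < k"; cases "i = k") (auto intro: continuous_map_coordinate continuous_map_add)
  then have "continuous_map ?S (subtopology (powertop_real UNIV) (standard_simplex p)) (merge_coordinates k)"
    using merge_coordinates_in_simplex[OF _ \<open>k \<le> p\<close>]
    by (auto simp: continuous_map_in_subtopology continuous_map_componentwise)
  from continuous_map_compose[OF this, of X \<sigma>] \<sigma>
  have 1: "continuous_map ?S X (\<lambda>t. \<sigma> (merge_coordinates k t))"
    by (simp add: singular_simplex_def o_def)
  have "continuous_map ?S euclideanreal (\<lambda>t. \<Sum>j\<in>{k<..Suc p}. t j)"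
    by (intro continuous_map_sum continuous_map_coordinate) simp
  moreover have "continuous_map euclideanreal circle (\<lambda>s. cis (2 * pi * s))"
    by (auto simp: continuous_map_in_subtopology intro!: continuous_intros)
  ultimately have "continuous_map ?S circle (\<lambda>t. cis (2 * pi * (\<Sum>j\<in>{k<..Suc p}. t j)))"
    using continuous_map_compose[of ?S euclideanreal _ circle] by (fastforce simp: o_def)
  with 1 have "continuous_map ?S (prod_topology X circle)
     (\<lambda>t. (\<sigma> (merge_coordinates k t), cis (2 * pi * (\<Sum>j\<in>{k<..Suc p}. t j))))"
    by (simp add: continuous_map_paired)
  then show ?thesis
    unfolding singular_simplex_def circle_prism_def by simp
qed

lemma singular_face_circle_prism:
  assumes "m \<le> Suc p"
  shows "singular_face (Suc p) m (circle_prism p k \<sigma>)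
    = restrict (\<lambda>t. (\<sigma> (merge_coordinates k (simplical_face m t)),
        cis (2 * pi * (\<Sum>j\<in>{k<..Suc p}. simplical_face m t j)))) (standard_simplex p)"
proof -
  have "simplical_face m t \<in> standard_simplex (Suc p)" if "t \<in> standard_simplex p" for t
    using simplical_face_in_standard_simplex[of "Suc p" m t] that assms by simp
  then show ?thesis
    by (simp add: singular_face_def circle_prism_def restrict_def fun_eq_iff)
qed

lemma circle_prism_1_singular_face:
  assumes "k \<le> 1" "m \<le> 2"
  shows "circle_prism 1 k (singular_face 2 m \<sigma>)
    = restrict (\<lambda>t. (\<sigma> (simplical_face m (merge_coordinates k t)),
        cis (2 * pi * (\<Sum>j\<in>{k<..2}. t j)))) (standard_simplex 2)"
proof -
  have "merge_coordinates k t \<in> standard_simplex (Suc 0)" if "t \<in> standard_simplex (Suc (Suc 0))" for t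
    using merge_coordinates_in_simplex[of t "Suc 0" k] that assms by simp
  then show ?thesis
    by (simp add: singular_face_def circle_prism_def restrict_def fun_eq_iff numeral_2_eq_2)
qed

lemma intervals_to_3:
  "{0<..3::nat} = {1, 2, 3}" "{Suc 0<..3} = {2, 3}" "{2<..3::nat} = {3}"
  "{0<..2::nat} = {1, 2}" "{Suc 0<..2} = {2}"
  by auto

text \<open>The first six faces form the prism over the boundary of \<open>\<sigma>\<close>, the
  next two are walls shared by neighbouring simplices of the subdivision. The last equation
  identifies top and bottom: their angles are a full turn and 0.\<close>

lemma circle_prism_faces:
  fixes \<sigma> :: "(nat \<Rightarrow> real) \<Rightarrow> 'a"
  shows "singular_face 3 2 (circle_prism 2 0 \<sigma>) = circle_prism 1 0 (singular_face 2 1 \<sigma>)"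
    "singular_face 3 3 (circle_prism 2 0 \<sigma>) = circle_prism 1 0 (singular_face 2 2 \<sigma>)"
    "singular_face 3 0 (circle_prism 2 1 \<sigma>) = circle_prism 1 0 (singular_face 2 0 \<sigma>)"
    "singular_face 3 3 (circle_prism 2 1 \<sigma>) = circle_prism 1 1 (singular_face 2 2 \<sigma>)"
    "singular_face 3 0 (circle_prism 2 2 \<sigma>) = circle_prism 1 1 (singular_face 2 0 \<sigma>)"
    "singular_face 3 1 (circle_prism 2 2 \<sigma>) = circle_prism 1 1 (singular_face 2 1 \<sigma>)"
    "singular_face 3 1 (circle_prism 2 0 \<sigma>) = singular_face 3 1 (circle_prism 2 1 \<sigma>)"
    "singular_face 3 2 (circle_prism 2 1 \<sigma>) = singular_face 3 2 (circle_prism 2 2 \<sigma>)"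
    "singular_face 3 0 (circle_prism 2 0 \<sigma>) = singular_face 3 3 (circle_prism 2 2 \<sigma>)"
proof -
  have x: "t 3 = 0" "\<And>i. i > 2 \<Longrightarrow> t i = 0" "t 0 + t (Suc 0) + t 2 = 1" if "t \<in> standard_simplex 2" for t
    using that by (auto simp: standard_simplex_def numeral_2_eq_2)
  have faces: "singular_face 3 m (circle_prism 2 k \<sigma>)
    = restrict (\<lambda>t. (\<sigma> (merge_coordinates k (simplical_face m t)),
        cis (2 * pi * (\<Sum>j\<in>{k<..3}. simplical_face m t j)))) (standard_simplex 2)"
    if "m \<le> 3" for m k
    using singular_face_circle_prism[of m 2 k \<sigma>] that by simp
  have m: "merge_coordinates 0 (simplical_face 2 t) = simplical_face 1 (merge_coordinates 0 t)"
    "merge_coordinates 0 (simplical_face 3 t) = simplical_face 2 (merge_coordinates 0 t)"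
    "merge_coordinates 1 (simplical_face 0 t) = simplical_face 0 (merge_coordinates 0 t)"
    "merge_coordinates 1 (simplical_face 3 t) = simplical_face 2 (merge_coordinates 1 t)"
    "merge_coordinates 2 (simplical_face 0 t) = simplical_face 0 (merge_coordinates 1 t)"
    "merge_coordinates 2 (simplical_face 1 t) = simplical_face 1 (merge_coordinates 1 t)"
    "merge_coordinates 0 (simplical_face 1 t) = t" "merge_coordinates 1 (simplical_face 1 t) = t"
    "merge_coordinates 1 (simplical_face 2 t) = t" "merge_coordinates 2 (simplical_face 2 t) = t"
    "merge_coordinates 0 (simplical_face 0 t) = t" "merge_coordinates 2 (simplical_face 3 t) = t"
    if "t \<in> standard_simplex 2" for t
    using x[OF that]
    by (auto simp: merge_coordinates_def simplical_face_def fun_eq_iff numeral_2_eq_2 numeral_3_eq_3 less_Suc_eq)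
  have full: "cis (2 * pi * (t 0 + (t (Suc 0) + t 2))) = 1" if "t \<in> standard_simplex 2" for t
    using x(3)[OF that] by (simp add: add.assoc)
  have s: "simplical_face 0 t (Suc 0) = t 0" "simplical_face 0 t 2 = t (Suc 0)" "simplical_face 0 t 3 = t 2"
    "simplical_face (Suc 0) t (Suc 0) = 0" "simplical_face (Suc 0) t 2 = t (Suc 0)" "simplical_face (Suc 0) t 3 = t 2"
    "simplical_face 2 t (Suc 0) = t (Suc 0)" "simplical_face 2 t 2 = 0" "simplical_face 2 t 3 = t 2"
    "simplical_face 3 t (Suc 0) = t (Suc 0)" "simplical_face 3 t 2 = t 2" "simplical_face 3 t 3 = 0"
    for t :: "nat \<Rightarrow> real"
    by (auto simp: simplical_face_def numeral_2_eq_2 numeral_3_eq_3)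
  note rules = faces circle_prism_1_singular_face[unfolded One_nat_def] intervals_to_3 s m m[simplified] full
  show "singular_face 3 2 (circle_prism 2 0 \<sigma>) = circle_prism 1 0 (singular_face 2 1 \<sigma>)"
    "singular_face 3 3 (circle_prism 2 0 \<sigma>) = circle_prism 1 0 (singular_face 2 2 \<sigma>)"
    "singular_face 3 0 (circle_prism 2 1 \<sigma>) = circle_prism 1 0 (singular_face 2 0 \<sigma>)"
    "singular_face 3 3 (circle_prism 2 1 \<sigma>) = circle_prism 1 1 (singular_face 2 2 \<sigma>)"
    "singular_face 3 0 (circle_prism 2 2 \<sigma>) = circle_prism 1 1 (singular_face 2 0 \<sigma>)"
    "singular_face 3 1 (circle_prism 2 2 \<sigma>) = circle_prism 1 1 (singular_face 2 1 \<sigma>)"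
    "singular_face 3 1 (circle_prism 2 0 \<sigma>) = singular_face 3 1 (circle_prism 2 1 \<sigma>)"
    "singular_face 3 2 (circle_prism 2 1 \<sigma>) = singular_face 3 2 (circle_prism 2 2 \<sigma>)"
    "singular_face 3 0 (circle_prism 2 0 \<sigma>) = singular_face 3 3 (circle_prism 2 2 \<sigma>)"
    by (simp_all add: rules cong: restrict_cong)
qed

text \<open>The slant product with the fundamental class of the circle. The two prism triangles
  carry opposite signs, which are invisible modulo 2.\<close>

definition circle_slant :: "(((nat \<Rightarrow> real) \<Rightarrow> 'a \<times> complex) \<Rightarrow> bit) \<Rightarrow> ((nat \<Rightarrow> real) \<Rightarrow> 'a) \<Rightarrow> bit" where
  "circle_slant d \<sigma> = d (circle_prism 1 0 \<sigma>) + d (circle_prism 1 1 \<sigma>)"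

text \<open>Adding the cocycle relations of the three simplices of the prism over
  \<open>\<sigma>\<close> cancels the shared walls and the two ends; only the prism over the
  boundary remains.\<close>

lemma circle_slant_cocycle:
  assumes d: "\<And>\<tau>. singular_simplex 3 (prod_topology X circle) \<tau> \<Longrightarrow>
      evaluate d (chain_boundary 3 (frag_of \<tau>)) = 0"
    and \<sigma>: "singular_simplex 2 X \<sigma>"
  shows "evaluate (circle_slant d) (chain_boundary 2 (frag_of \<sigma>)) = 0"
proof -
  have "singular_simplex 3 (prod_topology X circle) (circle_prism 2 k \<sigma>)" if "k \<le> 2" for k
    using singular_simplex_circle_prism[OF \<sigma> that] by simp
  from d[OF this[of 0]] d[OF this[of 1]] d[OF this[of 2]]
  have e: "evaluate d (chain_boundary 3 (frag_of (circle_prism 2 0 \<sigma>))) = 0"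
    "evaluate d (chain_boundary 3 (frag_of (circle_prism 2 1 \<sigma>))) = 0"
    "evaluate d (chain_boundary 3 (frag_of (circle_prism 2 2 \<sigma>))) = 0"
    by simp_all
  have "(a1 + b1) - (a2 + b2) + (a3 + b3) = (0::bit)"
    if "e + f + a2 + a3 = 0" "a1 + f + g + b3 = 0" "b1 + b2 + g + e = 0"
    for a1 a2 a3 b1 b2 b3 e f g :: bit
    using that by (cases a1; cases a2; cases a3; cases b1; cases b2; cases b3; cases e; cases f; cases g) simp_all
  from this[OF e[unfolded evaluate_chain_boundary_3_bit circle_prism_faces]]
  show ?thesis
    unfolding evaluate_chain_boundary_2 circle_slant_def .
qed

subsection \<open>Homology of the circle and of the solid torus\<close>

text \<open>Source of the rules that turn products, powers and finite products in the
  multiplicatively written homology groups into sums and multiples of cycles.\<close>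

lemma homologous_rel_set_hom:
  "homologous_rel_set p X S \<in> hom (relcycle_group p X S) (relative_homology_group (int p) X S)"
  using normal.r_coset_hom_Mod[OF normal_subgroup_singular_relboundary_relcycle, of p X S]
  unfolding right_coset_singular_relboundary
  by (simp add: nontrivial_relative_homology_group)

lemma homologous_rel_set_mult:
  assumes "singular_relcycle p X S a" "singular_relcycle p X S b"
  shows "homologous_rel_set p X S a \<otimes>\<^bsub>relative_homology_group (int p) X S\<^esub> homologous_rel_set p X S b
    = homologous_rel_set p X S (a + b)"
  using hom_mult[OF homologous_rel_set_hom, of a p X S b] assms by simp

lemma homologous_rel_set_int_pow:
  assumes "singular_relcycle p X S a"
  shows "homologous_rel_set p X S a [^]\<^bsub>relative_homology_group (int p) X S\<^esub> (k::int)
    = homologous_rel_set p X S (frag_cmul k a)"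
proof -
  have "a [^]\<^bsub>relcycle_group p X S\<^esub> k = a [^]\<^bsub>chain_group p X\<^esub> k"
    unfolding relcycle_group_def
    by (rule group.int_pow_subgroup_generated) (use assms in \<open>simp_all flip: relcycle_group_def\<close>)
  also have "\<dots> = frag_cmul k a"
    unfolding chain_group_def
    by (rule int_pow_free_Abelian_group) (use assms in \<open>simp add: singular_relcycle singular_chain_def\<close>)
  finally have "a [^]\<^bsub>relcycle_group p X S\<^esub> k = frag_cmul k a" .
  moreover have "group_hom (relcycle_group p X S) (relative_homology_group (int p) X S) (homologous_rel_set p X S)"
    by (simp add: group_hom_def group_hom_axioms_def homologous_rel_set_hom)
  ultimately show ?thesis
    using group_hom.hom_int_pow[of _ _ "homologous_rel_set p X S" a k] assms by fastforce
qed

lemma homologous_rel_set_finprod: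
  assumes "finite I" "\<And>i. i \<in> I \<Longrightarrow> singular_relcycle p X S (f i)"
  shows "finprod (relative_homology_group (int p) X S) (\<lambda>i. homologous_rel_set p X S (f i)) I
    = homologous_rel_set p X S (\<Sum>i\<in>I. f i)"
  using assms
proof (induction I)
  case empty
  interpret comm_group "relative_homology_group (int p) X S" by simp
  have "homologous_rel_set p X S 0 = singular_relboundary_set p X S"
    unfolding homologous_rel_set_eq_relboundary by simp
  then show ?case by simp
next
  case (insert i I)
  interpret comm_group "relative_homology_group (int p) X S" by simp
  have "(\<lambda>j. homologous_rel_set p X S (f j)) \<in> insert i I \<rightarrow> carrier (relative_homology_group (int p) X S)"
    using insert.prems by (auto simp: carrier_relative_homology_group)
  then show ?case
    using insert by (simp add: homologous_rel_set_mult singular_relcycle_sum)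
qed

definition standard_loop :: "(nat \<Rightarrow> real) \<Rightarrow> complex" where
  "standard_loop = path_simplex (\<lambda>t. cis (2 * pi * t))"

lemma standard_loop_edge_point [simp]:
  "0 \<le> t \<Longrightarrow> t \<le> 1 \<Longrightarrow> standard_loop (edge_point t) = cis (2 * pi * t)"
  by (simp add: standard_loop_def)

lemma singular_simplex_standard_loop: "singular_simplex 1 circle standard_loop"
  unfolding standard_loop_def
  by (intro singular_simplex_path_simplex)
    (auto simp: continuous_map_in_subtopology intro!: continuous_intros)

lemma singular_face_1:
  "singular_face 1 0 \<sigma> (\<lambda>j. if j = 0 then 1 else 0) = \<sigma> (edge_point 1)"
  "singular_face 1 1 \<sigma> (\<lambda>j. if j = 0 then 1 else 0) = \<sigma> (edge_point 0)"
proof -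
  have "simplical_face 0 (\<lambda>j. if j = 0 then 1 else 0) = edge_point 1"
    "simplical_face 1 (\<lambda>j. if j = 0 then 1 else 0) = edge_point 0"
    by (auto simp: simplical_face_def edge_point_def fun_eq_iff)
  then show "singular_face 1 0 \<sigma> (\<lambda>j. if j = 0 then 1 else 0) = \<sigma> (edge_point 1)"
    "singular_face 1 1 \<sigma> (\<lambda>j. if j = 0 then 1 else 0) = \<sigma> (edge_point 0)"
    by (simp_all add: singular_face_def standard_simplex_0)
qed

lemma chain_boundary_1_frag_of:
  "chain_boundary 1 (frag_of \<sigma>) = frag_of (singular_face 1 0 \<sigma>) - frag_of (singular_face 1 1 \<sigma>)"
  by (simp add: chain_boundary_of)

lemma chain_boundary_loop:
  assumes "\<sigma> (edge_point 0) = \<sigma> (edge_point 1)"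
  shows "chain_boundary 1 (frag_of \<sigma>) = 0"
proof -
  have *: "singular_face 1 0 \<sigma> x = singular_face 1 1 \<sigma> x" for x
  proof (cases "x \<in> standard_simplex 0")
    case True
    then have "x = (\<lambda>j. if j = 0 then 1 else 0)" by (simp add: standard_simplex_0)
    then show ?thesis using singular_face_1[of \<sigma>] assms by simp
  qed (simp add: singular_face_def)
  have "singular_face 1 0 \<sigma> = singular_face 1 1 \<sigma>"
    by (rule ext) (rule *)
  then show ?thesis unfolding chain_boundary_1_frag_of by (simp only: diff_self)
qed

lemma singular_relcycle_standard_loop: "singular_relcycle 1 circle {} (frag_of standard_loop)"
  unfolding singular_cycle
  by (auto simp only: singular_chain_of singular_simplex_standard_loop intro!: chain_boundary_loop)
    simp_all

text \<open>The complex cochain obtained by integrating the logarithmic derivative of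
  \<open>u\<close>; on a loop it is \<open>2 * pi * \<i>\<close> times the winding number.\<close>

definition path_log :: "('a \<Rightarrow> complex) \<Rightarrow> ((nat \<Rightarrow> real) \<Rightarrow> 'a) \<Rightarrow> complex" where
  "path_log u \<sigma> = log_diff (\<lambda>t. u (\<sigma> (edge_point t)))"

lemma path_log_simplex_map: "path_log u (simplex_map 1 f \<sigma>) = path_log (\<lambda>x. u (f x)) \<sigma>"
  unfolding path_log_def by (rule log_diff_cong) (simp add: simplex_map_def)

lemma path_log_boundary:
  assumes u: "continuous_map X euclidean u" "\<And>x. x \<in> topspace X \<Longrightarrow> u x \<noteq> 0"
    and z: "singular_chain 2 X z"
  shows "evaluate (path_log u) (chain_boundary 2 z) = 0"
proof (rule evaluate_chain_boundary_0[OF z])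
  fix \<sigma> assume \<sigma>: "singular_simplex 2 X \<sigma>"
  note c = continuous_map_simplex_triangle[OF \<sigma>]
  define h where "h z = u (\<sigma> (triangle_point z))" for z
  have h: "continuous_on std_triangle h" "\<And>z. z \<in> std_triangle \<Longrightarrow> h z \<noteq> 0"
    using continuous_map_compose[OF c u(1)] continuous_map_image_subset_topspace[OF c] u(2)
    by (auto simp: h_def o_def)
  have "path_log u (singular_face 2 0 \<sigma>) = log_diff (\<lambda>t. h (1 - t, t))"
    "path_log u (singular_face 2 1 \<sigma>) = log_diff (\<lambda>t. h (0, t))"
    "path_log u (singular_face 2 2 \<sigma>) = log_diff (\<lambda>t. h (t, 0))"
    unfolding path_log_def h_def
    by (rule log_diff_cong, simp add: singular_face_edge_point)+
  then show "evaluate (path_log u) (chain_boundary 2 (frag_of \<sigma>)) = 0"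
    using log_diff_triangle[OF h] unfolding evaluate_chain_boundary_2 by (simp add: algebra_simps)
qed

lemma path_log_homologous:
  assumes u: "continuous_map X euclidean u" "\<And>x. x \<in> topspace X \<Longrightarrow> u x \<noteq> 0"
    and "homologous_rel 1 X {} a b"
  shows "evaluate (path_log u) a = evaluate (path_log u) b"
proof -
  obtain z where z: "singular_chain 2 X z" "chain_boundary 2 z = a - b"
    using assms(3) by (auto simp: homologous_rel_def singular_boundary numeral_2_eq_2)
  show ?thesis using path_log_boundary[OF u z(1)] unfolding z(2) by (simp add: evaluate_diff)
qed

text \<open>Principal logarithms at the end points split \<open>path_log u\<close> into integer
  multiples of the period plus a coboundary, and a coboundary vanishes on cycles.\<close>

lemma path_log_cycle_integral:
  assumes u: "continuous_map X euclidean u" "\<And>x. x \<in> topspace X \<Longrightarrow> u x \<noteq> 0"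
    and x: "singular_relcycle 1 X {} x"
  shows "\<exists>k::int. evaluate (path_log u) x = of_int k * (2 * of_real pi * \<i>)"
proof -
  \<comment> \<open>A singular 0-simplex is a function on the one point of
    \<open>standard_simplex 0\<close>; \<open>b\<close> is the principal logarithm of
    \<open>u\<close> at its image.\<close>
  define b where "b \<tau> = Ln (u (\<tau> (\<lambda>j. if j = 0 then 1 else 0)))" for \<tau> :: "(nat \<Rightarrow> real) \<Rightarrow> 'a"
  define k where "k \<sigma> = log_turns (\<lambda>t. u (\<sigma> (edge_point t)))" for \<sigma> :: "(nat \<Rightarrow> real) \<Rightarrow> 'a"
  have x': "singular_chain 1 X x" "chain_boundary 1 x = 0"
    using x by (simp_all add: singular_cycle)
  have k: "path_log u \<sigma> = of_int (k \<sigma>) * (2 * of_real pi * \<i>) + evaluate b (chain_boundary 1 (frag_of \<sigma>))"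
    if \<sigma>: "singular_simplex 1 X \<sigma>" for \<sigma>
  proof -
    note c = continuous_map_simplex_edge[OF \<sigma>]
    have "continuous_on {0..1} (\<lambda>t. u (\<sigma> (edge_point t)))" "\<And>t. t \<in> {0..1} \<Longrightarrow> u (\<sigma> (edge_point t)) \<noteq> 0"
      using continuous_map_compose[OF c u(1)] continuous_map_image_subset_topspace[OF c] u(2)
      by (simp_all add: o_def image_subset_iff)
    from log_turns[OF this] show ?thesis
      by (simp only: chain_boundary_1_frag_of evaluate_diff evaluate_frag_of b_def singular_face_1
          k_def path_log_def) simp
  qed
  have b: "evaluate (\<lambda>\<sigma>. evaluate b (chain_boundary 1 (frag_of \<sigma>))) y = evaluate b (chain_boundary 1 y)" for y
  proof -
    have "Poly_Mapping.keys y \<subseteq> UNIV" by simp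
    then show ?thesis
      by (induction y rule: frag_induction) (simp_all add: chain_boundary_diff evaluate_diff)
  qed
  have "evaluate (path_log u) x
      = evaluate (\<lambda>\<sigma>. of_int (k \<sigma>) * (2 * of_real pi * \<i>) + evaluate b (chain_boundary 1 (frag_of \<sigma>))) x"
    by (rule evaluate_cong[OF x'(1) k])
  also have "\<dots> = evaluate (\<lambda>\<sigma>. of_int (k \<sigma>) * (2 * of_real pi * \<i>)) x
      + evaluate (\<lambda>\<sigma>. evaluate b (chain_boundary 1 (frag_of \<sigma>))) x"
    by (simp add: evaluate_def ring_distribs sum.distrib)
  also have "\<dots> = of_int (evaluate k x) * (2 * of_real pi * \<i>)"
    unfolding b x'(2) by (simp add: evaluate_def sum_distrib_right mult.assoc)
  finally show ?thesis by blast
qed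

lemma path_log_standard_loop: "path_log (\<lambda>z. z) standard_loop = 2 * of_real pi * \<i>"
proof -
  have "log_diff (\<lambda>t. standard_loop (edge_point t)) = 2 * pi * \<i> * of_real 1 - 2 * pi * \<i> * of_real 0"
    by (rule log_diff_eq) (auto intro!: continuous_intros simp: cis_conv_exp algebra_simps)
  then show ?thesis by (simp add: path_log_def)
qed

lemma frag_cmul_diff_right: "frag_cmul c (a - b) = frag_cmul c a - frag_cmul c b"
  by (metis frag_cmul_distrib2 diff_add_cancel add_diff_cancel_right')

text \<open>The standard loop is some \<open>N\<close>-fold multiple of \<open>\<zeta>\<close> and
  has winding number 1, while the winding number of \<open>\<zeta>\<close> is an integer
  \<open>k\<close>. Hence \<open>N * k = 1\<close> and the generator is the loop up to sign. The
  sign is harmless, since it cancels wherever \<open>\<zeta>\<close> stands on both sides of a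
  relation.\<close>

lemma circle_generator:
  assumes "group_generator (homology_group 1 circle) \<zeta>"
  obtains \<epsilon> :: int where "\<epsilon> = 1 \<or> \<epsilon> = - 1"
    "\<zeta> = homologous_rel_set 1 circle {} (frag_cmul \<epsilon> (frag_of standard_loop))"
proof -
  let ?H = "homology_group 1 circle" and ?l = "frag_of standard_loop"
  interpret group ?H by simp
  have car: "carrier ?H = homologous_rel_set 1 circle {} ` singular_relcycle_set 1 circle {}"
    using carrier_relative_homology_group[of 1 circle "{}"] by simp
  have \<zeta>: "\<zeta> \<in> carrier ?H" "carrier ?H = range (\<lambda>n::int. \<zeta> [^]\<^bsub>?H\<^esub> n)"
    using assms carrier_subgroup_generated_by_singleton[of \<zeta>] by (auto simp: group_generator_def)
  from \<zeta>(1) obtain z0 where z0: "singular_relcycle 1 circle {} z0" "\<zeta> = homologous_rel_set 1 circle {} z0"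
    using car by auto
  have "homologous_rel_set 1 circle {} ?l \<in> carrier ?H"
    using car singular_relcycle_standard_loop by auto
  then obtain N :: int where "homologous_rel_set 1 circle {} ?l = \<zeta> [^]\<^bsub>?H\<^esub> N"
    using \<zeta>(2) by auto
  also have "\<dots> = homologous_rel_set 1 circle {} (frag_cmul N z0)"
    using homologous_rel_set_int_pow[OF z0(1), of N] z0(2) by simp
  finally have hom: "homologous_rel 1 circle {} ?l (frag_cmul N z0)"
    by (simp only: homologous_rel_set_eq homologous_rel_eq)
  have id: "continuous_map circle euclidean (\<lambda>z. z)" "\<And>z. z \<in> topspace circle \<Longrightarrow> z \<noteq> 0"
    by (auto simp: continuous_map_from_subtopology)
  obtain k :: int where k: "evaluate (path_log (\<lambda>z. z)) z0 = of_int k * (2 * of_real pi * \<i>)"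
    using path_log_cycle_integral[OF id z0(1)] by blast
  have "2 * of_real pi * \<i> = of_int (N * k) * (2 * of_real pi * \<i>)"
    using path_log_homologous[OF id hom] by (simp add: evaluate_cmul k path_log_standard_loop)
  then have "of_int (N * k) = (1 :: complex)" by simp
  then have "N * k = 1" by (simp only: of_int_eq_1_iff)
  then have N: "N = 1 \<or> N = - 1" by (auto simp: zmult_eq_1_iff)
  then have NN: "N * N = 1" by auto
  have "homologous_rel 1 circle {} (frag_cmul N ?l) (frag_cmul N (frag_cmul N z0))"
    using singular_relboundary_cmul[of 1 circle "{}" "?l - frag_cmul N z0" N] hom
    by (simp add: homologous_rel_def frag_cmul_diff_right)
  moreover have "frag_cmul N (frag_cmul N z0) = z0"
    using NN by simp
  ultimately have "\<zeta> = homologous_rel_set 1 circle {} (frag_cmul N ?l)"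
    using z0(2) homologous_rel_eq[of 1 circle "{}" "frag_cmul N ?l" z0] by (simp add: homologous_rel_set_eq)
  with N that show thesis by blast
qed

text \<open>Projection to the core is a homotopy equivalence, and the circle has no second homology.
  The circle appears as \<open>nsphere 1\<close> because its homology is known in that form.\<close>

lemma solid_torus_2_cycle_bounds:
  assumes "singular_relcycle 2 (prod_topology disc circle) {} y"
  obtains z where "singular_chain 3 (prod_topology disc circle) z" "chain_boundary 3 z = y"
proof -
  let ?V = "prod_topology disc circle"
  define f where "f = (\<lambda>v::complex \<times> complex. \<lambda>i::nat. if i = 0 then Re (snd v) else if i = 1 then Im (snd v) else 0)"
  define g where "g = (\<lambda>x::nat \<Rightarrow> real. (0 :: complex, Complex (x 0) (x 1)))"
  have V: "?V = top_of_set (cball 0 1 \<times> sphere 0 1)"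
    by (simp flip: subtopology_Times)
  have cf: "continuous_map ?V (nsphere 1) f"
    unfolding nsphere continuous_map_in_subtopology
  proof
    have "continuous_on (cball 0 1 \<times> sphere 0 1) (\<lambda>v. f v i)" for i
      unfolding f_def by (cases "i = 0"; cases "i = 1") (auto intro!: continuous_intros)
    then show "continuous_map ?V (powertop_real UNIV) f"
      unfolding V continuous_map_componentwise by (simp add: extensional_def)
    have "(Re z)\<^sup>2 + (Im z)\<^sup>2 = 1" if "norm z = 1" for z
      using that by (simp add: norm_complex_def)
    then show "f \<in> topspace ?V \<rightarrow> {x. (\<Sum>i\<le>1. (x i)\<^sup>2) = 1 \<and> (\<forall>i>1. x i = 0)}"
      by (auto simp: f_def)
  qed
  have cg: "continuous_map (nsphere 1) ?V g"
  proof -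
    have "continuous_map (nsphere 1) euclidean (\<lambda>x. Complex (x 0) (x 1))"
    proof -
      have "continuous_map (nsphere 1) (prod_topology euclidean euclidean) (\<lambda>x. (x 0, x 1))"
        by (simp only: continuous_map_paired continuous_map_nsphere_projection simp_thms)
      then have 1: "continuous_map (nsphere 1) euclidean (\<lambda>x. (x 0, x 1))"
        by simp
      have 2: "continuous_map euclidean euclidean (\<lambda>p. Complex (fst p) (snd p))"
        unfolding Complex_eq by (auto intro!: continuous_intros)
      show ?thesis
        using continuous_map_compose[OF 1 2] by (simp add: o_def)
    qed
    moreover have "norm (Complex (x 0) (x 1)) = 1" if "x \<in> topspace (nsphere 1)" for x
      using that by (simp add: nsphere norm_complex_def)
    ultimately show ?thesis
      unfolding g_def continuous_map_paired by (auto simp: continuous_map_in_subtopology)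
  qed
  have fg: "homotopic_with (\<lambda>k. True) (nsphere 1) (nsphere 1) (f \<circ> g) id"
  proof (rule homotopic_with_equal)
    fix x assume "x \<in> topspace (nsphere 1)"
    then have "x i = 0" if "i > 1" for i using that by (simp add: nsphere)
    then show "(f \<circ> g) x = id x" by (auto simp: f_def g_def fun_eq_iff)
  qed (use continuous_map_compose[OF cg cf] in simp_all)
  have gf: "homotopic_with (\<lambda>h. True) ?V ?V (g \<circ> f) id"
  proof -
    have "g (f v) = (0, snd v)" for v
      by (simp add: f_def g_def)
    moreover have "homotopic_with (\<lambda>h. True) ?V ?V (\<lambda>v. (0, snd v)) id"
      unfolding V
    proof (rule homotopic_with_linear)
      fix v :: "complex \<times> complex" assume v: "v \<in> cball 0 1 \<times> sphere 0 1"
      then show "closed_segment (0, snd v) (id v) \<subseteq> cball 0 1 \<times> sphere 0 1"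
        by (cases v) (auto simp: closed_segment_def mult_le_one algebra_simps simp flip: scaleR_add_left)
    qed (auto intro!: continuous_intros)
    ultimately show ?thesis by (simp add: o_def)
  qed
  have "homology_group 2 ?V \<cong> homology_group 2 (nsphere 1)"
    by (rule homotopy_equivalent_space_imp_isomorphic_homology_groups)
      (use cf cg fg gf in \<open>auto simp: homotopy_equivalent_space_def\<close>)
  moreover have "trivial_group (homology_group 2 (nsphere 1))"
    using reduced_homology_group_nsphere(2)[of 2 1] by (simp add: un_reduced_homology_group)
  ultimately have "trivial_group (homology_group 2 ?V)"
    using isomorphic_group_triviality[of "homology_group 2 ?V" "homology_group 2 (nsphere 1)"] by simp
  moreover have "homologous_rel_set 2 ?V {} y \<in> carrier (homology_group 2 ?V)"
    using assms carrier_relative_homology_group[of 2 ?V "{}"] by auto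
  ultimately have "homologous_rel_set 2 ?V {} y = singular_relboundary_set 2 ?V {}"
    using one_relative_homology_group[of 2 ?V "{}"] by (auto simp: trivial_group_def)
  then have "singular_relboundary 2 ?V {} y"
    by (simp only: homologous_rel_set_eq_relboundary)
  then show thesis
    using that by (auto simp: singular_boundary numeral_3_eq_3 numeral_2_eq_2)
qed

subsection \<open>Circle-valued maps on the holed sphere\<close>

lemma circlepath_0_1: "circlepath 0 1 t = cis (2 * pi * t)"
  by (simp add: circlepath cis_conv_exp algebra_simps)

text \<open>The boundary is a simple closed curve with the centre inside it, so its winding number
  is a unit; the sign depends on the embedding and stays undetermined.\<close>

lemma log_diff_embedded_disc:
  fixes E :: "complex \<Rightarrow> complex"
  assumes cont: "continuous_on (cball 0 1) E" and inj: "inj_on E (cball 0 1)"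
  shows "\<exists>\<epsilon>::int. (\<epsilon> = 1 \<or> \<epsilon> = - 1) \<and>
    log_diff (\<lambda>t. E (cis (2 * pi * t)) - E 0) = of_int \<epsilon> * (2 * of_real pi * \<i>)"
proof -
  define \<gamma> where "\<gamma> = E \<circ> circlepath 0 1"
  have sub: "sphere 0 1 \<subseteq> cball (0::complex) 1" "ball 0 1 \<subseteq> cball (0::complex) 1" by auto
  have im: "path_image \<gamma> = E ` sphere 0 1"
    by (simp add: \<gamma>_def path_image_compose)
  have simple: "simple_path \<gamma>"
    unfolding \<gamma>_def
    by (rule simple_path_continuous_image)
      (use cont inj sub in \<open>auto intro: continuous_on_subset inj_on_subset simp: simple_path_circlepath\<close>)
  have notin: "E 0 \<notin> path_image \<gamma>"
    using inj_on_image_mem_iff[OF inj, of 0 "sphere 0 1"] by (auto simp: im)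
  have inside: "E 0 \<in> inside (path_image \<gamma>)"
  proof -
    \<comment> \<open>The complement of the curve is covered by two disjoint open sets, the image of
      the open disc (invariance of domain) and the complement of the closed one. The component of
      the centre stays in the first and is therefore bounded.\<close>
    define C where "C = connected_component_set (- path_image \<gamma>) (E 0)"
    have U: "open (E ` ball 0 1)"
      by (rule invariance_of_domain) (use cont inj sub in \<open>auto intro: continuous_on_subset inj_on_subset\<close>)
    have V: "open (- E ` cball 0 1)"
      using compact_imp_closed[OF compact_continuous_image[OF cont compact_cball]] by auto
    have C: "connected C" "C \<subseteq> - path_image \<gamma>" "E 0 \<in> C"
      using notin by (auto simp: C_def connected_component_subset)
    have "cball 0 1 = ball 0 1 \<union> sphere (0::complex) 1" by auto
    then have "E ` cball 0 1 = E ` ball 0 1 \<union> path_image \<gamma>"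
      unfolding im by (simp only: image_Un)
    then have 1: "E ` ball 0 1 \<inter> - E ` cball 0 1 \<inter> C = {}"
      and 2: "C \<subseteq> E ` ball 0 1 \<union> - E ` cball 0 1"
      using C(2) by blast+
    have "E 0 \<in> E ` ball 0 1" by simp
    then have "- E ` cball 0 1 \<inter> C = {}"
      using connectedD[OF C(1) U V 1 2] C(3) by blast
    then have "C \<subseteq> E ` cball 0 1" by blast
    moreover have "bounded (E ` cball 0 1)"
      by (rule compact_imp_bounded[OF compact_continuous_image[OF cont compact_cball]])
    ultimately have "bounded C"
      using bounded_subset[of "E ` cball 0 1" C] by (simp only:)
    then show ?thesis using notin by (simp add: inside_def C_def)
  qed
  obtain q where q: "path q" "pathfinish q - pathstart q = 2 * of_real pi * \<i> * winding_number \<gamma> (E 0)"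
      "\<And>t. t \<in> {0..1} \<Longrightarrow> \<gamma> t = E 0 + exp (q t)"
    by (rule winding_number_as_continuous_log[OF simple_path_imp_path[OF simple] notin]) blast
  have "log_diff (\<lambda>t. E (cis (2 * pi * t)) - E 0) = q 1 - q 0"
  proof (rule log_diff_eq)
    show "continuous_on {0..1} q" using q(1) by (simp add: path_def)
    show "E (cis (2 * pi * t)) - E 0 = exp (q t)" if "t \<in> {0..1}" for t
      using q(3)[OF that] by (simp add: \<gamma>_def circlepath_0_1)
  qed
  moreover have "winding_number \<gamma> (E 0) = 1 \<or> winding_number \<gamma> (E 0) = -1"
    by (rule simple_closed_path_winding_number_inside[OF simple]) (use inside in auto)
  ultimately show ?thesis
    using q(2) by (auto simp: pathfinish_def pathstart_def intro: exI[of _ 1] exI[of _ "-1"])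
qed

text \<open>A logarithm exists on the disc, and the boundary loop ends where it starts.\<close>

lemma log_diff_disc_boundary:
  fixes E :: "complex \<Rightarrow> complex"
  assumes "continuous_on (cball 0 1) E" "\<And>z. z \<in> cball 0 1 \<Longrightarrow> E z \<noteq> 0"
  shows "log_diff (\<lambda>t. E (cis (2 * pi * t))) = 0"
proof -
  obtain h where h: "continuous_on (cball 0 1) h" "\<And>z. z \<in> cball 0 1 \<Longrightarrow> E z = exp (h z)"
    using continuous_logarithm_on_cball[OF assms] by metis
  have "log_diff (\<lambda>t. E (cis (2 * pi * t))) = h (cis (2 * pi * 1)) - h (cis (2 * pi * 0))"
    by (rule log_diff_eq)
      (use h in \<open>auto intro!: continuous_on_compose2[OF h(1)] continuous_intros\<close>)
  then show ?thesis by simp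
qed

lemma log_diff_power_int:
  assumes "continuous_on {0..1} \<gamma>" "\<And>t. t \<in> {0..1} \<Longrightarrow> \<gamma> t \<noteq> 0"
  shows "log_diff (\<lambda>t. \<gamma> t powi k) = of_int k * log_diff \<gamma>"
proof -
  obtain L where L: "continuous_on {0..1} L" "\<And>t. t \<in> {0..1} \<Longrightarrow> \<gamma> t = exp (L t)"
    using path_logarithm_exists[OF assms] by blast
  have "log_diff (\<lambda>t. \<gamma> t powi k) = of_int k * L 1 - of_int k * L 0"
    by (rule log_diff_eq) (use L in \<open>auto intro!: continuous_intros simp: exp_power_int\<close>)
  also have "\<dots> = of_int k * (L 1 - L 0)"
    by (simp add: right_diff_distrib)
  also have "L 1 - L 0 = log_diff \<gamma>"
    by (rule log_diff_eq[OF L, symmetric])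
  finally show ?thesis .
qed

lemma log_diff_prod:
  assumes "finite I" "\<And>i. i \<in> I \<Longrightarrow> continuous_on {0..1} (\<gamma> i)"
    "\<And>i t. i \<in> I \<Longrightarrow> t \<in> {0..1} \<Longrightarrow> \<gamma> i t \<noteq> 0"
  shows "log_diff (\<lambda>t. \<Prod>i\<in>I. \<gamma> i t) = (\<Sum>i\<in>I. log_diff (\<gamma> i))"
  using assms
proof (induction I)
  case empty
  show ?case using log_diff_eq[of "\<lambda>t. 0" "\<lambda>t. 1"] by simp
next
  case (insert i I)
  then have "log_diff (\<lambda>t. \<gamma> i t * (\<Prod>j\<in>I. \<gamma> j t)) = log_diff (\<gamma> i) + log_diff (\<lambda>t. \<Prod>j\<in>I. \<gamma> j t)"
    by (intro log_diff_mult continuous_on_prod) auto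
  then show ?case
    using insert by simp
qed

lemma punctured_sphere_homeomorphic_plane:
  fixes b :: "real^3"
  assumes "b \<in> sphere 0 1"
  shows "(sphere 0 1 - {b}) homeomorphic (UNIV :: complex set)"
proof -
  have "(sphere 0 1 - {b}) homeomorphic {x::real^3. axis 1 1 \<bullet> x = 0}"
    by (rule homeomorphic_punctured_sphere_hyperplane) (use assms in \<open>auto simp: axis_eq_0_iff\<close>)
  also have "\<dots> homeomorphic (UNIV :: complex set)"
    by (rule homeomorphic_affine_sets) (auto simp: affine_hyperplane aff_dim_hyperplane axis_eq_0_iff)
  finally show ?thesis .
qed

lemma topspace_holed_sphere [simp]:
  "topspace (holed_sphere n e) = sphere 0 1 - (\<Union>i\<in>{1..n}. e i ` ball 0 1)"
  by (simp add: holed_sphere_def)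

lemma boundary_circle_in_holed_sphere:
  assumes d: "disjoint_discs n e" and i: "i \<in> {1..n}"
  shows "e i ` sphere 0 1 \<subseteq> sphere 0 1 - (\<Union>j\<in>{1..n}. e j ` ball 0 1)"
proof -
  have sub: "sphere 0 1 \<subseteq> cball (0::complex) 1" "ball 0 1 \<subseteq> cball (0::complex) 1" by auto
  have disjoint: "e i z \<notin> e j ` ball 0 1" if z: "z \<in> sphere 0 1" and j: "j \<in> {1..n}" for z j
  proof (cases "i = j")
    case True
    have "inj_on (e i) (cball 0 1)" using d i by (simp add: disjoint_discs_def)
    then show ?thesis using inj_on_image_mem_iff[of "e i" "cball 0 1" z "ball 0 1"] z sub True by auto
  next
    case False
    then have "e i ` cball 0 1 \<inter> e j ` cball 0 1 = {}"
      using d i j by (auto simp: disjoint_discs_def disjoint_family_on_def)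
    then show ?thesis using z sub by blast
  qed
  have sphere: "e i ` sphere 0 1 \<subseteq> sphere 0 1"
  proof -
    have "e i ` cball 0 1 \<subseteq> sphere 0 1"
      using d i unfolding disjoint_discs_def by blast
    then show ?thesis using sub by blast
  qed
  show ?thesis
  proof (intro image_subsetI DiffI notI)
    fix z :: complex assume z: "z \<in> sphere 0 1"
    show "e i z \<in> sphere 0 1" using sphere z by blast
    assume "e i z \<in> (\<Union>j\<in>{1..n}. e j ` ball 0 1)"
    then obtain j where "j \<in> {1..n}" "e i z \<in> e j ` ball 0 1" by (rule UN_E)
    then show False using disjoint[OF z] by metis
  qed
qed

lemma continuous_map_boundary_circle:
  assumes d: "disjoint_discs n e" and i: "i \<in> {1..n}"
  shows "continuous_map circle (holed_sphere n e) (e i)"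
proof -
  have "continuous_on (sphere 0 1) (e i)"
    using d i unfolding disjoint_discs_def
    by (metis continuous_on_subset sphere_cball)
  then show ?thesis
    using boundary_circle_in_holed_sphere[OF d i]
    by (auto simp: holed_sphere_def)
qed

text \<open>In a planar picture of the holed sphere a product of powers of linear factors prescribes
  all degrees but one; the last degree is forced, because the circles together bound the chain
  \<open>m\<close>.\<close>

lemma circle_valued_map_exists:
  fixes e :: "nat \<Rightarrow> complex \<Rightarrow> real^3" and d :: "nat \<Rightarrow> int"
  assumes discs: "disjoint_discs n e"
    and m: "singular_chain 2 (holed_sphere n e) m"
      "chain_boundary 2 m = (\<Sum>i\<in>{1..n}. chain_map 1 (e i) (frag_of standard_loop))"
    and d: "(\<Sum>i\<in>{1..n}. d i) = 0"
  obtains f :: "real^3 \<Rightarrow> complex" where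
    "continuous_map (holed_sphere n e) euclidean f"
    "\<And>x. x \<in> topspace (holed_sphere n e) \<Longrightarrow> f x \<noteq> 0"
    "\<And>i. i \<in> {1..n} \<Longrightarrow> log_diff (\<lambda>t. f (e i (cis (2 * pi * t)))) = of_int (d i) * (2 * of_real pi * \<i>)"
proof (cases "n = 0")
  case True
  show thesis by (rule that[of "\<lambda>_. 1"]) (auto simp: True)
next
  case False
  define X where "X = 2 * complex_of_real pi * \<i>"
  have X: "X \<noteq> 0" by (simp add: X_def)
  define S where "S = sphere 0 1 - (\<Union>i\<in>{1..n}. e i ` ball 0 1)"
  \<comment> \<open>The point sent to infinity is the centre of the first disc, so that the holed
    sphere and the remaining discs embed in the plane.\<close>
  define N where "N = e 1 0"
  have e: "continuous_on (cball 0 1) (e i)" "inj_on (e i) (cball 0 1)" "e i ` cball 0 1 \<subseteq> sphere 0 1"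
    if "i \<in> {1..n}" for i
    using bspec[OF conjunct1[OF discs[unfolded disjoint_discs_def]] that] by simp_all
  have disj: "e i z \<noteq> e j w" if "i \<in> {1..n}" "j \<in> {1..n}" "i \<noteq> j" "z \<in> cball 0 1" "w \<in> cball 0 1" for i j z w
  proof -
    have "e i ` cball 0 1 \<inter> e j ` cball 0 1 = {}"
      using disjoint_family_onD[OF conjunct2[OF discs[unfolded disjoint_discs_def]] that(1-3)] .
    then show ?thesis using that(4,5) by blast
  qed
  have N: "N \<in> sphere 0 1" using e(3)[of 1] False by (force simp: N_def)
  obtain h k where hk: "homeomorphism (sphere 0 1 - {N}) (UNIV :: complex set) h k"
    using punctured_sphere_homeomorphic_plane[OF N] unfolding homeomorphic_def by blast
  have h: "continuous_on (sphere 0 1 - {N}) h" "inj_on h (sphere 0 1 - {N})"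
    using hk by (auto simp: homeomorphism_def intro: inj_on_inverseI)
  have SN: "S \<subseteq> sphere 0 1 - {N}"
    using False by (force simp: S_def N_def)
  have eN: "e i ` cball 0 1 \<subseteq> sphere 0 1 - {N}" if "i \<in> {2..n}" for i
  proof (intro image_subsetI)
    fix z :: complex assume z: "z \<in> cball 0 1"
    have i: "i \<in> {1..n}" "1 \<in> {1..n}" "i \<noteq> 1" using that by auto
    have "e i z \<noteq> N" unfolding N_def by (rule disj[OF i z]) simp
    moreover have "e i z \<in> sphere 0 1" using e(3)[OF i(1)] z by blast
    ultimately show "e i z \<in> sphere 0 1 - {N}" by blast
  qed
  have he: "continuous_on (cball 0 1) (\<lambda>z. h (e i z))" "inj_on (\<lambda>z. h (e i z)) (cball 0 1)"
    if "i \<in> {2..n}" for i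
  proof -
    have i: "i \<in> {1..n}" using that by simp
    show "continuous_on (cball 0 1) (\<lambda>z. h (e i z))"
      by (rule continuous_on_compose2[OF h(1) e(1)[OF i] eN[OF that]])
    show "inj_on (\<lambda>z. h (e i z)) (cball 0 1)"
      using comp_inj_on[OF e(2)[OF i] inj_on_subset[OF h(2) eN[OF that]]] unfolding o_def .
  qed
  have eS: "e j z \<in> S" if "j \<in> {1..n}" "z \<in> sphere 0 1" for j z
    unfolding S_def using subsetD[OF boundary_circle_in_holed_sphere[OF discs that(1)] imageI[OF that(2)]] .
  define g where "g i x = h x - h (e i 0)" for i x
  have g0: "g i x \<noteq> 0" if "i \<in> {2..n}" "x \<in> S" for i x
  proof -
    have "x \<noteq> e i 0" using that by (force simp: S_def)
    moreover have "x \<in> sphere 0 1 - {N}" using SN that by blast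
    moreover have "(0::complex) \<in> cball 0 1" by simp
    then have "e i 0 \<in> sphere 0 1 - {N}" using eN[OF that(1)] by blast
    ultimately show ?thesis using inj_onD[OF h(2), of x "e i 0"] unfolding g_def right_minus_eq by metis
  qed
  have gc: "continuous_on S (g i)" for i
    unfolding g_def using continuous_on_subset[OF h(1) SN] by (intro continuous_intros)
  \<comment> \<open>The planar chart may traverse a boundary circle in either direction;
    \<open>\<epsilon> i\<close> records which.\<close>
  have "\<forall>i\<in>{2..n}. \<exists>\<epsilon>::int. (\<epsilon> = 1 \<or> \<epsilon> = - 1) \<and>
      log_diff (\<lambda>t. g i (e i (cis (2 * pi * t)))) = of_int \<epsilon> * X"
    unfolding g_def X_def by (intro ballI log_diff_embedded_disc he)
  from bchoice[OF this] obtain \<epsilon> :: "nat \<Rightarrow> int" where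
    \<epsilon>: "\<forall>i\<in>{2..n}. (\<epsilon> i = 1 \<or> \<epsilon> i = - 1) \<and>
      log_diff (\<lambda>t. g i (e i (cis (2 * pi * t)))) = of_int (\<epsilon> i) * X" ..
  have zero: "log_diff (\<lambda>t. g i (e j (cis (2 * pi * t)))) = 0"
    if "i \<in> {2..n}" "j \<in> {2..n}" "i \<noteq> j" for i j
  proof (rule log_diff_disc_boundary)
    show "continuous_on (cball 0 1) (\<lambda>z. g i (e j z))"
      unfolding g_def using he(1)[OF that(2)] by (intro continuous_intros)
    fix z :: complex assume z: "z \<in> cball 0 1"
    have "e j z \<noteq> e i 0" by (rule disj) (use that z in auto)
    moreover have "(0::complex) \<in> cball 0 1" by simp
    then have "e i 0 \<in> sphere 0 1 - {N}" using eN[OF that(1)] by blast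
    moreover have "e j z \<in> sphere 0 1 - {N}" using eN[OF that(2)] z by blast
    ultimately show "g i (e j z) \<noteq> 0"
      using inj_onD[OF h(2), of "e j z" "e i 0"] unfolding g_def right_minus_eq by metis
  qed
  \<comment> \<open>The factor for \<open>i\<close> winds \<open>\<epsilon> i\<close> times around
    its own circle and not at all around the other circles with index at least 2. The sign in the
    exponent squares to 1 and leaves \<open>d i\<close>.\<close>
  define f where "f x = (\<Prod>i\<in>{2..n}. g i x powi (\<epsilon> i * d i))" for x
  have fc: "continuous_on S f"
    unfolding f_def by (intro continuous_on_prod continuous_on_power_int gc) (use g0 in auto)
  have f0: "f x \<noteq> 0" if "x \<in> S" for x
    unfolding f_def using g0 that by (simp add: power_int_eq_0_iff)
  have fm: "continuous_map (holed_sphere n e) euclidean f" "\<And>x. x \<in> topspace (holed_sphere n e) \<Longrightarrow> f x \<noteq> 0"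
  proof -
    have "holed_sphere n e = top_of_set S" by (simp add: holed_sphere_def S_def)
    then show "continuous_map (holed_sphere n e) euclidean f" "\<And>x. x \<in> topspace (holed_sphere n e) \<Longrightarrow> f x \<noteq> 0"
      using fc f0 by simp_all
  qed
  have circ: "continuous_on {0..1} (\<lambda>t. u (e j (cis (2 * pi * t))))"
    if "continuous_on S u" "j \<in> {1..n}" for u :: "real^3 \<Rightarrow> complex" and j
  proof (rule continuous_on_compose2[OF that(1)])
    show "continuous_on {0..1} (\<lambda>t. e j (cis (2 * pi * t)))"
      by (rule continuous_on_compose2[OF e(1)[OF that(2)]]) (auto intro!: continuous_intros)
    show "(\<lambda>t. e j (cis (2 * pi * t))) ` {0..1} \<subseteq> S"
      by (intro image_subsetI eS[OF that(2)]) simp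
  qed
  have f_ge2: "log_diff (\<lambda>t. f (e j (cis (2 * pi * t)))) = of_int (d j) * X" if j: "j \<in> {2..n}" for j
  proof -
    have j1: "j \<in> {1..n}" using j by auto
    have nz: "g i (e j (cis (2 * pi * t))) \<noteq> 0" if "i \<in> {2..n}" for i t
      using g0 eS[OF j1] that by simp
    have "log_diff (\<lambda>t. f (e j (cis (2 * pi * t))))
      = (\<Sum>i\<in>{2..n}. log_diff (\<lambda>t. g i (e j (cis (2 * pi * t))) powi (\<epsilon> i * d i)))"
      unfolding f_def
      by (rule log_diff_prod)
        (use nz circ[OF gc j1] in \<open>auto intro!: continuous_on_power_int simp: power_int_eq_0_iff\<close>)
    also have "\<dots> = (\<Sum>i\<in>{2..n}. of_int (\<epsilon> i * d i) * log_diff (\<lambda>t. g i (e j (cis (2 * pi * t)))))"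
      by (rule sum.cong[OF refl], rule log_diff_power_int) (use nz circ[OF gc j1] in auto)
    also have "\<dots> = (\<Sum>i\<in>{2..n}. if i = j then of_int (\<epsilon> j * d j) * (of_int (\<epsilon> j) * X) else 0)"
      by (rule sum.cong[OF refl]) (use zero j \<epsilon> in auto)
    also have "\<dots> = of_int (\<epsilon> j * d j) * (of_int (\<epsilon> j) * X)"
      using j by simp
    also have "\<dots> = of_int (d j) * X"
      using bspec[OF \<epsilon> j] by auto
    finally show ?thesis .
  qed
  have ev: "evaluate (path_log f) (chain_map 1 (e i) (frag_of standard_loop))
      = log_diff (\<lambda>t. f (e i (cis (2 * pi * t))))" for i
    unfolding evaluate_chain_map evaluate_frag_of path_log_simplex_map unfolding path_log_def
    by (rule log_diff_cong) simp
  have split: "{1..n} = insert 1 {2..n}" using False by auto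
  \<comment> \<open>The logarithm cochain of \<open>f\<close> vanishes on the boundary of
    \<open>m\<close>. Together with the sum of the \<open>d i\<close> being 0, this determines the
    degree on the first circle.\<close>
  have "(\<Sum>i\<in>{1..n}. log_diff (\<lambda>t. f (e i (cis (2 * pi * t))))) = 0"
    using path_log_boundary[OF fm m(1)] unfolding m(2) evaluate_sum ev .
  moreover have "(\<Sum>i\<in>{2..n}. log_diff (\<lambda>t. f (e i (cis (2 * pi * t))))) = of_int (\<Sum>i\<in>{2..n}. d i) * X"
    unfolding of_int_sum sum_distrib_right by (rule sum.cong[OF refl f_ge2])
  moreover have "(\<Sum>i\<in>{1..n}. u i) = u 1 + (\<Sum>i\<in>{2..n}. u i)" for u :: "nat \<Rightarrow> complex"
    unfolding split by (rule sum.insert) auto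
  moreover have "(\<Sum>i\<in>{1..n}. d i) = d 1 + (\<Sum>i\<in>{2..n}. d i)"
    unfolding split by (rule sum.insert) auto
  then have "(\<Sum>i\<in>{2..n}. d i) = - d 1"
    using d by linarith
  ultimately have f_1: "log_diff (\<lambda>t. f (e 1 (cis (2 * pi * t)))) = of_int (d 1) * X"
    by simp
  show thesis
  proof (rule that[OF fm])
    show "log_diff (\<lambda>t. f (e i (cis (2 * pi * t)))) = of_int (d i) * (2 * of_real pi * \<i>)"
      if "i \<in> {1..n}" for i
    proof (cases "i = 1")
      case False
      then have "i \<in> {2..n}" using that by auto
      from f_ge2[OF this] show ?thesis unfolding X_def .
    qed (use f_1 in \<open>simp add: X_def\<close>)
  qed
qed

subsection \<open>Extension over a solid torus\<close>

lemma cis_eq_cases: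
  assumes "a \<in> {0..1}" "b \<in> {0..1}" "cis (2 * pi * a) = cis (2 * pi * b)"
  shows "a = b \<or> {a, b} = {0, 1}"
proof -
  have "exp (\<i> * of_real (2 * pi * a)) = exp (\<i> * of_real (2 * pi * b))"
    using assms(3) by (simp add: cis_conv_exp)
  then obtain k :: int where "\<i> * complex_of_real (2 * pi * a) = \<i> * of_real (2 * pi * b) + (of_int (2 * k) * pi) * \<i>"
    by (auto simp only: exp_eq)
  then have "2 * pi * a = 2 * pi * b + of_int (2 * k) * pi"
    by (auto dest: arg_cong[where f = Im])
  then have "2 * pi * (a - b - of_int k) = 0" by (simp add: algebra_simps)
  then have k: "a - b = of_int k" by simp
  then have "- 1 \<le> k" "k \<le> 1" using assms(1,2) by auto
  then have "k = - 1 \<or> k = 0 \<or> k = 1" by linarith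
  then show ?thesis using k assms(1,2) by auto
qed

text \<open>After division by \<open>z powi l\<close> the winding numbers along the two circle
  factors are \<open>2 * m\<close> and 0. Both are even, so half of a logarithm on the universal
  cover exponentiates to a function that descends to the torus.\<close>

lemma torus_square_root_exists:
  fixes N :: "complex \<times> complex \<Rightarrow> complex"
  assumes N: "continuous_on (sphere 0 1 \<times> sphere 0 1) N" "\<And>x. x \<in> sphere 0 1 \<times> sphere 0 1 \<Longrightarrow> N x \<noteq> 0"
    and m: "log_diff (\<lambda>t. N (cis (2 * pi * t), 1)) = of_int (2 * m) * (2 * of_real pi * \<i>)"
    and l: "log_diff (\<lambda>t. N (1, cis (2 * pi * t))) = of_int l * (2 * of_real pi * \<i>)"
  obtains s where "continuous_on (sphere 0 1 \<times> sphere 0 1) s"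
    "\<And>t z. t \<in> sphere 0 1 \<Longrightarrow> z \<in> sphere 0 1 \<Longrightarrow> N (t, z) = z powi l * (s (t, z))\<^sup>2"
proof -
  define q where "q = (\<lambda>(a, b). (cis (2 * pi * a), cis (2 * pi * b)))"
  have qc: "continuous_on A q" for A
    unfolding q_def case_prod_beta by (intro continuous_intros)
  have qs: "q x \<in> sphere 0 1 \<times> sphere 0 1" for x by (cases x) (simp add: q_def)
  have "continuous_on UNIV (\<lambda>x. N (q x))"
    by (rule continuous_on_compose2[OF N(1) qc]) (use qs in blast)
  then obtain H where H: "continuous_on UNIV H" "\<And>x. x \<in> UNIV \<Longrightarrow> N (q x) = exp (H x)"
    by (rule continuous_logarithm_on_contractible) (use N(2)[OF qs] in auto)
  have Hc: "continuous_on A (\<lambda>t. H (f t, g t))" if "continuous_on A f" "continuous_on A g"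
    for A :: "real set" and f g
    by (rule continuous_on_compose2[OF H(1)]) (use that in \<open>auto intro!: continuous_intros\<close>)
  have He: "exp (H (a, b)) = N (cis (2 * pi * a), cis (2 * pi * b))" for a b
    using H(2)[of "(a, b)"] by (simp add: q_def)
  have m': "H (1, 0) - H (0, 0) = of_int (2 * m) * (2 * of_real pi * \<i>)"
    unfolding m[symmetric]
    by (rule log_diff_eq[symmetric]) (auto intro!: Hc continuous_intros simp: He)
  have l': "H (0, 1) - H (0, 0) = of_int l * (2 * of_real pi * \<i>)"
    unfolding l[symmetric]
    by (rule log_diff_eq[symmetric]) (auto intro!: Hc continuous_intros simp: He)
  \<comment> \<open>The two vertical paths have the same image on the torus, so two logarithms of
    one path are compared and their increments agree. The same argument works horizontally.\<close>
  have "H (1, b * 1) - H (1, b * 0) = H (0, b * 1) - H (0, b * 0)" for b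
    by (rule log_diff_unique) (auto intro!: Hc continuous_intros simp: He)
  then have H1: "H (1, b) = H (0, b) + of_int (2 * m) * (2 * of_real pi * \<i>)" for b
    using m' by (simp add: algebra_simps)
  have "H (a * 1, 1) - H (a * 0, 1) = H (a * 1, 0) - H (a * 0, 0)" for a
    by (rule log_diff_unique) (auto intro!: Hc continuous_intros simp: He)
  then have H2: "H (a, 1) = H (a, 0) + of_int l * (2 * of_real pi * \<i>)" for a
    using l' by (simp add: algebra_simps)
  \<comment> \<open>The subtracted term is a logarithm of \<open>z powi l\<close> in the lifted
    angle \<open>snd x\<close>. Halving turns the first period into \<open>m\<close> full turns,
    which \<open>exp\<close> ignores, while the second period has been subtracted.\<close>
  define K where "K x = exp ((H x - of_int l * (2 * of_real pi * \<i>) * of_real (snd x)) / 2)" for x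
  have K1: "K (1, b) = K (0, b)" for b
  proof -
    have "(H (1, b) - c) / 2 = (H (0, b) - c) / 2 + of_int m * (2 * of_real pi * \<i>)" for c
      unfolding H1 by (simp add: field_simps)
    then have "K (1, b) = K (0, b) * exp (of_int m * (2 * of_real pi * \<i>))"
      unfolding K_def by (simp only: exp_add snd_conv)
    also have "exp (of_int m * (2 * of_real pi * \<i>)) = 1"
      using exp_integer_2pi[of "of_int m"] by (simp add: algebra_simps)
    finally show ?thesis by simp
  qed
  have K2: "K (a, 1) = K (a, 0)" for a
    unfolding K_def H2 by simp
  have Kq: "K x = K y" if "x \<in> {0..1} \<times> {0..1}" "y \<in> {0..1} \<times> {0..1}" "q x = q y" for x y
  proof -
    obtain a b c d where xy: "x = (a, b)" "y = (c, d)" by (meson surj_pair)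
    have "a = c \<or> {a, c} = {0, 1}" "b = d \<or> {b, d} = {0, 1}"
      using cis_eq_cases[of a c] cis_eq_cases[of b d] that by (auto simp: xy q_def)
    then have "K (a, b) = K (c, b)" "K (c, b) = K (c, d)"
      using K1 K2 by (auto simp: doubleton_eq_iff)
    then show ?thesis by (simp add: xy)
  qed
  have surj: "\<exists>x\<in>{0..1} \<times> {0..1}. y = q x" if "y \<in> sphere 0 1 \<times> sphere 0 1" for y
  proof -
    have *: "\<exists>a\<in>{0..1}. z = cis (2 * pi * a)" if "norm z = 1" for z
    proof
      show "z = cis (2 * pi * (Arg2pi z / (2 * pi)))"
        using Arg2pi_eq[of z] that by (simp add: cis_conv_exp)
      show "Arg2pi z / (2 * pi) \<in> {0..1}"
        using Arg2pi_ge_0[of z] Arg2pi_lt_2pi[of z] by (auto simp: field_simps)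
    qed
    obtain t z where "y = (t, z)" "norm t = 1" "norm z = 1"
      using \<open>y \<in> sphere 0 1 \<times> sphere 0 1\<close> by auto
    moreover from *[OF this(2)] *[OF this(3)]
    obtain a b where "a \<in> {0..1}" "b \<in> {0..1}" "t = cis (2 * pi * a)" "z = cis (2 * pi * b)" by blast
    ultimately show ?thesis by (intro bexI[of _ "(a, b)"]) (auto simp: q_def)
  qed
  define s where "s y = K (SOME x. x \<in> {0..1} \<times> {0..1} \<and> y = q x)" for y
  have sq: "s (q x) = K x" if "x \<in> {0..1} \<times> {0..1}" for x
  proof -
    have "(SOME x'. x' \<in> {0..1} \<times> {0..1} \<and> q x = q x') \<in> {0..1} \<times> {0..1} \<and>
        q x = q (SOME x'. x' \<in> {0..1} \<times> {0..1} \<and> q x = q x')"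
      by (rule someI[of _ x]) (use that in simp)
    then show ?thesis unfolding s_def using Kq[OF _ that] by metis
  qed
  have Kc: "continuous_on ({0..1} \<times> {0..1}) K"
    unfolding K_def using continuous_on_subset[OF H(1)] by (intro continuous_intros) auto
  show thesis
  proof
    \<comment> \<open>The compact square maps onto the torus, so the preimage of a closed set under
      \<open>s\<close> is the image of a compact set.\<close>
    show "continuous_on (sphere 0 1 \<times> sphere 0 1) s"
    proof (subst continuous_on_closed_vimage)
      show "closed (sphere (0::complex) 1 \<times> sphere (0::complex) 1)" by (intro closed_Times) auto
      show "\<forall>B. closed B \<longrightarrow> closed (s -` B \<inter> sphere 0 1 \<times> sphere 0 1)"
      proof (intro allI impI)
        fix B :: "complex set" assume B: "closed B"
        have "s -` B \<inter> sphere 0 1 \<times> sphere 0 1 = q ` (K -` B \<inter> {0..1} \<times> {0..1})"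
        proof (intro equalityI subsetI)
          fix y assume y: "y \<in> s -` B \<inter> sphere 0 1 \<times> sphere 0 1"
          then obtain x where "x \<in> {0..1} \<times> {0..1}" "y = q x" using surj by blast
          then show "y \<in> q ` (K -` B \<inter> {0..1} \<times> {0..1})" using y sq by auto
        next
          fix y assume "y \<in> q ` (K -` B \<inter> {0..1} \<times> {0..1})"
          then show "y \<in> s -` B \<inter> sphere 0 1 \<times> sphere 0 1" using sq qs by auto
        qed
        moreover have "closed (K -` B \<inter> {0..1} \<times> {0..1})"
          using Kc B continuous_on_closed_vimage[of "{0..1} \<times> {0..1}" K] by (simp add: closed_Times)
        then have "compact (K -` B \<inter> {0..1} \<times> {0..1})"
          using closed_Int_compact[of _ "{0..1} \<times> {0..1}"] compact_Times[of "{0..1::real}" "{0..1::real}"]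
          by (metis compact_Icc inf.right_idem)
        then have "closed (q ` (K -` B \<inter> {0..1} \<times> {0..1}))"
          using compact_continuous_image[OF qc] compact_imp_closed by blast
        ultimately show "closed (s -` B \<inter> sphere 0 1 \<times> sphere 0 1)" by simp
      qed
    qed
    fix t z :: complex assume tz: "t \<in> sphere 0 1" "z \<in> sphere 0 1"
    then obtain a b where ab: "(a, b) \<in> {0..1} \<times> {0..1}" "(t, z) = q (a, b)"
      using surj[of "(t, z)"] by auto
    have z: "z = cis (2 * pi * b)" using ab(2) by (simp add: q_def)
    have "z powi l = exp (of_int l * (2 * of_real pi * \<i>) * of_real b)"
      unfolding z cis_conv_exp exp_power_int by (simp add: algebra_simps)
    moreover have "(s (t, z))\<^sup>2 = exp (H (a, b) - of_int l * (2 * of_real pi * \<i>) * of_real b)"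
    proof -
      have "(exp (x / 2))\<^sup>2 = exp x" for x :: complex by (simp flip: exp_double)
      then show ?thesis unfolding ab(2) sq[OF ab(1)] K_def by simp
    qed
    moreover have "N (t, z) = exp (H (a, b))"
      using H(2)[of "(a, b)"] ab(2) by simp
    ultimately show "N (t, z) = z powi l * (s (t, z))\<^sup>2"
      by (simp flip: exp_add)
  qed
qed

text \<open>The factor \<open>z powi l\<close> depends on the core coordinate alone and lives on the
  whole solid torus. The rest is a square, so it lifts to \<open>C^2\<close>, where it can be pushed
  off the origin in the second coordinate while the radius shrinks.\<close>

lemma solid_torus_extension:
  fixes N :: "complex \<times> complex \<Rightarrow> complex"
  assumes N: "continuous_on (sphere 0 1 \<times> sphere 0 1) N" "\<And>x. x \<in> sphere 0 1 \<times> sphere 0 1 \<Longrightarrow> N x \<noteq> 0"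
    and m: "log_diff (\<lambda>t. N (cis (2 * pi * t), 1)) = of_int (2 * m) * (2 * of_real pi * \<i>)"
    and l: "log_diff (\<lambda>t. N (1, cis (2 * pi * t))) = of_int l * (2 * of_real pi * \<i>)"
  obtains w where "continuous_on (cball 0 1 \<times> sphere 0 1) w"
    "\<And>x. x \<in> cball 0 1 \<times> sphere 0 1 \<Longrightarrow> w x \<noteq> 0"
    "\<And>t z. t \<in> sphere 0 1 \<Longrightarrow> z \<in> sphere 0 1 \<Longrightarrow> cone_scale (z powi l) (veronese (w (t, z))) = (N (t, z), 0, 0)"
proof -
  obtain s where s: "continuous_on (sphere 0 1 \<times> sphere 0 1) s"
    "\<And>t z. t \<in> sphere 0 1 \<Longrightarrow> z \<in> sphere 0 1 \<Longrightarrow> N (t, z) = z powi l * (s (t, z))\<^sup>2"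
    using torus_square_root_exists[OF assms] by metis
  have s0: "s (t, z) \<noteq> 0" if "t \<in> sphere 0 1" "z \<in> sphere 0 1" for t z
    using s(2)[OF that] N(2)[of "(t, z)"] that by auto
  \<comment> \<open>\<open>w = (r s, 1 - r)\<close> at radius \<open>r\<close>: the second coordinate keeps \<open>w\<close> off the origin at the core.\<close>
  define w1 where "w1 x = of_real (norm (fst x)) * s (sgn (fst x), snd x)" for x :: "complex \<times> complex"
  define w where "w x = (w1 x, complex_of_real (1 - norm (fst x)))" for x
  \<comment> \<open>\<open>sgn (fst x)\<close> has no limit at the core. Continuity there comes from
    a bound on \<open>s\<close> and the factor \<open>norm (fst x)\<close>.\<close>
  have "compact (s ` (sphere 0 1 \<times> sphere 0 1))"
    by (intro compact_continuous_image s(1) compact_Times) auto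
  then obtain B where B: "\<And>y. y \<in> sphere 0 1 \<times> sphere 0 1 \<Longrightarrow> norm (s y) \<le> B"
    using compact_imp_bounded by (metis bounded_iff imageI)
  have w1c: "continuous (at x within cball 0 1 \<times> sphere 0 1) w1" if x: "x \<in> cball 0 1 \<times> sphere 0 1" for x
  proof (cases "fst x = 0")
    case False
    define U where "U = (cball 0 1 - {0::complex}) \<times> sphere (0::complex) 1"
    have "continuous_on U w1"
      unfolding w1_def
    proof (intro continuous_intros)
      show "continuous_on U (\<lambda>x. s (sgn (fst x), snd x))"
        by (rule continuous_on_compose2[OF s(1)])
          (auto simp: U_def norm_sgn intro!: continuous_intros)
    qed
    moreover have "U = (cball 0 1 \<times> sphere 0 1) \<inter> ((- {0}) \<times> UNIV)"
      by (auto simp: U_def)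
    moreover have "open ((- {0 :: complex}) \<times> (UNIV :: complex set))"
      by (intro open_Times) auto
    moreover have "x \<in> U" using x False by (auto simp: U_def)
    moreover have "at x within cball 0 1 \<times> sphere 0 1 = at x within U"
      by (rule at_within_nhd[where S = "(- {0}) \<times> UNIV"])
        (use calculation in auto)
    ultimately show ?thesis
      by (simp add: continuous_on_eq_continuous_within)
  next
    case True
    have "\<forall>\<^sub>F y in at x within cball 0 1 \<times> sphere 0 1. norm (w1 y) \<le> norm (fst y) * B"
      unfolding eventually_at_filter
    proof (intro always_eventually allI impI)
      fix y :: "complex \<times> complex" assume y: "y \<in> cball 0 1 \<times> sphere 0 1"
      show "norm (w1 y) \<le> norm (fst y) * B"
      proof (cases "fst y = 0")
        case False
        then have "norm (s (sgn (fst y), snd y)) \<le> B"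
          using y by (intro B) (auto simp: norm_sgn)
        then show ?thesis by (simp add: w1_def norm_mult mult_left_mono)
      qed (simp add: w1_def)
    qed
    moreover have "((\<lambda>y. norm (fst y) * B) \<longlongrightarrow> norm (fst x) * B) (at x within cball 0 1 \<times> sphere 0 1)"
      by (intro tendsto_intros)
    then have "((\<lambda>y. norm (fst y) * B) \<longlongrightarrow> 0) (at x within cball 0 1 \<times> sphere 0 1)"
      using True by simp
    ultimately have "(w1 \<longlongrightarrow> 0) (at x within cball 0 1 \<times> sphere 0 1)"
      by (rule Lim_null_comparison)
    then show ?thesis using True by (simp add: continuous_within w1_def)
  qed
  show thesis
  proof
    show "continuous_on (cball 0 1 \<times> sphere 0 1) w"
      unfolding w_def using w1c
      by (intro continuous_intros) (auto simp: continuous_on_eq_continuous_within)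
    fix x :: "complex \<times> complex" assume x: "x \<in> cball 0 1 \<times> sphere 0 1"
    show "w x \<noteq> 0"
    proof (cases "norm (fst x) = 1")
      case True
      then have "fst x \<in> sphere 0 1" by simp
      moreover have "sgn (fst x) = fst x" using True by (simp add: sgn_div_norm)
      ultimately have "w1 x \<noteq> 0" using s0[of "fst x" "snd x"] x True by (auto simp: w1_def)
      then show ?thesis by (simp add: w_def zero_prod_def)
    next
      case False
      then show ?thesis by (simp add: w_def zero_prod_def)
    qed
  next
    fix t z :: complex assume tz: "t \<in> sphere 0 1" "z \<in> sphere 0 1"
    have "w (t, z) = (s (t, z), 0)"
      using tz by (simp add: w_def w1_def sgn_div_norm)
    then show "cone_scale (z powi l) (veronese (w (t, z))) = (N (t, z), 0, 0)"
      using s(2)[OF tz] by (simp add: veronese_def cone_scale_def)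
  qed
qed

subsection \<open>The contribution of one torus\<close>

lemma chain_boundary_2_frag_of:
  "chain_boundary 2 (frag_of \<sigma>)
     = frag_of (singular_face 2 0 \<sigma>) - frag_of (singular_face 2 1 \<sigma>) + frag_of (singular_face 2 2 \<sigma>)"
  by (simp add: chain_boundary_of numeral_2_eq_2)

lemma singular_simplex_weaken:
  assumes "continuous_map T A (\<lambda>x. x)" "singular_simplex p T \<sigma>"
  shows "singular_simplex p A \<sigma>"
proof -
  have "continuous_map (subtopology (powertop_real UNIV) (standard_simplex p)) T \<sigma>"
    using assms(2) by (simp add: singular_simplex_def)
  from continuous_map_compose[OF this assms(1)] assms(2) show ?thesis
    by (simp add: singular_simplex_def o_def)
qed

lemma singular_simplex_in_topspace:
  assumes "singular_simplex p X \<sigma>" "x \<in> standard_simplex p"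
  shows "\<sigma> x \<in> topspace X"
  using assms by (auto simp: singular_simplex_def continuous_map_def)

lemma edge_point_cover: "x \<in> standard_simplex (Suc 0) \<Longrightarrow> x = edge_point (x 1) \<and> 0 \<le> x 1 \<and> x 1 \<le> 1"
  by (auto simp: standard_simplex_def edge_point_def fun_eq_iff)

lemma singular_1_simplex_eqI:
  assumes "\<sigma> \<in> extensional (standard_simplex 1)" "\<tau> \<in> extensional (standard_simplex 1)"
    and "\<And>t. 0 \<le> t \<Longrightarrow> t \<le> 1 \<Longrightarrow> \<sigma> (edge_point t) = \<tau> (edge_point t)"
  shows "\<sigma> = \<tau>"
proof (rule extensionalityI[OF assms(1,2)])
  fix x :: "nat \<Rightarrow> real" assume "x \<in> standard_simplex 1"
  then have "x = edge_point (x 1)" "0 \<le> x 1" "x 1 \<le> 1"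
    using edge_point_cover[of x] by simp_all
  then show "\<sigma> x = \<tau> x" using assms(3) by metis
qed

lemma circle_prism_1_triangle_point:
  assumes "0 \<le> s" "0 \<le> t" "s + t \<le> 1"
  shows "circle_prism 1 0 \<sigma> (triangle_point (s, t)) = (\<sigma> (edge_point t), cis (2 * pi * (s + t)))"
    and "circle_prism 1 1 \<sigma> (triangle_point (s, t)) = (\<sigma> (edge_point (s + t)), cis (2 * pi * t))"
proof -
  have "triangle_point (s, t) \<in> standard_simplex 2"
    by (rule triangle_point_in_simplex) (use assms in \<open>simp add: std_triangle_def\<close>)
  moreover have "merge_coordinates 0 (triangle_point (s, t)) = edge_point t"
    "merge_coordinates 1 (triangle_point (s, t)) = edge_point (s + t)"
    by (auto simp: merge_coordinates_def triangle_point_def edge_point_def fun_eq_iff)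
  moreover have "{0<..Suc 1} = {1, 2::nat}" "{1<..Suc 1} = {2::nat}" by auto
  ultimately show "circle_prism 1 0 \<sigma> (triangle_point (s, t)) = (\<sigma> (edge_point t), cis (2 * pi * (s + t)))"
    "circle_prism 1 1 \<sigma> (triangle_point (s, t)) = (\<sigma> (edge_point (s + t)), cis (2 * pi * t))"
    by (simp_all add: circle_prism_def triangle_point_def numeral_2_eq_2)
qed

text \<open>The two triangles are the halves of a square wrapped onto the torus. Opposite sides
  coincide because both factors are loops; the last equation is the common diagonal. So the
  difference of the triangles is a cycle.\<close>

lemma circle_prism_loop_faces:
  defines "\<sigma> \<equiv> \<lambda>E. simplex_map 1 E standard_loop"
  shows "singular_face 2 0 (circle_prism 1 0 (\<sigma> E)) = simplex_map 1 (\<lambda>z. (E z, 1)) standard_loop"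
    "singular_face 2 2 (circle_prism 1 0 (\<sigma> E)) = simplex_map 1 (\<lambda>z. (E 1, z)) standard_loop"
    "singular_face 2 0 (circle_prism 1 1 (\<sigma> E)) = simplex_map 1 (\<lambda>z. (E 1, z)) standard_loop"
    "singular_face 2 2 (circle_prism 1 1 (\<sigma> E)) = simplex_map 1 (\<lambda>z. (E z, 1)) standard_loop"
    "singular_face 2 1 (circle_prism 1 0 (\<sigma> E)) = singular_face 2 1 (circle_prism 1 1 (\<sigma> E))"
proof -
  have E: "simplex_map 1 f standard_loop (edge_point t) = f (cis (2 * pi * t))"
    if "0 \<le> t" "t \<le> 1" for f :: "complex \<Rightarrow> 'b" and t
    using that by (simp add: simplex_map_def)
  have ext: "singular_face 2 k \<tau> \<in> extensional (standard_simplex 1)"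
    "simplex_map 1 f \<upsilon> \<in> extensional (standard_simplex 1)"
    for k and \<tau> :: "(nat \<Rightarrow> real) \<Rightarrow> 'b" and f :: "'c \<Rightarrow> 'b" and \<upsilon>
    by (simp_all add: singular_face_def simplex_map_def)
  note rules = singular_face_edge_point circle_prism_1_triangle_point E \<sigma>_def
  show "singular_face 2 0 (circle_prism 1 0 (\<sigma> E)) = simplex_map 1 (\<lambda>z. (E z, 1)) standard_loop"
    by (rule singular_1_simplex_eqI[OF ext(1) ext(2)]) (simp add: rules[unfolded One_nat_def])
  show "singular_face 2 2 (circle_prism 1 0 (\<sigma> E)) = simplex_map 1 (\<lambda>z. (E 1, z)) standard_loop"
    by (rule singular_1_simplex_eqI[OF ext(1) ext(2)]) (simp add: rules[unfolded One_nat_def])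
  show "singular_face 2 0 (circle_prism 1 1 (\<sigma> E)) = simplex_map 1 (\<lambda>z. (E 1, z)) standard_loop"
    by (rule singular_1_simplex_eqI[OF ext(1) ext(2)]) (simp add: rules[unfolded One_nat_def])
  show "singular_face 2 2 (circle_prism 1 1 (\<sigma> E)) = simplex_map 1 (\<lambda>z. (E z, 1)) standard_loop"
    by (rule singular_1_simplex_eqI[OF ext(1) ext(2)]) (simp add: rules[unfolded One_nat_def])
  show "singular_face 2 1 (circle_prism 1 0 (\<sigma> E)) = singular_face 2 1 (circle_prism 1 1 (\<sigma> E))"
    by (rule singular_1_simplex_eqI[OF ext(1) ext(1)]) (simp add: rules[unfolded One_nat_def])
qed

text \<open>Compares two integral lifts on a torus, with values \<open>(d, 1)\<close> and
  \<open>(a, b)\<close> on boundary circle and fibre, through the halves occurring in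
  \<open>half_defect\<close>.\<close>

lemma torus_pairing_parity:
  fixes p q d a b :: int
  assumes "coprime p q" "odd p" "odd q \<Longrightarrow> d = 1 \<or> d = - 1" "even q \<Longrightarrow> d = 0"
    and "p * a + q * b = 0" "odd b"
  shows "even (d div 2 + (b div 2) * a + (a div 2) * b + (q + d * p) div 2)"
proof -
  \<comment> \<open>By coprimality \<open>(a, b)\<close> is a multiple of \<open>(q, - p)\<close>.
    The factor \<open>\<alpha>\<close> is odd because \<open>b\<close> is, which reduces the claim
    to parities of halves.\<close>
  have "p dvd q * b"
    using assms(5) by (metis add_eq_0_iff dvd_minus_iff dvd_triv_left)
  then have "p dvd b"
    using assms(1) by (simp add: coprime_dvd_mult_right_iff)
  then obtain \<alpha>' where b: "b = p * \<alpha>'" by blast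
  define \<alpha> where "\<alpha> = - \<alpha>'"
  have b: "b = - \<alpha> * p" using b by (simp add: \<alpha>_def)
  have "p * a = p * (\<alpha> * q)"
    using assms(5) unfolding b by (simp add: algebra_simps)
  then have a: "a = \<alpha> * q" using \<open>odd p\<close> by auto
  have "odd \<alpha>" using \<open>odd b\<close> b by simp
  then obtain A where A: "\<alpha> = 2 * A + 1" by (metis oddE)
  from \<open>odd p\<close> obtain P where P: "p = 2 * P + 1" by (metis oddE)
  have b2: "b = 2 * (- (2 * A * P + A + P) - 1) + 1"
    unfolding b A P by (simp add: algebra_simps)
  have half: "(2 * x + 1) div 2 = x" for x :: int by simp
  have bd: "b div 2 = - (2 * A * P + A + P) - 1" unfolding b2 by (rule half)
  show ?thesis
  proof (cases "even q")
    case True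
    then obtain Q where Q: "q = 2 * Q" by (metis evenE)
    have "a = 2 * (\<alpha> * Q)" unfolding a Q by simp
    then have ad: "a div 2 = \<alpha> * Q" and "even a" by simp_all
    have "d = 0" using assms(4) True by blast
    then have "even ((a div 2) * b + (q + d * p) div 2)"
      unfolding ad Q using \<open>odd \<alpha>\<close> \<open>odd b\<close> by simp
    then show ?thesis using \<open>even a\<close> \<open>d = 0\<close> by simp
  next
    case False
    then obtain Q where Q: "q = 2 * Q + 1" by (metis oddE)
    have a2: "a = 2 * (2 * A * Q + A + Q) + 1" unfolding a A Q by (simp add: algebra_simps)
    then have ad: "a div 2 = 2 * A * Q + A + Q" and oa: "odd a"
      using half[of "2 * A * Q + A + Q"] by simp_all
    have e: "even (b div 2 * a) \<longleftrightarrow> even (A + P + 1)" "even (a div 2 * b) \<longleftrightarrow> even (A + Q)"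
      using oa \<open>odd b\<close> unfolding ad bd by auto
    from assms(3) False consider "d = 1" | "d = - 1" by blast
    then show ?thesis
    proof cases
      case 1
      then have "(q + d * p) div 2 = P + Q + 1" unfolding P Q by simp
      then show ?thesis using e 1 by auto
    next
      case 2
      \<comment> \<open>Division rounds down, so \<open>d div 2 = - 1\<close> here; this odd term
        makes up for the one missing from \<open>Q - P\<close> compared with the case
        \<open>d = 1\<close>.\<close>
      then have "(q + d * p) div 2 = Q - P" unfolding P Q by simp
      then show ?thesis using e 2 by auto
    qed
  qed
qed

lemma of_int_bit: "of_int n = (of_bool (odd n) :: bit)"
  by (cases "even n") (auto elim!: evenE oddE)

text \<open>The torus over the circle is evaluated twice: with the lift \<open>g\<close> this is the
  left-hand side, with the lift \<open>r\<close> it is 0, since the torus bounds in the solid torus.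
  The unknown \<open>w\<close> contributes equally to both and drops out.\<close>

lemma torus_contribution:
  fixes E :: "complex \<Rightarrow> 'a" and X :: "'a topology" and M :: "'m topology" and p q d l :: int
  defines "T \<equiv> prod_topology X circle" and "V \<equiv> prod_topology disc circle"
  defines "\<gamma> \<equiv> simplex_map 1 (\<lambda>z. (E z, 1 :: complex)) standard_loop"
    and "\<eta> \<equiv> simplex_map 1 (\<lambda>z. (E 1, z :: complex)) standard_loop"
  assumes \<phi>: "homeomorphic_map (prod_topology circle circle) T \<phi>"
    and E: "continuous_map circle X E"
    and hom: "homologous_rel 1 T {} (chain_map 1 (\<lambda>z. \<phi> (z, 1)) (frag_of standard_loop))
      (frag_cmul p (frag_of \<gamma>) + frag_cmul q (frag_of \<eta>))"
    and jV: "continuous_map V M jV"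
    and glue: "\<And>y. y \<in> topspace (prod_topology circle circle) \<Longrightarrow> jV y = jA (\<phi> y)"
    and cube: "cube_primitive M c w"
    and g: "\<And>\<sigma>. singular_simplex 1 T \<sigma> \<Longrightarrow> of_int (g \<sigma>) = c (simplex_map 1 jA \<sigma>)" "g \<gamma> = d" "g \<eta> = 1"
    and r: "\<And>\<sigma>. singular_simplex 1 V \<sigma> \<Longrightarrow> of_int (r \<sigma>) = c (simplex_map 1 jV \<sigma>)"
      "\<And>\<sigma>. singular_simplex 2 V \<sigma> \<Longrightarrow>
         r (singular_face 2 0 \<sigma>) + r (singular_face 2 2 \<sigma>) = r (singular_face 2 1 \<sigma>)"
      "\<And>\<sigma>. singular_simplex 1 V \<sigma> \<Longrightarrow> \<sigma> (edge_point 0) = \<sigma> (edge_point 1) \<Longrightarrow>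
         of_int (r \<sigma>) * (2 * of_real pi * \<i>) = log_diff (\<lambda>t. snd (\<sigma> (edge_point t)) powi l)"
    and pq: "coprime p q" "odd p" "odd q \<Longrightarrow> d = 1 \<or> d = - 1" "even q \<Longrightarrow> d = 0"
  shows "circle_slant (half_defect g (\<lambda>\<sigma>. w (simplex_map 2 jA \<sigma>))) (simplex_map 1 E standard_loop)
    = of_int ((q + d * p) div 2)"
proof -
  let ?CC = "prod_topology circle circle"
  obtain \<psi> where "homeomorphic_maps ?CC T \<phi> \<psi>"
    using \<phi> homeomorphic_map_maps by blast
  then have \<psi>: "continuous_map T ?CC \<psi>" "\<And>y. y \<in> topspace ?CC \<Longrightarrow> \<psi> (\<phi> y) = y"
    "\<And>x. x \<in> topspace T \<Longrightarrow> \<phi> (\<psi> x) = x" and \<phi>c: "continuous_map ?CC T \<phi>"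
    by (auto simp: homeomorphic_maps_def)
  have CV: "continuous_map ?CC V (\<lambda>x. x)"
  proof -
    have "?CC = top_of_set (sphere 0 1 \<times> sphere 0 1)" "V = top_of_set (cball 0 1 \<times> sphere 0 1)"
      unfolding V_def by (simp_all flip: subtopology_Times)
    then show ?thesis by auto
  qed
  define \<sigma> where "\<sigma> = simplex_map 1 E standard_loop"
  have \<sigma>: "singular_simplex 1 X \<sigma>"
    unfolding \<sigma>_def by (rule singular_simplex_simplex_map[OF singular_simplex_standard_loop E])
  define S where "S k = circle_prism 1 k \<sigma>" for k
  have S: "singular_simplex 2 T (S k)" if "k \<le> 1" for k
    using singular_simplex_circle_prism[OF \<sigma> that] by (simp add: S_def T_def numeral_2_eq_2)
  have faces: "singular_face 2 0 (S 0) = \<gamma>" "singular_face 2 2 (S 0) = \<eta>"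
    "singular_face 2 0 (S 1) = \<eta>" "singular_face 2 2 (S 1) = \<gamma>"
    "singular_face 2 1 (S 0) = singular_face 2 1 (S 1)"
    unfolding S_def \<sigma>_def \<gamma>_def \<eta>_def by (rule circle_prism_loop_faces)+
  have \<gamma>\<eta>: "singular_simplex 1 T \<gamma>" "singular_simplex 1 T \<eta>"
    using singular_simplex_singular_face[OF S[of 0], of 0] singular_simplex_singular_face[OF S[of 0], of 2]
    by (simp_all add: faces)
  define S' where "S' k = simplex_map 2 \<psi> (S k)" for k
  have S': "singular_simplex 2 V (S' k)" if "k \<le> 1" for k
    unfolding S'_def by (rule singular_simplex_weaken[OF CV singular_simplex_simplex_map[OF S[OF that] \<psi>(1)]])
  define \<gamma>' \<eta>' where "\<gamma>' = simplex_map 1 \<psi> \<gamma>" and "\<eta>' = simplex_map 1 \<psi> \<eta>"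
  have V1: "singular_simplex 1 V (simplex_map 1 \<psi> \<tau>)" if "singular_simplex 1 T \<tau>" for \<tau>
    by (rule singular_simplex_weaken[OF CV singular_simplex_simplex_map[OF that \<psi>(1)]])
  have face_map: "singular_face 2 k (simplex_map 2 \<psi> \<tau>) = simplex_map 1 \<psi> (singular_face 2 k \<tau>)" if "k \<le> 2" for k \<tau>
    using singular_face_simplex_map[of 2 k \<psi> \<tau>] that
    by (simp add: simplex_map_def singular_face_def restrict_def fun_eq_iff)
  have faces': "singular_face 2 0 (S' 0) = \<gamma>'" "singular_face 2 2 (S' 0) = \<eta>'"
    "singular_face 2 0 (S' 1) = \<eta>'" "singular_face 2 2 (S' 1) = \<gamma>'"
    "singular_face 2 1 (S' 0) = singular_face 2 1 (S' 1)"
    unfolding S'_def \<gamma>'_def \<eta>'_def by (simp_all add: face_map faces[unfolded One_nat_def])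
  \<comment> \<open>Values of the lift on the solid torus on the boundary circle and on the
    fibre.\<close>
  define a b where "a = r \<gamma>'" and "b = r \<eta>'"
  define W where "W k = w (simplex_map 2 jA (S k))" for k
  have jj: "simplex_map k jV (simplex_map k \<psi> \<tau>) = simplex_map k jA \<tau>" if "singular_simplex k T \<tau>" for k \<tau>
  proof -
    have "jV (\<psi> (\<tau> x)) = jA (\<tau> x)" if "x \<in> standard_simplex k" for x
    proof -
      have t: "\<tau> x \<in> topspace T"
        using singular_simplex_in_topspace[OF \<open>singular_simplex k T \<tau>\<close> that] .
      then have "\<psi> (\<tau> x) \<in> topspace ?CC" using \<psi>(1) by (auto simp: continuous_map_def)
      from glue[OF this] show ?thesis using \<psi>(3)[OF t] by simp
    qed
    then show ?thesis by (auto simp: simplex_map_def restrict_def fun_eq_iff)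
  qed
  \<comment> \<open>Carried to the solid torus by \<open>\<psi>\<close>, the two triangles still
    form a cycle, which bounds there; the cocycle built from \<open>r\<close> therefore vanishes on
    it.\<close>
  have zero: "(W 0 + of_int (b div 2) * of_int a) + (W 1 + of_int (a div 2) * of_int b) = 0"
  proof -
    have "chain_boundary 2 (frag_of (S' 0) - frag_of (S' 1)) = 0"
      unfolding chain_boundary_diff chain_boundary_2_frag_of faces' by simp
    moreover have "singular_chain 2 V (frag_of (S' 0) - frag_of (S' 1))"
      using S' by (intro singular_chain_diff) (simp_all add: singular_chain_of)
    ultimately obtain z where z: "singular_chain 3 V z" "chain_boundary 3 z = frag_of (S' 0) - frag_of (S' 1)"
      using solid_torus_2_cycle_bounds[of "frag_of (S' 0) - frag_of (S' 1)"]
      unfolding V_def singular_cycle by metis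
    have "evaluate (half_defect r (\<lambda>\<sigma>. w (simplex_map 2 jV \<sigma>))) (chain_boundary 3 z) = 0"
      by (rule evaluate_chain_boundary_0[OF z(1)],
          rule half_defect_cocycle[OF cube_primitive_pullback[OF cube jV] r(1,2)])
    then have "half_defect r (\<lambda>\<sigma>. w (simplex_map 2 jV \<sigma>)) (S' 0)
        + half_defect r (\<lambda>\<sigma>. w (simplex_map 2 jV \<sigma>)) (S' 1) = 0"
      unfolding z(2) evaluate_diff evaluate_frag_of by simp
    moreover have "w (simplex_map 2 jV (S' k)) = W k" if "k \<le> 1" for k
      unfolding W_def S'_def using jj[OF S[OF that]] by simp
    ultimately show ?thesis
      unfolding half_defect_def faces' by (simp add: a_def b_def)
  qed
  define X2 where "X2 = 2 * complex_of_real pi * \<i>"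
  have X2: "X2 \<noteq> 0" by (simp add: X2_def)
  define u where "u y = snd (\<psi> y) powi l" for y
  have u: "continuous_map T euclidean u" "\<And>y. y \<in> topspace T \<Longrightarrow> u y \<noteq> 0"
  proof -
    have "continuous_map T circle (\<lambda>y. snd (\<psi> y))"
      using continuous_map_compose[OF \<psi>(1) continuous_map_snd] by (simp add: o_def)
    moreover have "continuous_map circle euclidean (\<lambda>z. z powi l)"
      by (auto intro!: continuous_on_power_int continuous_intros)
    ultimately show "continuous_map T euclidean u"
      unfolding u_def using continuous_map_compose[of T circle "\<lambda>y. snd (\<psi> y)" euclidean "\<lambda>z. z powi l"]
      by (simp add: o_def)
    show "u y \<noteq> 0" if "y \<in> topspace T" for y
    proof -
      have "\<psi> y \<in> topspace ?CC" using \<psi>(1) that by (auto simp: continuous_map_def)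
      then show ?thesis by (cases "\<psi> y") (auto simp: u_def power_int_eq_0_iff)
    qed
  qed
  have plog: "of_int (r (simplex_map 1 \<psi> \<tau>)) * X2 = path_log u \<tau>"
    if "singular_simplex 1 T \<tau>" "\<tau> (edge_point 0) = \<tau> (edge_point 1)" for \<tau>
  proof -
    have "of_int (r (simplex_map 1 \<psi> \<tau>)) * X2 = log_diff (\<lambda>t. snd (simplex_map 1 \<psi> \<tau> (edge_point t)) powi l)"
      unfolding X2_def by (rule r(3)[OF V1[OF that(1)]]) (use that(2) in \<open>simp add: simplex_map_def\<close>)
    also have "\<dots> = path_log u \<tau>"
      unfolding path_log_def by (rule log_diff_cong) (simp add: simplex_map_def u_def)
    finally show ?thesis .
  qed
  \<comment> \<open>Along the meridian the core coordinate is constantly 1, and so is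
    \<open>u\<close>. Expanding the class of the meridian in circle and fibre turns this into the
    relation between \<open>a\<close> and \<open>b\<close>.\<close>
  have "evaluate (path_log u) (chain_map 1 (\<lambda>z. \<phi> (z, 1)) (frag_of standard_loop)) = 0"
  proof -
    have "evaluate (path_log u) (chain_map 1 (\<lambda>z. \<phi> (z, 1)) (frag_of standard_loop))
      = log_diff (\<lambda>t. 1)"
      unfolding evaluate_chain_map evaluate_frag_of path_log_simplex_map unfolding path_log_def
      by (rule log_diff_cong) (simp add: u_def \<psi>(2))
    also have "\<dots> = 0" using log_diff_eq[of "\<lambda>t. 0" "\<lambda>t. 1"] by simp
    finally show ?thesis .
  qed
  moreover have "evaluate (path_log u) (frag_cmul p (frag_of \<gamma>) + frag_cmul q (frag_of \<eta>))
      = of_int (p * a + q * b) * X2"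
  proof -
    have "path_log u \<gamma> = of_int a * X2"
      unfolding a_def \<gamma>'_def by (rule plog[OF \<gamma>\<eta>(1), symmetric]) (simp add: \<gamma>_def simplex_map_def)
    moreover have "path_log u \<eta> = of_int b * X2"
      unfolding b_def \<eta>'_def by (rule plog[OF \<gamma>\<eta>(2), symmetric]) (simp add: \<eta>_def simplex_map_def)
    ultimately show ?thesis by (simp add: evaluate_add evaluate_cmul algebra_simps)
  qed
  ultimately have "of_int (p * a + q * b) * X2 = 0"
    using path_log_homologous[OF u hom] by simp
  then have pab: "p * a + q * b = 0" using X2 by (simp only: mult_eq_0_iff of_int_eq_0_iff simp_thms)
  \<comment> \<open>Both lifts reduce to \<open>c\<close> on the fibre, where \<open>g\<close> is
    1.\<close>
  have "of_int b = c (simplex_map 1 jA \<eta>)"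
    unfolding b_def \<eta>'_def using r(1)[OF V1[OF \<gamma>\<eta>(2)]] jj[OF \<gamma>\<eta>(2)] by simp
  also have "\<dots> = 1" using g(1)[OF \<gamma>\<eta>(2)] g(3) by simp
  finally have "odd b" by (simp add: of_int_bit split: if_splits)
  \<comment> \<open>On the fibre \<open>g\<close> is 1 and its half rounds to 0, so only
    \<open>d div 2\<close> survives. Replacing \<open>W 0 + W 1\<close> by means of
    \<open>zero\<close> eliminates \<open>w\<close>.\<close>
  have "circle_slant (half_defect g (\<lambda>\<sigma>. w (simplex_map 2 jA \<sigma>))) \<sigma>
      = (W 0 + of_int ((1::int) div 2) * of_int d) + (W 1 + of_int (d div 2) * of_int 1)"
    unfolding circle_slant_def half_defect_def S_def[symmetric] faces g(2,3) W_def ..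
  also have "\<dots> = of_int (d div 2 + (b div 2) * a + (a div 2) * b)"
  proof -
    have "x + y + (z + t) = s + y + t + v"
      if "(x + s) + (z + v) = 0" "y = 0" for x y z t s v :: bit
      using that by (cases x; cases y; cases z; cases t; cases s; cases v) simp_all
    from this[OF zero, of 0 "of_int (d div 2)"] show ?thesis by (simp add: ac_simps)
  qed
  also have "\<dots> = of_int ((q + d * p) div 2)"
    using torus_pairing_parity[OF pq pab \<open>odd b\<close>] unfolding of_int_bit by auto
  finally show ?thesis by (simp add: \<sigma>_def)
qed

subsection \<open>Maps and chains on the glued space\<close>

text \<open>Coherence holds only in homology of the boundary; a correction by a chain in the
  boundary makes it an equation of chains.\<close>

lemma coherent_boundary_chain:
  assumes discs: "disjoint_discs n e" and coh: "coherently_oriented n e \<zeta> \<mu>"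
  obtains m where "singular_chain 2 (holed_sphere n e) m"
    "chain_boundary 2 m = (\<Sum>i\<in>{1..n}. chain_map 1 (e i) (frag_of standard_loop))"
proof -
  define \<Sigma> where "\<Sigma> = holed_sphere n e"
  define B where "B = holed_sphere_boundary n e"
  define S where "S = subtopology \<Sigma> B"
  let ?l = "frag_of standard_loop"
  have \<zeta>: "group_generator (homology_group 1 circle) \<zeta>"
    and \<mu>: "group_generator (relative_homology_group 2 \<Sigma> B) \<mu>"
    and bd: "hom_boundary 2 \<Sigma> B \<mu> = (\<Otimes>\<^bsub>homology_group 1 S\<^esub> i\<in>{1..n}. hom_induced 1 circle {} S {} (e i) \<zeta>)"
    using coh by (simp_all add: coherently_oriented_def Let_def \<Sigma>_def B_def S_def)
  obtain \<epsilon> :: int where \<epsilon>: "\<epsilon> = 1 \<or> \<epsilon> = - 1"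
    "\<zeta> = homologous_rel_set 1 circle {} (frag_cmul \<epsilon> ?l)"
    using circle_generator[OF \<zeta>] by metis
  have \<epsilon>l: "singular_relcycle 1 circle {} (frag_cmul \<epsilon> ?l)"
    by (rule singular_relcycle_cmul[OF singular_relcycle_standard_loop])
  have eS: "continuous_map circle S (e i)" if "i \<in> {1..n}" for i
  proof -
    have "e i \<in> topspace circle \<rightarrow> B"
      using that by (auto simp: B_def holed_sphere_boundary_def boundary_circle_def)
    with continuous_map_boundary_circle[OF discs that] show ?thesis
      unfolding S_def \<Sigma>_def by (simp only: continuous_map_in_subtopology simp_thms)
  qed
  have cyc: "singular_relcycle 1 S {} (chain_map 1 (e i) (frag_cmul \<epsilon> ?l))" if "i \<in> {1..n}" for i
    by (rule singular_relcycle_chain_map[OF \<epsilon>l eS[OF that]]) simp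
  have ind: "hom_induced 1 circle {} S {} (e i) \<zeta> = homologous_rel_set 1 S {} (chain_map 1 (e i) (frag_cmul \<epsilon> ?l))"
    if "i \<in> {1..n}" for i
    using hom_induced_chain_map[OF eS[OF that] _ \<epsilon>l, of "{}"] by (simp add: \<epsilon>(2))
  interpret comm_group "homology_group 1 S" by (rule abelian_homology_group)
  have "(\<Otimes>\<^bsub>homology_group 1 S\<^esub> i\<in>{1..n}. hom_induced 1 circle {} S {} (e i) \<zeta>)
      = (\<Otimes>\<^bsub>homology_group 1 S\<^esub> i\<in>{1..n}. homologous_rel_set 1 S {} (chain_map 1 (e i) (frag_cmul \<epsilon> ?l)))"
  proof (rule finprod_cong'[OF refl])
    show "(\<lambda>i. homologous_rel_set 1 S {} (chain_map 1 (e i) (frag_cmul \<epsilon> ?l))) \<in> {1..n} \<rightarrow> carrier (homology_group 1 S)"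
      using cyc carrier_relative_homology_group[of 1 S "{}"] by auto
  qed (rule ind)
  also have "\<dots> = homologous_rel_set 1 S {} (\<Sum>i\<in>{1..n}. chain_map 1 (e i) (frag_cmul \<epsilon> ?l))"
    using homologous_rel_set_finprod[of "{1..n}" 1 S "{}" "\<lambda>i. chain_map 1 (e i) (frag_cmul \<epsilon> ?l)"] cyc
    by simp
  finally have fin: "hom_boundary 2 \<Sigma> B \<mu> = homologous_rel_set 1 S {} (\<Sum>i\<in>{1..n}. chain_map 1 (e i) (frag_cmul \<epsilon> ?l))"
    using bd by simp
  have "\<mu> \<in> carrier (relative_homology_group 2 \<Sigma> B)"
    using \<mu> by (simp add: group_generator_def)
  then obtain m0 where m0: "singular_relcycle 2 \<Sigma> B m0" "\<mu> = homologous_rel_set 2 \<Sigma> B m0"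
    using carrier_relative_homology_group[of 2 \<Sigma> B] by auto
  have "hom_boundary 2 \<Sigma> B \<mu> = homologous_rel_set 1 S {} (chain_boundary 2 m0)"
    using hom_boundary_chain_boundary[OF m0(1)] by (simp add: m0(2) S_def)
  with fin have "homologous_rel 1 S {} (chain_boundary 2 m0) (\<Sum>i\<in>{1..n}. chain_map 1 (e i) (frag_cmul \<epsilon> ?l))"
    by (simp only: homologous_rel_set_eq homologous_rel_eq)
  then obtain y where y: "singular_chain 2 S y"
    "chain_boundary 2 y = chain_boundary 2 m0 - (\<Sum>i\<in>{1..n}. chain_map 1 (e i) (frag_cmul \<epsilon> ?l))"
    by (auto simp: homologous_rel_def singular_boundary numeral_2_eq_2)
  \<comment> \<open>Subtracting \<open>y\<close> makes the boundary exactly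
    \<open>\<epsilon>\<close> times the sum of the circles; multiplication by
    \<open>\<epsilon>\<close> then removes the sign.\<close>
  have ch: "singular_chain 2 \<Sigma> (m0 - y)"
    using m0(1) y(1) by (intro singular_chain_diff) (simp_all add: singular_relcycle S_def singular_chain_subtopology)
  have sum: "(\<Sum>i\<in>{1..n}. chain_map 1 (e i) (frag_cmul \<epsilon> ?l)) = frag_cmul \<epsilon> (\<Sum>i\<in>{1..n}. chain_map 1 (e i) ?l)"
    by (simp only: chain_map_cmul frag_cmul_sum)
  show thesis
  proof
    show "singular_chain 2 (holed_sphere n e) (frag_cmul \<epsilon> (m0 - y))"
      using singular_chain_cmul[OF ch] by (simp add: \<Sigma>_def)
    have "\<epsilon> * \<epsilon> = 1" using \<epsilon>(1) by auto
    then show "chain_boundary 2 (frag_cmul \<epsilon> (m0 - y)) = (\<Sum>i\<in>{1..n}. chain_map 1 (e i) ?l)"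
      by (simp only: chain_boundary_cmul chain_boundary_diff y(2) sum diff_diff_eq2 add_diff_cancel_left'
          frag_cmul_cmul frag_cmul_one)
  qed
qed

text \<open>\<open>\<zeta>\<close> is the standard loop up to a sign, and the same sign multiplies
  every term of the gluing relation, so it can be removed.\<close>

lemma gluing_homology:
  assumes \<zeta>: "group_generator (homology_group 1 circle) \<zeta>"
    and glue: "seifert_gluing n p q e \<zeta> \<phi>" and i: "i \<in> {1..n}"
    and e: "continuous_map circle (top_of_set (boundary_circle e i)) (e i)"
  shows "homeomorphic_map (prod_topology circle circle) (boundary_torus e i) (\<phi> i)"
    "homologous_rel 1 (boundary_torus e i) {} (chain_map 1 (\<lambda>z. \<phi> i (z, 1)) (frag_of standard_loop))
      (frag_cmul (p i) (chain_map 1 (\<lambda>z. (e i z, 1)) (frag_of standard_loop))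
       + frag_cmul (q i) (chain_map 1 (\<lambda>z. (e i 1, z)) (frag_of standard_loop)))"
proof -
  define T where "T = boundary_torus e i"
  let ?l = "frag_of standard_loop"
  let ?cls = "\<lambda>\<gamma>. hom_induced 1 circle {} T {} \<gamma> \<zeta>"
  have \<phi>: "homeomorphic_map (prod_topology circle circle) T (\<phi> i)"
    and cls: "?cls (\<lambda>z. \<phi> i (z, 1)) =
          ?cls (\<lambda>z. (e i z, 1)) [^]\<^bsub>homology_group 1 T\<^esub> p i \<otimes>\<^bsub>homology_group 1 T\<^esub> ?cls (\<lambda>z. (e i 1, z)) [^]\<^bsub>homology_group 1 T\<^esub> q i"
    using glue i by (auto simp: seifert_gluing_def Let_def T_def)
  show "homeomorphic_map (prod_topology circle circle) (boundary_torus e i) (\<phi> i)"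
    using \<phi> by (simp add: T_def)
  obtain \<epsilon> :: int where \<epsilon>: "\<epsilon> = 1 \<or> \<epsilon> = - 1"
    "\<zeta> = homologous_rel_set 1 circle {} (frag_cmul \<epsilon> ?l)"
    using circle_generator[OF \<zeta>] by metis
  have \<epsilon>l: "singular_relcycle 1 circle {} (frag_cmul \<epsilon> ?l)"
    by (rule singular_relcycle_cmul[OF singular_relcycle_standard_loop])
  have cyc: "singular_relcycle 1 T {} (chain_map 1 \<gamma> (frag_cmul \<epsilon> ?l))"
    and ind: "?cls \<gamma> = homologous_rel_set 1 T {} (chain_map 1 \<gamma> (frag_cmul \<epsilon> ?l))"
    if "continuous_map circle T \<gamma>" for \<gamma>
  proof -
    show "singular_relcycle 1 T {} (chain_map 1 \<gamma> (frag_cmul \<epsilon> ?l))"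
      by (rule singular_relcycle_chain_map[OF \<epsilon>l that]) simp
    show "?cls \<gamma> = homologous_rel_set 1 T {} (chain_map 1 \<gamma> (frag_cmul \<epsilon> ?l))"
      using hom_induced_chain_map[OF that _ \<epsilon>l, of "{}"] by (simp add: \<epsilon>(2))
  qed
  have c1: "continuous_map circle T (\<lambda>z. \<phi> i (z, 1))"
  proof -
    have "continuous_map circle (prod_topology circle circle) (\<lambda>z. (z, 1))"
      unfolding continuous_map_paired by auto
    from continuous_map_compose[OF this homeomorphic_imp_continuous_map[OF \<phi>]]
    show ?thesis by (simp add: o_def)
  qed
  have c2: "continuous_map circle T (\<lambda>z. (e i z, 1))"
    unfolding T_def boundary_torus_def continuous_map_paired using e by auto
  have c3: "continuous_map circle T (\<lambda>z. (e i 1, z))"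
    unfolding T_def boundary_torus_def continuous_map_paired by (auto simp: boundary_circle_def)
  have "homologous_rel_set 1 T {} (chain_map 1 (\<lambda>z. \<phi> i (z, 1)) (frag_cmul \<epsilon> ?l))
     = homologous_rel_set 1 T {} (frag_cmul (p i) (chain_map 1 (\<lambda>z. (e i z, 1)) (frag_cmul \<epsilon> ?l))
       + frag_cmul (q i) (chain_map 1 (\<lambda>z. (e i 1, z)) (frag_cmul \<epsilon> ?l)))"
    using cls unfolding ind[OF c1] ind[OF c2] ind[OF c3]
    using homologous_rel_set_int_pow[OF cyc[OF c2], of "p i"] homologous_rel_set_int_pow[OF cyc[OF c3], of "q i"]
      homologous_rel_set_mult[OF singular_relcycle_cmul[OF cyc[OF c2], of "p i"] singular_relcycle_cmul[OF cyc[OF c3], of "q i"]]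
    by simp
  then have "homologous_rel 1 T {} (chain_map 1 (\<lambda>z. \<phi> i (z, 1)) (frag_cmul \<epsilon> ?l))
     (frag_cmul (p i) (chain_map 1 (\<lambda>z. (e i z, 1)) (frag_cmul \<epsilon> ?l))
       + frag_cmul (q i) (chain_map 1 (\<lambda>z. (e i 1, z)) (frag_cmul \<epsilon> ?l)))"
    by (simp only: homologous_rel_set_eq homologous_rel_eq)
  then have "singular_relboundary 1 T {} (frag_cmul \<epsilon> (chain_map 1 (\<lambda>z. \<phi> i (z, 1)) (frag_cmul \<epsilon> ?l)
     - (frag_cmul (p i) (chain_map 1 (\<lambda>z. (e i z, 1)) (frag_cmul \<epsilon> ?l))
       + frag_cmul (q i) (chain_map 1 (\<lambda>z. (e i 1, z)) (frag_cmul \<epsilon> ?l)))))"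
    unfolding homologous_rel_def by (rule singular_relboundary_cmul)
  moreover have "frag_cmul \<epsilon> (chain_map 1 (\<lambda>z. \<phi> i (z, 1)) (frag_cmul \<epsilon> ?l)
     - (frag_cmul (p i) (chain_map 1 (\<lambda>z. (e i z, 1)) (frag_cmul \<epsilon> ?l))
       + frag_cmul (q i) (chain_map 1 (\<lambda>z. (e i 1, z)) (frag_cmul \<epsilon> ?l))))
    = chain_map 1 (\<lambda>z. \<phi> i (z, 1)) ?l - (frag_cmul (p i) (chain_map 1 (\<lambda>z. (e i z, 1)) ?l)
       + frag_cmul (q i) (chain_map 1 (\<lambda>z. (e i 1, z)) ?l))"
  proof -
    have 1: "\<epsilon> * \<epsilon> = 1" "\<epsilon> * (k * \<epsilon>) = k" for k using \<epsilon>(1) by auto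
    show ?thesis
      by (simp only: frag_cmul_diff_right frag_cmul_distrib2 chain_map_cmul frag_cmul_cmul 1 frag_cmul_one)
  qed
  ultimately show "homologous_rel 1 (boundary_torus e i) {} (chain_map 1 (\<lambda>z. \<phi> i (z, 1)) ?l)
      (frag_cmul (p i) (chain_map 1 (\<lambda>z. (e i z, 1)) ?l) + frag_cmul (q i) (chain_map 1 (\<lambda>z. (e i 1, z)) ?l))"
    unfolding homologous_rel_def T_def by simp
qed

lemma adjunction_space_maps:
  assumes f: "f ` (C \<inter> topspace B) \<subseteq> topspace A"
  shows "continuous_map A (adjunction_space A B C f) Inl"
    "continuous_map B (adjunction_space A B C f) (attach_map C f)"
proof -
  have "f x \<in> topspace A" if "x \<in> C" "x \<in> topspace B" for x
    using f that by blast
  then show "continuous_map A (adjunction_space A B C f) Inl"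
    "continuous_map B (adjunction_space A B C f) (attach_map C f)"
    using topspace_adjunction_space[OF f]
    by (auto simp: continuous_map_def openin_adjunction_space attach_map_def)
qed

lemma continuous_map_from_adjunction_space:
  assumes f: "f ` (C \<inter> topspace B) \<subseteq> topspace A"
    and a: "continuous_map A Y a" and b: "continuous_map B Y b"
    and ab: "\<And>x. x \<in> C \<inter> topspace B \<Longrightarrow> b x = a (f x)"
  shows "continuous_map (adjunction_space A B C f) Y (case_sum a b)"
proof -
  let ?S = "adjunction_space A B C f"
  have top: "topspace ?S = Inl ` topspace A \<union> Inr ` (topspace B - C)"
    by (rule topspace_adjunction_space[OF f])
  have "openin ?S {x \<in> topspace ?S. case_sum a b x \<in> U}" if U: "openin Y U" for U
  proof -
    have "{z \<in> topspace A. Inl z \<in> {x \<in> topspace ?S. case_sum a b x \<in> U}} = {z \<in> topspace A. a z \<in> U}"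
      by (auto simp: top)
    moreover have "{z \<in> topspace B. attach_map C f z \<in> {x \<in> topspace ?S. case_sum a b x \<in> U}} = {z \<in> topspace B. b z \<in> U}"
      using f ab by (auto simp: top attach_map_def)
    ultimately show ?thesis
      using openin_continuous_map_preimage[OF a U] openin_continuous_map_preimage[OF b U]
      by (auto simp: openin_adjunction_space top)
  qed
  moreover have "case_sum a b \<in> topspace ?S \<rightarrow> topspace Y"
    using a b by (auto simp: top continuous_map_def)
  ultimately show ?thesis by (simp add: continuous_map_def)
qed

lemma continuous_map_from_sum_topology:
  assumes "\<And>i. i \<in> I \<Longrightarrow> continuous_map (X i) Y (\<lambda>x. f (i, x))"
  shows "continuous_map (sum_topology X I) Y f"
  unfolding continuous_map_def
proof (intro conjI allI impI)
  have "f (i, x) \<in> topspace Y" if "i \<in> I" "x \<in> topspace (X i)" for i x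
    using continuous_map_image_subset_topspace[OF assms[OF that(1)]] that(2) by blast
  then show "f \<in> topspace (sum_topology X I) \<rightarrow> topspace Y"
    by auto
  fix U assume U: "openin Y U"
  have "openin (X i) {x. (i, x) \<in> {z \<in> topspace (sum_topology X I). f z \<in> U}}" if "i \<in> I" for i
  proof -
    have "{x. (i, x) \<in> {z \<in> topspace (sum_topology X I). f z \<in> U}} = {x \<in> topspace (X i). f (i, x) \<in> U}"
      using that by auto
    then show ?thesis using openin_continuous_map_preimage[OF assms[OF that] U] by simp
  qed
  then show "openin (sum_topology X I) {z \<in> topspace (sum_topology X I). f z \<in> U}"
    unfolding openin_sum_topology by auto
qed

text \<open>Transports the pieces into \<open>M\<close> through the homeomorphism, so that later
  arguments see only the maps \<open>jA\<close> and \<open>jV\<close>. The last clause is the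
  universal property of the gluing, for the ambient space of the cone as target.\<close>

lemma seifert_space_maps:
  fixes M :: "'m topology" and e :: "nat \<Rightarrow> complex \<Rightarrow> real^3"
  assumes M: "M homeomorphic_space seifert_space n e \<phi>"
    and \<phi>: "\<And>i y. i \<in> {1..n} \<Longrightarrow> y \<in> sphere 0 1 \<times> sphere 0 1 \<Longrightarrow>
      \<phi> i y \<in> topspace (prod_topology (holed_sphere n e) circle)"
  obtains jA jV where
    "continuous_map (prod_topology (holed_sphere n e) circle) M jA"
    "\<And>i. i \<in> {1..n} \<Longrightarrow> continuous_map (prod_topology disc circle) M (jV i)"
    "\<And>i y. i \<in> {1..n} \<Longrightarrow> y \<in> sphere 0 1 \<times> sphere 0 1 \<Longrightarrow> jV i y = jA (\<phi> i y)"
    "topspace M = jA ` topspace (prod_topology (holed_sphere n e) circle) \<union>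
      (\<Union>i\<in>{1..n}. jV i ` topspace (prod_topology disc circle))"
    "\<forall>(a :: (real^3) \<times> complex \<Rightarrow> complex \<times> complex \<times> complex) b.
      continuous_map (prod_topology (holed_sphere n e) circle) euclidean a \<longrightarrow>
      (\<forall>i\<in>{1..n}. continuous_map (prod_topology disc circle) euclidean (b i)) \<longrightarrow>
      (\<forall>i\<in>{1..n}. \<forall>y\<in>sphere 0 1 \<times> sphere 0 1. b i y = a (\<phi> i y)) \<longrightarrow>
      (\<exists>F. continuous_map M euclidean F \<and>
        (\<forall>x\<in>topspace (prod_topology (holed_sphere n e) circle). F (jA x) = a x) \<and>
        (\<forall>i\<in>{1..n}. \<forall>y\<in>topspace (prod_topology disc circle). F (jV i y) = b i y))"
proof -
  define A where "A = prod_topology (holed_sphere n e) circle"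
  define V where "V = prod_topology disc circle"
  define B where "B = sum_topology (\<lambda>i. V) {1..n}"
  define C where "C = {1..n} \<times> sphere (0::complex) 1 \<times> sphere (0::complex) 1"
  define f where "f = (\<lambda>(i, y). \<phi> i y)"
  define S where "S = adjunction_space A B C f"
  have S: "seifert_space n e \<phi> = S"
    by (simp add: seifert_space_def S_def A_def B_def C_def f_def V_def)
  have Vtop: "topspace V = cball 0 1 \<times> sphere 0 1" by (simp add: V_def)
  have CB: "C \<inter> topspace B = C" by (auto simp: C_def B_def Vtop)
  have f: "f ` (C \<inter> topspace B) \<subseteq> topspace A"
    unfolding CB
  proof (intro image_subsetI)
    fix x assume "x \<in> C"
    then obtain i y where "x = (i, y)" "i \<in> {1..n}" "y \<in> sphere 0 1 \<times> sphere 0 1"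
      unfolding C_def by blast
    then show "f x \<in> topspace A" using \<phi>[of i y] by (simp add: f_def A_def)
  qed
  obtain h k where hk: "homeomorphic_maps M S h k"
    using M unfolding S homeomorphic_space_def by blast
  have h: "continuous_map M S h" and k: "continuous_map S M k"
    and hk': "\<And>x. x \<in> topspace M \<Longrightarrow> k (h x) = x" "\<And>y. y \<in> topspace S \<Longrightarrow> h (k y) = y"
    using hk by (auto simp: homeomorphic_maps_def)
  define jA where "jA x = k (Inl x)" for x
  define jV where "jV i y = k (attach_map C f (i, y))" for i y
  have Inl: "continuous_map A S Inl" and att: "continuous_map B S (attach_map C f)"
    unfolding S_def by (rule adjunction_space_maps[OF f])+
  have comp: "continuous_map V B (\<lambda>y. (i, y))" if "i \<in> {1..n}" for i
    unfolding B_def using that by (rule continuous_map_component_injection)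
  have attV: "continuous_map V S (\<lambda>y. attach_map C f (i, y))" if "i \<in> {1..n}" for i
    using continuous_map_compose[OF comp[OF that] att] by (simp add: o_def)
  have top: "topspace S = Inl ` topspace A \<union> Inr ` (topspace B - C)"
    unfolding S_def by (rule topspace_adjunction_space[OF f])
  show thesis
  proof (rule that[of jA jV])
    show "continuous_map (prod_topology (holed_sphere n e) circle) M jA"
      using continuous_map_compose[OF Inl k] by (simp add: jA_def[abs_def] o_def A_def)
    show cV: "continuous_map (prod_topology disc circle) M (jV i)" if "i \<in> {1..n}" for i
      using continuous_map_compose[OF attV[OF that] k] by (simp add: jV_def[abs_def] o_def V_def)
    show "jV i y = jA (\<phi> i y)" if "i \<in> {1..n}" "y \<in> sphere 0 1 \<times> sphere 0 1" for i y
      using that by (auto simp: jV_def jA_def attach_map_def C_def f_def)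
    have surj: "x \<in> jA ` topspace A \<union> (\<Union>i\<in>{1..n}. jV i ` topspace V)" if x: "x \<in> topspace M" for x
    proof -
      have "h x \<in> topspace S" using h x by (auto simp: continuous_map_def)
      then consider z where "z \<in> topspace A" "h x = Inl z"
        | i y where "i \<in> {1..n}" "y \<in> topspace V" "(i, y) \<notin> C" "h x = Inr (i, y)"
        unfolding top B_def by auto
      then show ?thesis
      proof cases
        case 1
        then have "x = jA z" using hk'(1)[OF x] by (simp add: jA_def)
        with 1 show ?thesis by blast
      next
        case 2
        then have "x = jV i y" using hk'(1)[OF x] by (simp add: jV_def attach_map_def)
        with 2 show ?thesis by blast
      qed
    qed
    have subA: "jA ` topspace A \<subseteq> topspace M"
      using continuous_map_image_subset_topspace[OF continuous_map_compose[OF Inl k]] by (simp add: jA_def o_def)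
    have subV: "jV i ` topspace V \<subseteq> topspace M" if "i \<in> {1..n}" for i
      using continuous_map_image_subset_topspace[OF cV[OF that]] by (simp add: V_def)
    have "topspace M = jA ` topspace A \<union> (\<Union>i\<in>{1..n}. jV i ` topspace V)"
      by (intro equalityI subsetI[OF surj] Un_least UN_least subA subV)
    then show "topspace M = jA ` topspace (prod_topology (holed_sphere n e) circle) \<union>
      (\<Union>i\<in>{1..n}. jV i ` topspace (prod_topology disc circle))"
      unfolding A_def V_def .
    show "\<forall>(a :: (real^3) \<times> complex \<Rightarrow> complex \<times> complex \<times> complex) b.
      continuous_map (prod_topology (holed_sphere n e) circle) euclidean a \<longrightarrow>
      (\<forall>i\<in>{1..n}. continuous_map (prod_topology disc circle) euclidean (b i)) \<longrightarrow>
      (\<forall>i\<in>{1..n}. \<forall>y\<in>sphere 0 1 \<times> sphere 0 1. b i y = a (\<phi> i y)) \<longrightarrow>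
      (\<exists>F. continuous_map M euclidean F \<and>
        (\<forall>x\<in>topspace (prod_topology (holed_sphere n e) circle). F (jA x) = a x) \<and>
        (\<forall>i\<in>{1..n}. \<forall>y\<in>topspace (prod_topology disc circle). F (jV i y) = b i y))"
    proof (intro allI impI)
    fix a :: "(real^3) \<times> complex \<Rightarrow> complex \<times> complex \<times> complex"
      and b :: "nat \<Rightarrow> complex \<times> complex \<Rightarrow> complex \<times> complex \<times> complex"
    assume a: "continuous_map (prod_topology (holed_sphere n e) circle) euclidean a"
      and b': "\<forall>i\<in>{1..n}. continuous_map (prod_topology disc circle) euclidean (b i)"
      and ab': "\<forall>i\<in>{1..n}. \<forall>y\<in>sphere 0 1 \<times> sphere 0 1. b i y = a (\<phi> i y)"
    note b = bspec[OF b']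
    have ab: "b i y = a (\<phi> i y)" if "i \<in> {1..n}" "y \<in> sphere 0 1 \<times> sphere 0 1" for i y
      by (rule bspec[OF bspec[OF ab' that(1)] that(2)])
    define F where "F = case_sum a (\<lambda>(i, y). b i y) \<circ> h"
    have "continuous_map S euclidean (case_sum a (\<lambda>(i, y). b i y))"
      unfolding S_def
    proof (rule continuous_map_from_adjunction_space[OF f])
      show "continuous_map A euclidean a" using a by (simp add: A_def)
      show "continuous_map B euclidean (\<lambda>(i, y). b i y)"
        unfolding B_def by (rule continuous_map_from_sum_topology) (use b in \<open>simp add: V_def\<close>)
      show "(\<lambda>(i, y). b i y) x = a (f x)" if "x \<in> C \<inter> topspace B" for x
        using that ab by (auto simp: C_def f_def)
    qed
    then have "continuous_map M euclidean F"
      unfolding F_def by (rule continuous_map_compose[OF h])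
    moreover have "F (jA x) = a x" if "x \<in> topspace A" for x
      using hk'(2)[of "Inl x"] that by (simp add: F_def jA_def top)
    moreover have "F (jV i y) = b i y" if "i \<in> {1..n}" "y \<in> topspace V" for i y
    proof -
      have "attach_map C f (i, y) \<in> topspace S"
        using continuous_map_image_subset_topspace[OF attV[OF that(1)]] that(2) by blast
      then have "F (jV i y) = case_sum a (\<lambda>(i, y). b i y) (attach_map C f (i, y))"
        using hk'(2) by (simp add: F_def jV_def)
      also have "\<dots> = b i y"
        using ab[OF that(1)] by (auto simp: attach_map_def C_def f_def)
      finally show ?thesis .
    qed
    ultimately show "\<exists>F. continuous_map M euclidean F \<and>
        (\<forall>x\<in>topspace (prod_topology (holed_sphere n e) circle). F (jA x) = a x) \<and>
        (\<forall>i\<in>{1..n}. \<forall>y\<in>topspace (prod_topology disc circle). F (jV i y) = b i y)"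
      unfolding A_def V_def by blast
    qed
  qed
qed

subsection \<open>The essential class\<close>

lemma sum_alternating_even: "even n \<Longrightarrow> (\<Sum>k<n. (- 1) ^ k) = (0::int)"
proof -
  have "(\<Sum>k<2 * m. (- 1) ^ k) = (0::int)" for m by (induction m) auto
  then show "even n \<Longrightarrow> (\<Sum>k<n. (- 1) ^ k) = (0::int)" by (metis evenE)
qed

text \<open>Turns the alternation over positions in \<open>js\<close> into signs attached to fibres;
  the signs cancel in total because the list has even length.\<close>

lemma alternating_signs_exist:
  fixes js :: "nat list" and p q :: "nat \<Rightarrow> int"
  assumes "distinct js" "set js = {i \<in> {1..n}. odd (q i)}" "even (card {i \<in> {1..n}. odd (q i)})"
  obtains d :: "nat \<Rightarrow> int" where
    "\<And>i. i \<in> {1..n} \<Longrightarrow> odd (q i) \<Longrightarrow> d i = 1 \<or> d i = - 1" "\<And>i. even (q i) \<Longrightarrow> d i = 0"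
    "(\<Sum>i\<in>{1..n}. d i) = 0"
    "(\<Sum>i\<in>{1..n}. d i * p i) = (\<Sum>k<length js. (- 1) ^ k * p (js ! k))"
proof
  \<comment> \<open>Inverts the enumeration: as \<open>js\<close> has no repetition, at most one
    position contributes, and none does for even \<open>q i\<close>.\<close>
  define d :: "nat \<Rightarrow> int" where "d i = (\<Sum>k<length js. if js ! k = i then (- 1) ^ k else 0)" for i
  show "d i = 1 \<or> d i = - 1" if "i \<in> {1..n}" "odd (q i)" for i
  proof -
    have "i \<in> set js" using that assms(2) by simp
    then obtain k0 where k0: "k0 < length js" "js ! k0 = i" by (auto simp: in_set_conv_nth)
    have "d i = (\<Sum>k<length js. if k = k0 then (- 1) ^ k0 else 0)"
      unfolding d_def
      by (rule sum.cong[OF refl]) (use k0 assms(1) in \<open>auto simp: nth_eq_iff_index_eq\<close>)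
    also have "\<dots> = (- 1) ^ k0" using k0 by simp
    finally show ?thesis by (cases "even k0") auto
  qed
  show "d i = 0" if "even (q i)" for i
    unfolding d_def
  proof (rule sum.neutral, rule ballI)
    fix k assume "k \<in> {..<length js}"
    then have "js ! k \<in> set js" by simp
    then show "(if js ! k = i then (- 1) ^ k else 0) = (0::int)" using that assms(2) by auto
  qed
  have s: "(\<Sum>i\<in>{1..n}. d i * p i) = (\<Sum>k<length js. (- 1) ^ k * p (js ! k))" for p :: "nat \<Rightarrow> int"
  proof -
    have "(\<Sum>i\<in>{1..n}. d i * p i) = (\<Sum>i\<in>{1..n}. \<Sum>k<length js. if i = js ! k then (- 1) ^ k * p (js ! k) else 0)"
      unfolding d_def sum_distrib_right by (intro sum.cong refl) auto
    also have "\<dots> = (\<Sum>k<length js. \<Sum>i\<in>{1..n}. if i = js ! k then (- 1) ^ k * p (js ! k) else 0)"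
      by (rule sum.swap)
    also have "\<dots> = (\<Sum>k<length js. (- 1) ^ k * p (js ! k))"
    proof (rule sum.cong[OF refl])
      fix k assume "k \<in> {..<length js}"
      then have "js ! k \<in> set js" by simp
      then have "js ! k \<in> {1..n}" using assms(2) by blast
      then show "(\<Sum>i\<in>{1..n}. if i = js ! k then (- 1) ^ k * p (js ! k) else 0) = (- 1) ^ k * p (js ! k)"
        by simp
    qed
    finally show ?thesis .
  qed
  show "(\<Sum>i\<in>{1..n}. d i * p i) = (\<Sum>k<length js. (- 1) ^ k * p (js ! k))"
    by (rule s)
  have "length js = card {i \<in> {1..n}. odd (q i)}"
    using distinct_card[OF assms(1)] assms(2) by simp
  then show "(\<Sum>i\<in>{1..n}. d i) = 0"
    using s[of "\<lambda>_. 1"] sum_alternating_even[of "length js"] assms(3) by simp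
qed

lemma holonomy_cong:
  "(\<And>t. t \<in> {0..1} \<Longrightarrow> \<gamma> t = \<delta> t) \<Longrightarrow> holonomy \<gamma> = holonomy \<delta>"
  unfolding holonomy_def by (metis (lifting))

text \<open>The value 0 off the singular simplices is what \<open>cochain_group\<close>
  demands.\<close>

definition holonomy_cochain :: "'m topology \<Rightarrow> ('m \<Rightarrow> complex \<times> complex \<times> complex) \<Rightarrow> ((nat \<Rightarrow> real) \<Rightarrow> 'm) \<Rightarrow> bit" where
  "holonomy_cochain M F \<sigma> = (if singular_simplex 1 M \<sigma> then holonomy (\<lambda>t. F (\<sigma> (edge_point t))) else 0)"

lemma holonomy_cochain_cocycle:
  assumes F: "continuous_map M euclidean F" "\<And>x. x \<in> topspace M \<Longrightarrow> F x \<in> veronese_cone"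
  shows "holonomy_cochain M F \<in> cocycles 1 M"
proof -
  have "coboundary 1 M (holonomy_cochain M F) \<sigma> = 0" for \<sigma>
  proof (cases "singular_simplex 2 M \<sigma>")
    case True
    note c = continuous_map_simplex_triangle[OF True]
    define g where "g z = F (\<sigma> (triangle_point z))" for z
    have g: "continuous_on std_triangle g"
      using continuous_map_compose[OF c F(1)] by (simp add: g_def o_def)
    have g': "g z \<in> veronese_cone" if "z \<in> std_triangle" for z
      unfolding g_def using continuous_map_image_subset_topspace[OF c] that by (auto intro!: F(2))
    have face: "singular_simplex 1 M (singular_face 2 k \<sigma>)" if "k \<le> 2" for k
      using singular_simplex_singular_face[OF True, of k] that by simp
    have hc: "holonomy_cochain M F (singular_face 2 k \<sigma>) = holonomy (\<lambda>t. F (singular_face 2 k \<sigma> (edge_point t)))"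
      if "k \<le> 2" for k
      unfolding holonomy_cochain_def using face[OF that] by simp
    have h: "holonomy_cochain M F (singular_face 2 0 \<sigma>) = holonomy (\<lambda>t. g (1 - t, t))"
      unfolding hc[OF le0] g_def by (rule holonomy_cong) (simp add: singular_face_edge_point)
    have h1: "holonomy_cochain M F (singular_face 2 1 \<sigma>) = holonomy (\<lambda>t. g (0, t))"
      unfolding hc[OF one_le_numeral] g_def by (rule holonomy_cong) (simp add: singular_face_edge_point)
    have h2: "holonomy_cochain M F (singular_face 2 2 \<sigma>) = holonomy (\<lambda>t. g (t, 0))"
      unfolding hc[OF order.refl] g_def by (rule holonomy_cong) (simp add: singular_face_edge_point)
    have "coboundary 1 M (holonomy_cochain M F) \<sigma>
      = holonomy_cochain M F (singular_face 2 0 \<sigma>) + holonomy_cochain M F (singular_face 2 1 \<sigma>)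
        + holonomy_cochain M F (singular_face 2 2 \<sigma>)"
      using True by (simp add: coboundary_def numeral_2_eq_2)
    also have "\<dots> = 0"
      unfolding h h1 h2 using holonomy_triangle[OF g g']
      by (cases "holonomy (\<lambda>t. g (t, 0))"; cases "holonomy (\<lambda>t. g (1 - t, t))";
          cases "holonomy (\<lambda>t. g (0, t))") simp_all
    finally show ?thesis .
  qed (simp add: coboundary_def numeral_2_eq_2)
  then have "coboundary 1 M (holonomy_cochain M F) = (\<lambda>\<sigma>. 0)" ..
  then show ?thesis
    by (simp add: cocycles_def cochain_group_def holonomy_cochain_def)
qed

lemma zero_in_coboundaries: "(\<lambda>\<sigma>. 0) \<in> coboundaries p X"
proof (cases "p = 0")
  case False
  have "coboundary (p - 1) X (\<lambda>\<sigma>. 0) = (\<lambda>\<sigma>. 0)" by (auto simp: coboundary_def fun_eq_iff)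
  moreover have "(\<lambda>\<sigma>. 0) \<in> carrier (cochain_group (p - 1) X)" by (simp add: cochain_group_def)
  ultimately show ?thesis using False unfolding coboundaries_def by (metis image_eqI)
qed (simp add: coboundaries_def)

lemma cochain_in_coset: "c \<in> coboundaries p X #>\<^bsub>cochain_group p X\<^esub> c"
  unfolding r_coset_def using zero_in_coboundaries[of p X]
  by (intro UN_I[where a = "\<lambda>\<sigma>. 0"]) (auto simp: cochain_group_def)

text \<open>\<open>cup\<close> is a union over representatives, so the cube of the class of
  \<open>c\<close> contains the cochain cube of \<open>c\<close>. Were it the unit of the third
  cohomology group, which is the set of coboundaries, this cochain would be a coboundary.\<close>

lemma essential_class_exists:
  assumes c: "c \<in> cocycles 1 M"
    and w: "\<And>w. coboundary 2 M w \<noteq> cochain_cup 2 1 M (cochain_cup 1 1 M c c) c"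
  shows "\<exists>x \<in> carrier (cohomology_group 1 M). essential M x"
proof -
  define G where "G = cochain_group 1 M"
  define x where "x = coboundaries 1 M #>\<^bsub>G\<^esub> c"
  have "c \<in> carrier (subgroup_generated G (cocycles 1 M))"
    unfolding subgroup_generated_def G_def using c by (auto simp: cocycles_def intro: generate.incl)
  moreover have "x = coboundaries 1 M #>\<^bsub>subgroup_generated G (cocycles 1 M)\<^esub> c"
    by (simp add: x_def r_coset_def subgroup_generated_def)
  ultimately have x: "x \<in> carrier (cohomology_group 1 M)"
    unfolding cohomology_group_def FactGroup_def RCOSETS_def G_def by auto
  have cx: "c \<in> x" unfolding x_def G_def by (rule cochain_in_coset)
  have cc: "cochain_cup 1 1 M c c \<in> cup 1 1 M x x"
    unfolding cup_def using cx cochain_in_coset by blast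
  have ccc: "cochain_cup 2 1 M (cochain_cup 1 1 M c c) c \<in> cup 2 1 M (cup 1 1 M x x) x"
    unfolding cup_def[of 2] using cx cc cochain_in_coset by blast
  have "cup 2 1 M (cup 1 1 M x x) x \<noteq> \<one>\<^bsub>cohomology_group 3 M\<^esub>"
  proof
    assume "cup 2 1 M (cup 1 1 M x x) x = \<one>\<^bsub>cohomology_group 3 M\<^esub>"
    then have "cochain_cup 2 1 M (cochain_cup 1 1 M c c) c \<in> coboundaries 3 M"
      using ccc by (simp add: cohomology_group_def FactGroup_def)
    then obtain w0 where "cochain_cup 2 1 M (cochain_cup 1 1 M c c) c = coboundary 2 M w0"
      by (auto simp: coboundaries_def)
    then show False using w[of w0] by simp
  qed
  with x show ?thesis by (auto simp: essential_def)
qed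

text \<open>A square root of the scalar lifts the scaling to \<open>C^2\<close>.\<close>

lemma cone_scale_in_veronese_cone:
  assumes "u \<noteq> 0" "w \<noteq> 0"
  shows "cone_scale u (veronese w) \<in> veronese_cone"
proof -
  have "cone_scale u (veronese w) = veronese (csqrt u * fst w, csqrt u * snd w)"
    by (simp add: veronese_scale)
  moreover have "(csqrt u * fst w, csqrt u * snd w) \<noteq> 0"
    using assms by (cases w) (auto simp: zero_prod_def)
  ultimately show ?thesis by (auto simp: veronese_cone_def)
qed

theorem theorem4p2:
  fixes M :: "'a topology" and n :: nat and p q :: "nat \<Rightarrow> int"
    and js :: "nat list" and Qs Ps :: int
  assumes "seifert_manifold M n p q"
    and "\<forall>i\<in>{1..n}. odd (p i)"
    and "even (card {i \<in> {1..n}. odd (q i)})"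
    and "Qs = (\<Sum>i\<in>{1..n}. q i)"
    and "distinct js" and "set js = {i \<in> {1..n}. odd (q i)}"
    and "Ps = (\<Sum>k<length js. (-1) ^ k * p (js ! k))"
    and "odd ((Qs + Ps) div 2)"
  shows "\<exists>x \<in> carrier (cohomology_group 1 M). essential M x"
proof -

  \<comment> \<open>Orientations, boundary chain, signs, and the function on the holed
    sphere\<close>
  let ?l = "frag_of standard_loop"
  define X2 where "X2 = 2 * complex_of_real pi * \<i>"
  have X2: "X2 \<noteq> 0" by (simp add: X2_def)
  have cop: "\<forall>i\<in>{1..n}. p i \<ge> 2 \<and> coprime (p i) (q i)"
    using assms(1) unfolding seifert_manifold_def by (rule conjunct1)
  obtain e \<zeta> \<mu> \<phi> where discs: "disjoint_discs n e" and coh: "coherently_oriented n e \<zeta> \<mu>"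
    and glue: "seifert_gluing n p q e \<zeta> \<phi>" and M: "M homeomorphic_space seifert_space n e \<phi>"
    using assms(1) unfolding seifert_manifold_def by (elim conjE exE)
  have \<zeta>: "group_generator (homology_group 1 circle) \<zeta>"
    using coh by (simp add: coherently_oriented_def Let_def)
  obtain m where m: "singular_chain 2 (holed_sphere n e) m"
    "chain_boundary 2 m = (\<Sum>i\<in>{1..n}. chain_map 1 (e i) ?l)"
    by (rule coherent_boundary_chain[OF discs coh])
  obtain d where d: "\<And>i. i \<in> {1..n} \<Longrightarrow> odd (q i) \<Longrightarrow> d i = 1 \<or> d i = - 1" "\<And>i. even (q i) \<Longrightarrow> d i = 0"
    "(\<Sum>i\<in>{1..n}. d i) = 0"
    "(\<Sum>i\<in>{1..n}. d i * p i) = (\<Sum>k<length js. (- 1) ^ k * p (js ! k))"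
    by (rule alternating_signs_exist[OF assms(5,6,3), of p]) blast
  obtain f where f: "continuous_map (holed_sphere n e) euclidean f"
    "\<And>x. x \<in> topspace (holed_sphere n e) \<Longrightarrow> f x \<noteq> 0"
    "\<And>i. i \<in> {1..n} \<Longrightarrow> log_diff (\<lambda>t. f (e i (cis (2 * pi * t)))) = of_int (d i) * (2 * of_real pi * \<i>)"
    by (rule circle_valued_map_exists[OF discs m d(3)]) blast

  \<comment> \<open>The pieces of the manifold and the function \<open>G\<close>\<close>
  define A where "A = prod_topology (holed_sphere n e) circle"
  define V where "V = prod_topology disc circle"
  let ?CC = "prod_topology circle circle"
  have CC: "?CC = top_of_set (sphere 0 1 \<times> sphere 0 1)" and V: "V = top_of_set (cball 0 1 \<times> sphere 0 1)"
    unfolding V_def by (simp_all flip: subtopology_Times)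
  define T where "T i = boundary_torus e i" for i
  have Tprod: "T i = prod_topology (top_of_set (boundary_circle e i)) circle" for i
    by (simp add: T_def boundary_torus_def)
  have TA: "continuous_map (T i) A (\<lambda>x. x)" if "i \<in> {1..n}" for i
  proof -
    have "boundary_circle e i \<subseteq> sphere 0 1 - (\<Union>j\<in>{1..n}. e j ` ball 0 1)"
      using boundary_circle_in_holed_sphere[OF discs that] by (simp add: boundary_circle_def)
    moreover have "T i = top_of_set (boundary_circle e i \<times> sphere 0 1)"
      "A = top_of_set ((sphere 0 1 - (\<Union>j\<in>{1..n}. e j ` ball 0 1)) \<times> sphere 0 1)"
      unfolding Tprod A_def holed_sphere_def by (simp_all flip: subtopology_Times)
    ultimately show ?thesis by auto
  qed
  have ec: "continuous_map circle (top_of_set (boundary_circle e i)) (e i)" if "i \<in> {1..n}" for i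
    using continuous_map_boundary_circle[OF discs that]
    by (auto simp: boundary_circle_def holed_sphere_def)
  note gl = gluing_homology[OF \<zeta> glue _ ec, folded T_def]
  have \<phi>c: "continuous_map ?CC (T i) (\<phi> i)" if "i \<in> {1..n}" for i
    using homeomorphic_imp_continuous_map[OF gl(1)[OF that that]] .
  \<comment> \<open>The second factor makes the fibre degree equal to 1; the meridian degree
    therefore picks up the term \<open>q i\<close>.\<close>
  define G where "G x = f (fst x) * snd x" for x :: "(real^3) \<times> complex"
  have G: "continuous_map A euclidean G" "\<And>x. x \<in> topspace A \<Longrightarrow> G x \<noteq> 0"
  proof -
    define Z where "Z = sphere 0 1 - (\<Union>j\<in>{1..n}. e j ` ball 0 1)"
    have Z: "A = top_of_set (Z \<times> sphere 0 1)"
      unfolding A_def holed_sphere_def Z_def by (simp flip: subtopology_Times)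
    have "continuous_on Z f" using f(1) by (simp add: holed_sphere_def Z_def)
    then have "continuous_on (Z \<times> sphere 0 1) (\<lambda>x. f (fst x))"
      by (rule continuous_on_compose2) (auto intro!: continuous_intros)
    then show "continuous_map A euclidean G"
      unfolding Z G_def by (auto intro!: continuous_intros)
    show "\<And>x. x \<in> topspace A \<Longrightarrow> G x \<noteq> 0"
      using f(2) by (auto simp: A_def G_def)
  qed
  have loop\<gamma>: "log_diff (\<lambda>t. G (e i (cis (2 * pi * t)), 1)) = of_int (d i) * X2" if "i \<in> {1..n}" for i
    using f(3)[OF that] by (simp add: G_def X2_def)
  have loop\<eta>: "log_diff (\<lambda>t. G (e i 1, cis (2 * pi * t))) = X2" if "i \<in> {1..n}" for i
  proof -
    have "e i 1 \<in> topspace (holed_sphere n e)"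
      unfolding topspace_holed_sphere
      by (rule subsetD[OF boundary_circle_in_holed_sphere[OF discs that] imageI]) simp
    then have "f (e i 1) \<noteq> 0" by (rule f(2))
    then have "log_diff (\<lambda>t. G (e i 1, cis (2 * pi * t))) = (Ln (f (e i 1)) + X2 * of_real 1) - (Ln (f (e i 1)) + X2 * of_real 0)"
      by (intro log_diff_eq) (auto simp: G_def exp_add X2_def cis_conv_exp algebra_simps intro!: continuous_intros)
    then show ?thesis by simp
  qed
  have ev: "evaluate (path_log u) (chain_map 1 h ?l) = log_diff (\<lambda>t. u (h (cis (2 * pi * t))))"
    for u :: "'x \<Rightarrow> complex" and h
    unfolding evaluate_chain_map evaluate_frag_of path_log_simplex_map unfolding path_log_def
    by (rule log_diff_cong) simp

  \<comment> \<open>Extension of \<open>G\<close> over the solid tori, with values in the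
    cone\<close>
  have "\<forall>i\<in>{1..n}. \<exists>lw :: int \<times> (complex \<times> complex \<Rightarrow> complex \<times> complex).
      continuous_on (cball 0 1 \<times> sphere 0 1) (snd lw) \<and> (\<forall>x\<in>cball 0 1 \<times> sphere 0 1. snd lw x \<noteq> 0) \<and>
      (\<forall>y\<in>sphere 0 1 \<times> sphere 0 1. cone_scale (snd y powi fst lw) (veronese (snd lw y)) = (G (\<phi> i y), 0, 0))"
  proof
    fix i assume i: "i \<in> {1..n}"
    define N where "N y = G (\<phi> i y)" for y
    have GT: "continuous_map (T i) euclidean G" "\<And>x. x \<in> topspace (T i) \<Longrightarrow> G x \<noteq> 0"
    proof -
      show "continuous_map (T i) euclidean G"
        using continuous_map_compose[OF TA[OF i] G(1)] by (simp add: o_def)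
      show "G x \<noteq> 0" if "x \<in> topspace (T i)" for x
        using continuous_map_image_subset_topspace[OF TA[OF i]] that by (intro G(2)) blast
    qed
    have N: "continuous_on (sphere 0 1 \<times> sphere 0 1) N"
      using continuous_map_compose[OF \<phi>c[OF i] GT(1)] by (simp add: N_def[abs_def] o_def CC)
    have N0: "N y \<noteq> 0" if "y \<in> sphere 0 1 \<times> sphere 0 1" for y
    proof -
      have "y \<in> topspace ?CC" using that by simp
      then have "\<phi> i y \<in> topspace (T i)"
        using continuous_map_image_subset_topspace[OF \<phi>c[OF i]] by blast
      then show ?thesis unfolding N_def by (rule GT(2))
    qed
    have "log_diff (\<lambda>t. N (cis (2 * pi * t), 1)) = of_int (p i * d i + q i) * X2"
      using path_log_homologous[OF GT gl(2)[OF i i]]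
      unfolding evaluate_add evaluate_cmul ev loop\<gamma>[OF i] loop\<eta>[OF i] N_def
      by (simp add: algebra_simps)
    \<comment> \<open>For odd \<open>q i\<close> both terms are odd, as \<open>p i\<close> is odd
      and \<open>d i\<close> is a sign; for even \<open>q i\<close> the sign is 0.\<close>
    moreover have "even (p i * d i + q i)"
      using d(1)[OF i] d(2)[of i] assms(2) i by (cases "even (q i)") auto
    then obtain k where "p i * d i + q i = 2 * k" by blast
    ultimately have lm: "log_diff (\<lambda>t. N (cis (2 * pi * t), 1)) = of_int (2 * k) * (2 * of_real pi * \<i>)"
      by (simp add: X2_def)
    have NC: "continuous_map circle euclidean (\<lambda>z. N (1, z))"
    proof -
      have "continuous_on (sphere 0 1) (\<lambda>z. N (1, z))"
      proof (rule continuous_on_compose2[OF N])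
        show "continuous_on (sphere 0 1) (\<lambda>z. (1, z))" by (intro continuous_intros)
      qed auto
      then show ?thesis by simp
    qed
    have NC0: "N (1, z) \<noteq> 0" if "z \<in> topspace circle" for z
      using N0[of "(1, z)"] that by auto
    \<comment> \<open>The gluing prescribes only the class of the meridian; \<open>l\<close> absorbs
      whatever happens in the core direction.\<close>
    obtain l :: int where "evaluate (path_log (\<lambda>z. N (1, z))) ?l = of_int l * (2 * of_real pi * \<i>)"
      using path_log_cycle_integral[OF NC NC0 singular_relcycle_standard_loop] ..
    then have ll: "log_diff (\<lambda>t. N (1, cis (2 * pi * t))) = of_int l * (2 * of_real pi * \<i>)"
      unfolding evaluate_frag_of path_log_def
      using log_diff_cong[of "\<lambda>t. N (1, standard_loop (edge_point t))" "\<lambda>t. N (1, cis (2 * pi * t))"] by simp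
    obtain w where w: "continuous_on (cball 0 1 \<times> sphere 0 1) w"
      "\<And>x. x \<in> cball 0 1 \<times> sphere 0 1 \<Longrightarrow> w x \<noteq> 0"
      "\<And>t z. t \<in> sphere 0 1 \<Longrightarrow> z \<in> sphere 0 1 \<Longrightarrow> cone_scale (z powi l) (veronese (w (t, z))) = (N (t, z), 0, 0)"
    proof (rule solid_torus_extension[OF N N0 lm ll])
      fix w assume "continuous_on (cball 0 1 \<times> sphere 0 1) w"
        "\<And>x. x \<in> cball 0 1 \<times> sphere 0 1 \<Longrightarrow> w x \<noteq> 0"
        "\<And>t z. t \<in> sphere 0 1 \<Longrightarrow> z \<in> sphere 0 1 \<Longrightarrow> cone_scale (z powi l) (veronese (w (t, z))) = (N (t, z), 0, 0)"
      then show thesis by (rule that)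
    qed
    show "\<exists>lw :: int \<times> (complex \<times> complex \<Rightarrow> complex \<times> complex).
      continuous_on (cball 0 1 \<times> sphere 0 1) (snd lw) \<and> (\<forall>x\<in>cball 0 1 \<times> sphere 0 1. snd lw x \<noteq> 0) \<and>
      (\<forall>y\<in>sphere 0 1 \<times> sphere 0 1. cone_scale (snd y powi fst lw) (veronese (snd lw y)) = (G (\<phi> i y), 0, 0))"
    proof (intro exI[of _ "(l, w)"] conjI ballI)
      fix y :: "complex \<times> complex" assume "y \<in> sphere 0 1 \<times> sphere 0 1"
      then obtain t z where "y = (t, z)" "t \<in> sphere 0 1" "z \<in> sphere 0 1" by (rule SigmaE)
      then show "cone_scale (snd y powi fst (l, w)) (veronese (snd (l, w) y)) = (G (\<phi> i y), 0, 0)"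
        using w(3)[of t z] by (simp add: N_def)
    qed (use w in simp_all)
  qed
  from bchoice[OF this] obtain lw :: "nat \<Rightarrow> int \<times> (complex \<times> complex \<Rightarrow> complex \<times> complex)" where
    lw: "\<forall>i\<in>{1..n}. continuous_on (cball 0 1 \<times> sphere 0 1) (snd (lw i)) \<and> (\<forall>x\<in>cball 0 1 \<times> sphere 0 1. snd (lw i) x \<noteq> 0) \<and>
      (\<forall>y\<in>sphere 0 1 \<times> sphere 0 1. cone_scale (snd y powi fst (lw i)) (veronese (snd (lw i) y)) = (G (\<phi> i y), 0, 0))" ..
  define u where "u i y = snd y powi fst (lw i)" for i and y :: "complex \<times> complex"
  have u: "continuous_map V euclidean (u i)" "\<And>y. y \<in> topspace V \<Longrightarrow> u i y \<noteq> 0" for i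
    unfolding V u_def by (auto intro!: continuous_on_power_int continuous_intros simp: power_int_eq_0_iff)
  have wV: "continuous_map V euclidean (snd (lw i))" "\<And>y. y \<in> topspace V \<Longrightarrow> snd (lw i) y \<noteq> 0"
    if "i \<in> {1..n}" for i
    using bspec[OF lw that] unfolding V by auto
  define b where "b i y = cone_scale (u i y) (veronese (snd (lw i) y))" for i y
  have bc: "continuous_map V euclidean (b i)" if "i \<in> {1..n}" for i
    using u(1)[of i] wV(1)[OF that]
    unfolding V b_def cone_scale_def veronese_def case_prod_beta
    by (auto intro!: continuous_intros)
  have \<phi>A: "\<phi> i y \<in> topspace A" if "i \<in> {1..n}" "y \<in> sphere 0 1 \<times> sphere 0 1" for i y
  proof -
    have "y \<in> topspace ?CC" using that(2) by simp
    then show ?thesis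
      using continuous_map_image_subset_topspace[OF continuous_map_compose[OF \<phi>c[OF that(1)] TA[OF that(1)]]]
      unfolding o_def by blast
  qed

  \<comment> \<open>The global map \<open>F\<close> into the punctured cone\<close>
  obtain jA jV where
    jA: "continuous_map A M jA" and jV: "\<And>i. i \<in> {1..n} \<Longrightarrow> continuous_map V M (jV i)"
    and jj: "\<And>i y. i \<in> {1..n} \<Longrightarrow> y \<in> sphere 0 1 \<times> sphere 0 1 \<Longrightarrow> jV i y = jA (\<phi> i y)"
    and Mtop: "topspace M = jA ` topspace A \<union> (\<Union>i\<in>{1..n}. jV i ` topspace V)"
    and univ: "\<forall>(a :: (real^3) \<times> complex \<Rightarrow> complex \<times> complex \<times> complex) b.
      continuous_map A euclidean a \<longrightarrow> (\<forall>i\<in>{1..n}. continuous_map V euclidean (b i)) \<longrightarrow>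
      (\<forall>i\<in>{1..n}. \<forall>y\<in>sphere 0 1 \<times> sphere 0 1. b i y = a (\<phi> i y)) \<longrightarrow>
      (\<exists>F. continuous_map M euclidean F \<and> (\<forall>x\<in>topspace A. F (jA x) = a x) \<and>
        (\<forall>i\<in>{1..n}. \<forall>y\<in>topspace V. F (jV i y) = b i y))"
  proof (rule seifert_space_maps[OF M \<phi>A[unfolded A_def], folded A_def V_def])
    fix jA jV
    assume "continuous_map A M jA" "\<And>i. i \<in> {1..n} \<Longrightarrow> continuous_map V M (jV i)"
      "\<And>i y. i \<in> {1..n} \<Longrightarrow> y \<in> sphere 0 1 \<times> sphere 0 1 \<Longrightarrow> jV i y = jA (\<phi> i y)"
      "topspace M = jA ` topspace A \<union> (\<Union>i\<in>{1..n}. jV i ` topspace V)"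
      "\<forall>(a :: (real^3) \<times> complex \<Rightarrow> complex \<times> complex \<times> complex) b.
        continuous_map A euclidean a \<longrightarrow> (\<forall>i\<in>{1..n}. continuous_map V euclidean (b i)) \<longrightarrow>
        (\<forall>i\<in>{1..n}. \<forall>y\<in>sphere 0 1 \<times> sphere 0 1. b i y = a (\<phi> i y)) \<longrightarrow>
        (\<exists>F. continuous_map M euclidean F \<and> (\<forall>x\<in>topspace A. F (jA x) = a x) \<and>
          (\<forall>i\<in>{1..n}. \<forall>y\<in>topspace V. F (jV i y) = b i y))"
    then show thesis by (rule that)
  qed
  have Ga: "continuous_map A euclidean (\<lambda>x. (G x, 0 :: complex, 0 :: complex))"
  proof -
    have "continuous_map euclidean euclidean (\<lambda>z :: complex. (z, 0 :: complex, 0 :: complex))"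
      by (auto intro!: continuous_intros)
    from continuous_map_compose[OF G(1) this] show ?thesis by (simp add: o_def)
  qed
  have compat: "b i y = (G (\<phi> i y), 0, 0)" if "i \<in> {1..n}" "y \<in> sphere 0 1 \<times> sphere 0 1" for i y
    unfolding b_def u_def using conjunct2[OF conjunct2[OF bspec[OF lw that(1)]]] that(2) by (rule bspec)
  from univ[rule_format, OF Ga bc compat] obtain F where
    Fall: "continuous_map M euclidean F \<and> (\<forall>x\<in>topspace A. F (jA x) = (G x, 0, 0)) \<and>
      (\<forall>i\<in>{1..n}. \<forall>y\<in>topspace V. F (jV i y) = b i y)" ..
  have F: "continuous_map M euclidean F" "\<And>x. x \<in> topspace A \<Longrightarrow> F (jA x) = (G x, 0, 0)"
    "\<And>i y. i \<in> {1..n} \<Longrightarrow> y \<in> topspace V \<Longrightarrow> F (jV i y) = b i y"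
    using Fall by simp_all
  \<comment> \<open>Brings \<open>F\<close> on \<open>A\<close> into the form of a scalar times a
    vector that lifts globally, here the constant \<open>(1, 0)\<close>, so that \<open>G\<close>
    alone carries the holonomy.\<close>
  have one: "(G x, 0, 0) = cone_scale (G x) (veronese (1, 0))" for x
    by (simp add: cone_scale_def veronese_def)
  have e10: "((1, 0) :: complex \<times> complex) \<noteq> 0" by (simp add: zero_prod_def)
  have Fcone: "F x \<in> veronese_cone" if "x \<in> topspace M" for x
  proof -
    from that consider z where "z \<in> topspace A" "x = jA z"
      | i y where "i \<in> {1..n}" "y \<in> topspace V" "x = jV i y"
      unfolding Mtop by blast
    then show ?thesis
    proof cases
      case 1
      then show ?thesis
        using cone_scale_in_veronese_cone[OF G(2)[OF 1(1)] e10] by (simp add: F(2) one)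
    next
      case 2
      then show ?thesis
        using cone_scale_in_veronese_cone[OF u(2)[OF 2(2)] wV(2)[OF 2(1,2)]] by (simp add: F(3) b_def)
    qed
  qed

  \<comment> \<open>The mod 2 class and its integral lifts on the pieces\<close>
  define c where "c = holonomy_cochain M F"
  have c_map: "c (simplex_map 1 j \<sigma>) = holonomy (\<lambda>t. F (j (\<sigma> (edge_point t))))"
    if "continuous_map X M j" "singular_simplex 1 X \<sigma>" for X :: "'x topology" and j \<sigma>
    using singular_simplex_simplex_map[OF that(2,1)] unfolding c_def holonomy_cochain_def
    by (auto intro!: holonomy_cong simp: simplex_map_def)
  have "\<exists>g :: ((nat \<Rightarrow> real) \<Rightarrow> (real^3) \<times> complex) \<Rightarrow> int.
    (\<forall>\<sigma>. singular_simplex 1 A \<sigma> \<longrightarrow> of_int (g \<sigma>) = holonomy (\<lambda>t. F (jA (\<sigma> (edge_point t))))) \<and>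
    (\<forall>\<sigma>. singular_simplex 2 A \<sigma> \<longrightarrow> g (singular_face 2 0 \<sigma>) + g (singular_face 2 2 \<sigma>) = g (singular_face 2 1 \<sigma>)) \<and>
    (\<forall>\<sigma>. singular_simplex 1 A \<sigma> \<longrightarrow> \<sigma> (edge_point 0) = \<sigma> (edge_point 1) \<longrightarrow>
       of_int (g \<sigma>) * (2 * of_real pi * \<i>) = log_diff (\<lambda>t. G (\<sigma> (edge_point t))))"
  proof (rule integer_lift_of_holonomy[OF G, of "\<lambda>_. (1, 0)" "\<lambda>x. F (jA x)"])
    show "continuous_map A euclidean (\<lambda>_. (1, 0) :: complex \<times> complex)" by simp
    show "F (jA x) = cone_scale (G x) (veronese (1, 0))" if "x \<in> topspace A" for x
      using F(2)[OF that] one by simp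
  qed (use e10 in auto)
  then obtain g :: "((nat \<Rightarrow> real) \<Rightarrow> (real^3) \<times> complex) \<Rightarrow> int" where
    g1: "\<forall>\<sigma>. singular_simplex 1 A \<sigma> \<longrightarrow> of_int (g \<sigma>) = holonomy (\<lambda>t. F (jA (\<sigma> (edge_point t))))" and
    g2: "\<forall>\<sigma>. singular_simplex 2 A \<sigma> \<longrightarrow> g (singular_face 2 0 \<sigma>) + g (singular_face 2 2 \<sigma>) = g (singular_face 2 1 \<sigma>)" and
    g3: "\<forall>\<sigma>. singular_simplex 1 A \<sigma> \<longrightarrow> \<sigma> (edge_point 0) = \<sigma> (edge_point 1) \<longrightarrow>
       of_int (g \<sigma>) * (2 * of_real pi * \<i>) = log_diff (\<lambda>t. G (\<sigma> (edge_point t)))"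
    by (elim exE conjE)
  note g = g1[rule_format] g2[rule_format] g3[rule_format]
  have "\<forall>i\<in>{1..n}. \<exists>r :: ((nat \<Rightarrow> real) \<Rightarrow> complex \<times> complex) \<Rightarrow> int.
    (\<forall>\<sigma>. singular_simplex 1 V \<sigma> \<longrightarrow> of_int (r \<sigma>) = holonomy (\<lambda>t. F (jV i (\<sigma> (edge_point t))))) \<and>
    (\<forall>\<sigma>. singular_simplex 2 V \<sigma> \<longrightarrow> r (singular_face 2 0 \<sigma>) + r (singular_face 2 2 \<sigma>) = r (singular_face 2 1 \<sigma>)) \<and>
    (\<forall>\<sigma>. singular_simplex 1 V \<sigma> \<longrightarrow> \<sigma> (edge_point 0) = \<sigma> (edge_point 1) \<longrightarrow>
       of_int (r \<sigma>) * (2 * of_real pi * \<i>) = log_diff (\<lambda>t. u i (\<sigma> (edge_point t))))"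
  proof
    fix i assume i: "i \<in> {1..n}"
    show "\<exists>r :: ((nat \<Rightarrow> real) \<Rightarrow> complex \<times> complex) \<Rightarrow> int.
    (\<forall>\<sigma>. singular_simplex 1 V \<sigma> \<longrightarrow> of_int (r \<sigma>) = holonomy (\<lambda>t. F (jV i (\<sigma> (edge_point t))))) \<and>
    (\<forall>\<sigma>. singular_simplex 2 V \<sigma> \<longrightarrow> r (singular_face 2 0 \<sigma>) + r (singular_face 2 2 \<sigma>) = r (singular_face 2 1 \<sigma>)) \<and>
    (\<forall>\<sigma>. singular_simplex 1 V \<sigma> \<longrightarrow> \<sigma> (edge_point 0) = \<sigma> (edge_point 1) \<longrightarrow>
       of_int (r \<sigma>) * (2 * of_real pi * \<i>) = log_diff (\<lambda>t. u i (\<sigma> (edge_point t))))"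
      by (rule integer_lift_of_holonomy[OF u(1)[of i] u(2) wV[OF i], of "\<lambda>y. F (jV i y)"])
        (auto simp: F(3)[OF i] b_def)
  qed
  from bchoice[OF this] obtain r where r: "\<forall>i\<in>{1..n}.
    (\<forall>\<sigma>. singular_simplex 1 V \<sigma> \<longrightarrow> of_int (r i \<sigma>) = holonomy (\<lambda>t. F (jV i (\<sigma> (edge_point t))))) \<and>
    (\<forall>\<sigma>. singular_simplex 2 V \<sigma> \<longrightarrow> r i (singular_face 2 0 \<sigma>) + r i (singular_face 2 2 \<sigma>) = r i (singular_face 2 1 \<sigma>)) \<and>
    (\<forall>\<sigma>. singular_simplex 1 V \<sigma> \<longrightarrow> \<sigma> (edge_point 0) = \<sigma> (edge_point 1) \<longrightarrow>
       of_int (r i \<sigma>) * (2 * of_real pi * \<i>) = log_diff (\<lambda>t. u i (\<sigma> (edge_point t))))" ..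

  \<comment> \<open>The cube of \<open>c\<close> is not a coboundary\<close>
  show ?thesis
  proof (rule essential_class_exists)
    show "c \<in> cocycles 1 M"
      unfolding c_def by (rule holonomy_cochain_cocycle[OF F(1) Fcone])
    fix w :: "((nat \<Rightarrow> real) \<Rightarrow> 'a) \<Rightarrow> bit"
    show "coboundary 2 M w \<noteq> cochain_cup 2 1 M (cochain_cup 1 1 M c c) c"
    proof
      assume "coboundary 2 M w = cochain_cup 2 1 M (cochain_cup 1 1 M c c) c"
      then have cube: "cube_primitive M c w" by (rule cube_primitive_coboundary)
      define D where "D = half_defect g (\<lambda>\<sigma>. w (simplex_map 2 jA \<sigma>))"
      have gc: "of_int (g \<sigma>) = c (simplex_map 1 jA \<sigma>)" if "singular_simplex 1 A \<sigma>" for \<sigma>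
        using g(1)[OF that] c_map[OF jA that] by simp
      have "circle_slant D (simplex_map 1 (e i) standard_loop) = of_int ((q i + d i * p i) div 2)"
        if i: "i \<in> {1..n}" for i
        unfolding D_def
      proof (rule torus_contribution[unfolded chain_map_of, OF gl(1)[OF i i, unfolded Tprod] ec[OF i]
            gl(2)[OF i i, unfolded Tprod chain_map_of] jV[OF i, unfolded V_def] _ cube, where l = "fst (lw i)"])
        have s: "singular_simplex 1 A \<sigma>" if "singular_simplex 1 (prod_topology (top_of_set (boundary_circle e i)) circle) \<sigma>" for \<sigma>
          using singular_simplex_weaken[OF TA[OF i], of 1 \<sigma>] that by (simp add: Tprod)
        show "jV i y = jA (\<phi> i y)" if "y \<in> topspace ?CC" for y
          using jj[OF i] that by simp
        show "of_int (g \<sigma>) = c (simplex_map 1 jA \<sigma>)"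
          if "singular_simplex 1 (prod_topology (top_of_set (boundary_circle e i)) circle) \<sigma>" for \<sigma>
          by (rule gc[OF s[OF that]])
        \<comment> \<open>On a closed simplex \<open>g\<close> is the winding number of
          \<open>G\<close>; this gives the values on the boundary circle and the fibre.\<close>
        have val: "g (simplex_map 1 h standard_loop) = k"
          if "continuous_map circle A h" "log_diff (\<lambda>t. G (h (cis (2 * pi * t)))) = of_int k * X2" for h k
        proof -
          have "of_int (g (simplex_map 1 h standard_loop)) * X2
            = log_diff (\<lambda>t. G (simplex_map 1 h standard_loop (edge_point t)))"
            unfolding X2_def
            by (rule g(3)[OF singular_simplex_simplex_map[OF singular_simplex_standard_loop that(1)]])
              (simp add: simplex_map_def)
          also have "\<dots> = of_int k * X2"
            unfolding that(2)[symmetric] by (rule log_diff_cong) (simp add: simplex_map_def)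
          finally show ?thesis using X2 by simp
        qed
        have hol: "e i z \<in> sphere 0 1 - (\<Union>j\<in>{1..n}. e j ` ball 0 1)" if "z \<in> sphere 0 1" for z
          by (rule subsetD[OF boundary_circle_in_holed_sphere[OF discs i] imageI[OF that]])
        show "g (simplex_map 1 (\<lambda>z. (e i z, 1)) standard_loop) = d i"
          by (rule val)
            (use loop\<gamma>[OF i] continuous_map_boundary_circle[OF discs i] in \<open>auto simp: A_def continuous_map_paired\<close>)
        show "g (simplex_map 1 (\<lambda>z. (e i 1, z)) standard_loop) = 1"
          by (rule val)
            (use loop\<eta>[OF i] hol[of 1] in \<open>auto simp: A_def continuous_map_paired\<close>)
        show "of_int (r i \<sigma>) = c (simplex_map 1 (jV i) \<sigma>)" if "singular_simplex 1 (prod_topology disc circle) \<sigma>" for \<sigma>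
          using bspec[OF r i] c_map[OF jV[OF i], of \<sigma>] that by (simp add: V_def)
        show "r i (singular_face 2 0 \<sigma>) + r i (singular_face 2 2 \<sigma>) = r i (singular_face 2 1 \<sigma>)"
          if "singular_simplex 2 (prod_topology disc circle) \<sigma>" for \<sigma>
          using bspec[OF r i] that by (simp add: V_def)
        show "of_int (r i \<sigma>) * (2 * of_real pi * \<i>) = log_diff (\<lambda>t. snd (\<sigma> (edge_point t)) powi fst (lw i))"
          if "singular_simplex 1 (prod_topology disc circle) \<sigma>" "\<sigma> (edge_point 0) = \<sigma> (edge_point 1)" for \<sigma>
          using bspec[OF r i] that by (simp add: V_def u_def)
        show "coprime (p i) (q i)" "odd (p i)" using cop assms(2) i by auto
        show "odd (q i) \<Longrightarrow> d i = 1 \<or> d i = - 1" "even (q i) \<Longrightarrow> d i = 0" using d(1)[OF i] d(2) by auto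
      qed
      note contrib = this
      \<comment> \<open>The tori together bound in \<open>A\<close>: slanting moves the statement to
        the holed sphere, where the circles bound \<open>m\<close>. The sum of all values in
        \<open>contrib\<close> is therefore 0.\<close>
      have "evaluate (circle_slant D) (chain_boundary 2 m) = 0"
      proof (rule evaluate_chain_boundary_0[OF m(1)], rule circle_slant_cocycle)
        show "evaluate D (chain_boundary 3 (frag_of \<tau>)) = 0"
          if "singular_simplex 3 (prod_topology (holed_sphere n e) circle) \<tau>" for \<tau>
          unfolding D_def
          by (rule half_defect_cocycle[OF cube_primitive_pullback[OF cube jA] gc g(2)])
            (use that in \<open>simp_all add: A_def\<close>)
      qed
      then have "(\<Sum>i\<in>{1..n}. circle_slant D (simplex_map 1 (e i) standard_loop)) = 0"
        unfolding m(2) evaluate_sum chain_map_of evaluate_frag_of .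
      then have "of_int (\<Sum>i\<in>{1..n}. (q i + d i * p i) div 2) = (0 :: bit)"
        unfolding of_int_sum using contrib by simp
      moreover have "(\<Sum>i\<in>{1..n}. (q i + d i * p i) div 2) = (Qs + Ps) div 2"
      proof -
        \<comment> \<open>Each numerator is even by the parity of \<open>p i\<close> and the choice
          of \<open>d i\<close>, so the halves add up without rounding.\<close>
        have "2 * ((q i + d i * p i) div 2) = q i + d i * p i" if i: "i \<in> {1..n}" for i
          using d(1)[OF i] d(2)[of i] assms(2) i by (cases "even (q i)") auto
        then have "2 * (\<Sum>i\<in>{1..n}. (q i + d i * p i) div 2) = (\<Sum>i\<in>{1..n}. q i + d i * p i)"
          unfolding sum_distrib_left by (rule sum.cong[OF refl])
        also have "\<dots> = Qs + Ps"
          unfolding sum.distrib assms(4,7) d(4) ..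
        finally show ?thesis by simp
      qed
      ultimately show False using assms(8) by (simp add: of_int_bit)
    qed
  qed
qed

end
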